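(* Let $-1<p<1$, $p\ne0$, and let $K$ and $L$ be origin-symmetric convex bodies in $\mathbb{R}^n$ such that $\Gamma^*_pK\subset\Gamma^*_pL$. Then: (i) if $0<p<1$ and $n=2$, then $\mathrm{vol}(L)\le\mathrm{vol}(K)$; (ii) if $-1<p<0$ and $n=2$ or $n=3$, then $\mathrm{vol}(L)\le\mathrm{vol}(K)$.
   Context: A convex body is a compact convex set with non-empty interior in $\mathbb{R}^n$; $\mathrm{vol}$ denotes $n$-dimensional Lebesgue measure, and $(x,\xi)$ is the standard inner product. Polar $p$-centroid body: for $p>-1$, $p\ne 0$, the polar $p$-centroid body $\Gamma^*_pK$ of $K$ is the (possibly non-convex) body $\Gamma_p^*K=\{\xi:\|\xi\|_{\Gamma^*_pK}\le 1\}$ whose Minkowski functional is $$\|\xi\|_{\Gamma^*_p K}=\left(\frac{1}{\mathrm{vol}(K)}\int_K|(x,\xi)|^p\,dx\right)^{1/p},\quad \xi\in\mathbb{R}^n\setminus\{0\}.$$ *)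

theory Defs
  imports "HOL-Analysis.Analysis"
begin

definition convex_body :: "(real ^ 'n) set \<Rightarrow> bool" where
  "convex_body K \<longleftrightarrow> compact K \<and> convex K \<and> interior K \<noteq> {}"

definition origin_symmetric :: "(real ^ 'n) set \<Rightarrow> bool" where
  "origin_symmetric K \<longleftrightarrow> uminus ` K = K"

text \<open>
  The Minkowski functional is extended by 0 to the origin, as for every star body. For
  negative p, the value \<open>0 powr p = 0\<close> on the hyperplane orthogonal to \<open>\<xi>\<close>
  is immaterial, since that hyperplane is a null set for nonzero \<open>\<xi>\<close>.
\<close>

definition polar_centroid_functional ::
    "real \<Rightarrow> (real ^ 'n) set \<Rightarrow> real ^ 'n \<Rightarrow> real" where
  "polar_centroid_functional p K \<xi> =
     (if \<xi> = 0 then 0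
      else (1 / measure lebesgue K *
             (LINT x:K|lebesgue. \<bar>x \<bullet> \<xi>\<bar> powr p)) powr (1 / p))"

definition polar_centroid_body :: "real \<Rightarrow> (real ^ 'n) set \<Rightarrow> (real ^ 'n) set" where
  "polar_centroid_body p K = {\<xi>. polar_centroid_functional p K \<xi> \<le> 1}"

end

theory Submission
  imports Defs "HOL-Real_Asymp.Real_Asymp"
begin

text \<open>
  If \<open>\<parallel>\<cdot>\<parallel>\<^sub>K\<^sup>p\<close> is a positive mixture of the functions \<open>\<bar>x \<bullet> \<xi>\<bar>\<^sup>p\<close>, the inclusion of the centroid bodies
  can be integrated over \<open>\<xi>\<close> and compares the means of \<open>\<parallel>\<cdot>\<parallel>\<^sub>K\<^sup>p\<close> over \<open>K\<close> and over \<open>L\<close>. Among bodies of the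
  volume of \<open>L\<close> the mean is extremal for the dilate \<open>cK\<close>, so this forces \<open>c \<le> 1\<close>.

  In the plane, \<open>\<parallel>\<cdot>\<parallel>\<^sub>K\<close> is a limit of sums \<open>\<Sum>\<^sub>i \<bar>x \<bullet> \<eta>\<^sub>i\<bar>\<close>, and if \<open>C\<^sub>i\<close> are independent standard Cauchy variables then
  \<open>\<Sum>\<^sub>i C\<^sub>i (x \<bullet> \<eta>\<^sub>i)\<close> is distributed as \<open>(\<Sum>\<^sub>i \<bar>x \<bullet> \<eta>\<^sub>i\<bar>) C\<^sub>1\<close>, whose \<open>p\<close>-th absolute moment is finite for
  \<open>-1 < p < 1\<close>. In three-dimensional space and for \<open>p = -q < 0\<close>, \<open>\<parallel>x\<parallel>\<^sub>K\<^sup>-\<^sup>q\<close> is a multiple of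
  \<open>\<integral> \<bar>s\<bar>\<^sup>q\<^sup>-\<^sup>1 1\<^sub>K(s x) ds\<close>. Smoothing \<open>1\<^sub>K\<close> by a product of Cauchy densities, which is a superposition of the
  plane waves \<open>Re (M + i (z \<bullet> \<xi>))\<^sup>-\<^sup>3\<close>, writes this as a mixture of \<open>\<bar>x \<bullet> \<xi>\<bar>\<^sup>-\<^sup>q\<close>; its weights are
  nonnegative because parallel sections of a symmetric convex body are largest through the centre.
\<close>

subsection \<open>Norms and convex bodies\<close>

text \<open>Both signs of p lead to c \<le> 1 because two reversals cancel: for p < 0 removing the
  outer power 1/p turns the comparison of directional moments around, and the extremal property of
  the dilate turns around as well. No representing measure over directions is constructed. The
  comparison of moments that such a measure would give is itself the notion to be proved, since it
  passes to limits without any convergence of the mixtures. The obstacle in dimension three is that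
  plane waves change sign. With a positive smoothing parameter all integrals converge absolutely, so
  that Fubini applies and the sign of the weights can be read off after integration over the body.
  The smoothing is then removed by a one-sided squeeze: lower semicontinuity of chord moments for
  one measure, maximality of the central chord for the other. The exponent -3 is the dimension: each
  of two integrations over directions lowers it by one and splits off one coordinate factor, and the
  last factor is what remains. The bound q < 1 makes the singularity of the mixed functions
  integrable and makes the power with exponent q - 1 decreasing, which is the origin of the
  positivity.\<close>

abbreviation directional_moment :: "real \<Rightarrow> 'a::euclidean_space measure \<Rightarrow> 'a \<Rightarrow> ennreal" where
  "directional_moment p \<mu> \<xi> \<equiv> (\<integral>\<^sup>+x. ennreal (\<bar>x \<bullet> \<xi>\<bar> powr p) \<partial>\<mu>)"

abbreviation norm_moment :: "real \<Rightarrow> 'a measure \<Rightarrow> ('a \<Rightarrow> real) \<Rightarrow> ennreal" where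
  "norm_moment p \<mu> N \<equiv> (\<integral>\<^sup>+x. ennreal (N x powr p) \<partial>\<mu>)"


definition norm_fun :: "('a::euclidean_space \<Rightarrow> real) \<Rightarrow> bool" where
  "norm_fun N \<longleftrightarrow> (\<forall>x y. N (x + y) \<le> N x + N y) \<and> (\<forall>c x. N (c *\<^sub>R x) = \<bar>c\<bar> * N x) \<and>
    (\<forall>x. x \<noteq> 0 \<longrightarrow> 0 < N x)"

lemma norm_fun_triangle: "norm_fun N \<Longrightarrow> N (x + y) \<le> N x + N y"
  and norm_fun_scaleR: "norm_fun N \<Longrightarrow> N (c *\<^sub>R x) = \<bar>c\<bar> * N x"
  and norm_fun_pos: "norm_fun N \<Longrightarrow> x \<noteq> 0 \<Longrightarrow> 0 < N x"
  by (auto simp: norm_fun_def)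

lemma norm_fun_zero: "norm_fun N \<Longrightarrow> N 0 = 0"
  using norm_fun_scaleR[of N 0 0] by simp

lemma norm_fun_nonneg: "norm_fun N \<Longrightarrow> 0 \<le> N x"
  by (cases "x = 0") (auto simp: norm_fun_zero dest: norm_fun_pos[of N x])

lemma norm_fun_minus: "norm_fun N \<Longrightarrow> N (- x) = N x"
  using norm_fun_scaleR[of N "-1" x] by simp

lemma norm_fun_diff: "norm_fun N \<Longrightarrow> \<bar>N x - N y\<bar> \<le> N (x - y)"
  using norm_fun_triangle[of N "x - y" y] norm_fun_triangle[of N "y - x" x]
    norm_fun_minus[of N "x - y"] by (simp add: abs_le_iff)

lemma norm_fun_convex_on:
  assumes "norm_fun N" shows "convex_on UNIV N"
  unfolding convex_on_def using assms
  by (auto intro!: order_trans[OF norm_fun_triangle[OF assms]] simp: norm_fun_scaleR)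

lemma norm_fun_continuous:
  assumes "norm_fun N" shows "continuous_on A N"
  using convex_on_continuous[OF _ norm_fun_convex_on[OF assms]] continuous_on_subset by blast

lemma norm_fun_measurable:
  assumes "norm_fun N" shows "N \<in> borel_measurable borel"
  using norm_fun_continuous[OF assms] by (rule borel_measurable_continuous_onI)

lemma norm_fun_bounds:
  fixes N :: "'a::euclidean_space \<Rightarrow> real"
  assumes N: "norm_fun N"
  obtains c C where "0 < c" "0 < C" "\<And>x. c * norm x \<le> N x" "\<And>x. N x \<le> C * norm x"
proof -
  have co: "compact (sphere 0 1 :: 'a set)" and ne: "(sphere 0 1 :: 'a set) \<noteq> {}" by auto
  obtain u where u: "u \<in> sphere 0 1" "\<And>y. y \<in> sphere 0 1 \<Longrightarrow> N u \<le> N y"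
    using continuous_attains_inf[OF co ne norm_fun_continuous[OF N]] by blast
  obtain v where v: "v \<in> sphere 0 1" "\<And>y. y \<in> sphere 0 1 \<Longrightarrow> N y \<le> N v"
    using continuous_attains_sup[OF co ne norm_fun_continuous[OF N]] by blast
  have Nx: "N x = norm x * N (x /\<^sub>R norm x)" for x
    by (cases "x = 0") (auto simp: norm_fun_scaleR[OF N] norm_fun_zero[OF N])
  show ?thesis
  proof (rule that[of "N u" "N v"])
    have "u \<noteq> 0" "v \<noteq> 0" using u(1) v(1) by auto
    thus "0 < N u" "0 < N v" using norm_fun_pos[OF N] by auto
    show "N u * norm x \<le> N x" for x
      by (cases "x = 0") (use Nx[of x] u(2)[of "x /\<^sub>R norm x"] in
          \<open>auto simp: norm_fun_zero[OF N] mult.commute intro!: mult_left_mono\<close>)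
    show "N x \<le> N v * norm x" for x
      by (cases "x = 0") (use Nx[of x] v(2)[of "x /\<^sub>R norm x"] in
          \<open>auto simp: norm_fun_zero[OF N] mult.commute intro!: mult_left_mono\<close>)
  qed
qed

lemma norm_fun_ball:
  fixes N :: "'a::euclidean_space \<Rightarrow> real"
  assumes N: "norm_fun N"
  shows "compact {x. N x \<le> r}" "convex {x. N x \<le> r}"
proof -
  obtain c where c: "0 < c" "\<And>x. c * norm x \<le> N x" using norm_fun_bounds[OF N] by metis
  have "norm x \<le> r / c" if "N x \<le> r" for x
    using that c(2)[of x] c(1) by (simp add: field_simps)
  hence "bounded {x. N x \<le> r}" by (auto simp: bounded_iff)
  moreover have "closed {x. N x \<le> r}"
    using norm_fun_continuous[OF N, of UNIV] by (intro closed_Collect_le) auto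
  ultimately show "compact {x. N x \<le> r}" using compact_eq_bounded_closed by blast
  show "convex {x. N x \<le> r}"
  proof (rule convexI)
    fix x y and u v :: real assume a: "x \<in> {x. N x \<le> r}" "y \<in> {x. N x \<le> r}" "0 \<le> u" "0 \<le> v" "u + v = 1"
    have "N (u *\<^sub>R x + v *\<^sub>R y) \<le> u * N x + v * N y"
      using norm_fun_triangle[OF N, of "u *\<^sub>R x" "v *\<^sub>R y"] a by (simp add: norm_fun_scaleR[OF N])
    also have "\<dots> \<le> u * r + v * r" using a by (intro add_mono mult_left_mono) auto
    finally show "u *\<^sub>R x + v *\<^sub>R y \<in> {x. N x \<le> r}" using a by (simp flip: distrib_right)
  qed
qed

lemma norm_fun_linear:
  assumes "norm_fun N" "linear T" "inj T"
  shows "norm_fun (\<lambda>x. N (T x))"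
  using assms linear_injective_0[OF assms(2)] unfolding norm_fun_def
  by (auto simp: linear_add linear_scale)

lemma symmetric_convex_zero_interior:
  fixes K :: "'a::euclidean_space set"
  assumes K: "convex K" "interior K \<noteq> {}" "uminus ` K = K"
  shows "0 \<in> interior K"
proof -
  obtain a where a: "a \<in> interior K" using K by auto
  have "- a \<in> interior K"
    using interior_negations[of K] K(3) a by (metis image_eqI)
  hence "(1/2) *\<^sub>R a + (1/2) *\<^sub>R (- a) \<in> interior K"
    using convex_interior[OF K(1)] a unfolding convex_def by (metis divide_nonneg_nonneg field_sum_of_halves zero_le_numeral zero_le_one)
  thus ?thesis by simp
qed

text \<open>The norm is the gauge of \<open>K\<close>. A ball around 0 inside \<open>K\<close> makes
  it finite, boundedness of \<open>K\<close> makes it positive off 0, symmetry gives the absolute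
  value in the homogeneity, and closedness makes the infimum attained, so that \<open>K\<close> is
  exactly the closed unit ball.\<close>

lemma symmetric_convex_body_norm_fun:
  fixes K :: "'a::euclidean_space set"
  assumes K: "compact K" "convex K" "interior K \<noteq> {}" "uminus ` K = K"
  obtains N where "norm_fun N" "K = {x. N x \<le> 1}"
proof -
  have "0 \<in> interior K" using symmetric_convex_zero_interior K by blast
  then obtain e where e: "0 < e" "cball 0 e \<subseteq> K"
    using mem_interior_cball by blast
  obtain R where R: "0 < R" "\<And>x. x \<in> K \<Longrightarrow> norm x \<le> R"
    using compact_imp_bounded[OF K(1)] bounded_pos by metis
  have mK: "- x \<in> K \<longleftrightarrow> x \<in> K" for x using K(4) by force
  define S where "S x = {t. 0 < t \<and> x /\<^sub>R t \<in> K}" for x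
  define N where "N x = Inf (S x)" for x
  have scale: "s *\<^sub>R x \<in> K" if "x \<in> K" "0 \<le> s" "s \<le> 1" for s x
    using that e convexD[OF K(2), of x 0 s "1 - s"] by (auto simp: subset_iff)
  have up: "t' \<in> S x" if "t \<in> S x" "t \<le> t'" for t t' x
  proof -
    have "x /\<^sub>R t' = (t / t') *\<^sub>R (x /\<^sub>R t)" using that by (auto simp: S_def field_simps)
    thus ?thesis using that scale[of "x /\<^sub>R t" "t / t'"] by (auto simp: S_def divide_simps)
  qed
  have mem: "norm x / e \<in> S x" if "x \<noteq> 0" for x
    using e that by (auto simp: S_def intro!: subsetD[OF e(2)])
  have bdd: "bdd_below (S x)" for x by (auto simp: S_def intro!: bdd_belowI[of _ 0] less_imp_le)
  have ne: "S x \<noteq> {}" for x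
  proof (cases "x = 0")
    case True thus ?thesis using e by (auto simp: S_def intro!: exI[of _ 1])
  qed (use mem in auto)
  have lower: "norm x / R \<le> t" if "t \<in> S x" for t x
    using that R(1) R(2)[of "x /\<^sub>R t"] by (auto simp: S_def field_simps)
  have Nlow: "norm x / R \<le> N x" for x
    unfolding N_def by (rule cInf_greatest[OF ne lower])
  have N0: "N 0 = 0"
  proof (rule antisym)
    show "N 0 \<le> 0"
    proof (rule field_le_epsilon)
      fix d :: real assume "0 < d"
      hence "d \<in> S 0" using e by (auto simp: S_def)
      thus "N 0 \<le> 0 + d" unfolding N_def using cInf_lower[OF _ bdd] by auto
    qed
  qed (use Nlow[of 0] in simp)
  have attained: "N x \<in> S x" if "x \<noteq> 0" for x
  proof -
    have pos: "0 < N x" using Nlow[of x] that R(1) by (smt (verit) divide_pos_pos zero_less_norm_iff)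
    have *: "x /\<^sub>R (N x + 1 / real (Suc n)) \<in> K" for n
    proof -
      have "Inf (S x) < N x + 1 / real (Suc n)" by (simp add: N_def)
      then obtain t where "t \<in> S x" "t < N x + 1 / real (Suc n)"
        using cInf_lessD[OF ne] by blast
      thus ?thesis using up[of t x "N x + 1 / real (Suc n)"] by (auto simp: S_def)
    qed
    have "(\<lambda>n. N x + 1 / real (Suc n)) \<longlonglongrightarrow> N x + 0"
      by (intro tendsto_intros LIMSEQ_Suc[OF lim_1_over_n])
    hence "(\<lambda>n. x /\<^sub>R (N x + 1 / real (Suc n))) \<longlonglongrightarrow> x /\<^sub>R N x"
      using pos by (intro tendsto_intros) auto
    hence "x /\<^sub>R N x \<in> K"
      by (rule closed_sequentially[OF compact_imp_closed[OF K(1)] *])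
    thus ?thesis using pos by (simp add: S_def)
  qed
  have pos: "0 < N x" if "x \<noteq> 0" for x using attained[OF that] by (simp add: S_def)
  have le: "N x \<le> t" if "x /\<^sub>R t \<in> K" "0 < t" for x t
    unfolding N_def using that by (intro cInf_lower bdd) (auto simp: S_def)
  have tri: "N (x + y) \<le> N x + N y" for x y
  proof (cases "x = 0 \<or> y = 0")
    case True thus ?thesis using N0 by auto
  next
    case False
    let ?a = "N x" let ?b = "N y"
    have ab: "0 < ?a" "0 < ?b" using False pos by auto
    have "(?a / (?a + ?b)) *\<^sub>R (x /\<^sub>R ?a) + (?b / (?a + ?b)) *\<^sub>R (y /\<^sub>R ?b) \<in> K"
      using False attained[of x] attained[of y] ab
      by (intro convexD[OF K(2)]) (auto simp: S_def simp flip: add_divide_distrib)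
    moreover have "(?a / (?a + ?b)) *\<^sub>R (x /\<^sub>R ?a) + (?b / (?a + ?b)) *\<^sub>R (y /\<^sub>R ?b) = (x + y) /\<^sub>R (?a + ?b)"
      using ab by (simp add: scaleR_add_right divide_inverse mult.assoc mult.left_commute[of _ "inverse (N x + N y)"])
    ultimately show ?thesis using ab by (intro le) auto
  qed
  have homle: "N (c *\<^sub>R x) \<le> \<bar>c\<bar> * N x" for c x
  proof (cases "x = 0 \<or> c = 0")
    case True thus ?thesis using N0 by auto
  next
    case False
    have "(c *\<^sub>R x) /\<^sub>R (\<bar>c\<bar> * N x) = sgn c *\<^sub>R (x /\<^sub>R N x)"
      using False by (simp add: sgn_real_def divide_simps)
    moreover have "sgn c *\<^sub>R (x /\<^sub>R N x) \<in> K"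
      using attained[of x] False mK by (auto simp: S_def sgn_real_def)
    ultimately have "(c *\<^sub>R x) /\<^sub>R (\<bar>c\<bar> * N x) \<in> K" by (simp only:)
    thus ?thesis using False pos[of x] by (intro le) simp_all
  qed
  have hom: "N (c *\<^sub>R x) = \<bar>c\<bar> * N x" for c x
  proof (cases "c = 0")
    case False
    have "N x \<le> \<bar>1/c\<bar> * N (c *\<^sub>R x)" using homle[of "1/c" "c *\<^sub>R x"] False by simp
    hence "\<bar>c\<bar> * N x \<le> N (c *\<^sub>R x)" using False by (simp add: field_simps)
    thus ?thesis using homle[of c x] by simp
  qed (use N0 in auto)
  have "x \<in> K \<longleftrightarrow> N x \<le> 1" for x
  proof
    show "x \<in> K \<Longrightarrow> N x \<le> 1" using le[where x=x and t=1] by simp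
    assume "N x \<le> 1"
    show "x \<in> K"
    proof (cases "x = 0")
      case True thus ?thesis using e by auto
    next
      case False
      thus ?thesis using up[OF attained \<open>N x \<le> 1\<close>] by (auto simp: S_def)
    qed
  qed
  thus ?thesis using that[of N] tri hom pos by (auto simp: norm_fun_def)
qed


section \<open>The bathtub principle and comparison of volumes\<close>

text \<open>On the common part nothing changes. Cancelling the finite measure of
  \<open>A \<inter> B\<close> shows that \<open>A - B\<close> is no larger than
  \<open>B - A\<close>, and \<open>\<tau>\<close> separates the values of \<open>h\<close> on these
  two pieces.\<close>

lemma nn_integral_bathtub:
  fixes h :: "'a \<Rightarrow> ennreal"
  assumes [measurable]: "A \<in> sets M" "B \<in> sets M" "h \<in> borel_measurable M"
    and le: "emeasure M A \<le> emeasure M B" and fin: "emeasure M A < \<infinity>"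
    and A: "\<And>x. x \<in> A - B \<Longrightarrow> h x \<le> \<tau>" and B: "\<And>x. x \<in> B - A \<Longrightarrow> \<tau> \<le> h x"
  shows "(\<integral>\<^sup>+x\<in>A. h x \<partial>M) \<le> (\<integral>\<^sup>+x\<in>B. h x \<partial>M)"
proof -
  have split: "(\<integral>\<^sup>+x\<in>C. h x \<partial>M) = (\<integral>\<^sup>+x\<in>C \<inter> D. h x \<partial>M) + (\<integral>\<^sup>+x\<in>C - D. h x \<partial>M)"
    if [measurable]: "C \<in> sets M" "D \<in> sets M" for C D
    by (subst nn_integral_add[symmetric])
      (auto intro!: nn_integral_cong simp: indicator_def)
  have AB: "emeasure M (A - B) \<le> emeasure M (B - A)"
  proof -
    have "emeasure M (A \<inter> B) + emeasure M (A - B) \<le> emeasure M (A \<inter> B) + emeasure M (B - A)"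
    proof -
      have "A \<inter> B \<union> (A - B) = A" "A \<inter> B \<union> (B - A) = B" "A \<inter> B \<inter> (A - B) = {}" "A \<inter> B \<inter> (B - A) = {}"
        by auto
      thus ?thesis
        using le plus_emeasure[of "A \<inter> B" M "A - B"] plus_emeasure[of "A \<inter> B" M "B - A"] by simp
    qed
    moreover have "emeasure M (A \<inter> B) < \<infinity>"
      by (rule le_less_trans[OF emeasure_mono fin]) auto
    ultimately show ?thesis by (auto simp: ennreal_add_left_cancel_le)
  qed
  have "(\<integral>\<^sup>+x\<in>A - B. h x \<partial>M) \<le> (\<integral>\<^sup>+x\<in>A - B. \<tau> \<partial>M)"
    using A by (intro nn_integral_mono) (auto simp: indicator_def)
  also have "\<dots> = \<tau> * emeasure M (A - B)" by (simp add: nn_integral_cmult)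
  also have "\<dots> \<le> \<tau> * emeasure M (B - A)" using AB by (rule mult_left_mono) auto
  also have "\<dots> = (\<integral>\<^sup>+x\<in>B - A. \<tau> \<partial>M)" by (simp add: nn_integral_cmult)
  also have "\<dots> \<le> (\<integral>\<^sup>+x\<in>B - A. h x \<partial>M)"
    using B by (intro nn_integral_mono) (auto simp: indicator_def)
  finally show ?thesis
    by (subst split[of A B], simp, simp, subst split[of B A], simp, simp) (auto simp: Int_commute intro: add_left_mono)
qed

lemma nn_integral_lborel_scaleR:
  fixes f :: "'a::euclidean_space \<Rightarrow> ennreal"
  assumes [measurable]: "f \<in> borel_measurable borel" and c: "c \<noteq> 0"
  shows "(\<integral>\<^sup>+x. f x \<partial>lborel) = ennreal (\<bar>c\<bar> ^ DIM('a)) * (\<integral>\<^sup>+x. f (c *\<^sub>R x) \<partial>lborel)"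
  by (subst lborel_affine[OF c, of 0]) (simp add: nn_integral_density nn_integral_distr nn_integral_cmult)

lemma nn_integral_lborel_translate:
  fixes f :: "'a::euclidean_space \<Rightarrow> ennreal"
  assumes [measurable]: "f \<in> borel_measurable borel"
  shows "(\<integral>\<^sup>+x. f (a + x) \<partial>lborel) = (\<integral>\<^sup>+x. f x \<partial>lborel)"
  by (subst (2) lborel_affine[of 1 a]) (simp_all add: nn_integral_density nn_integral_distr)

text \<open>If \<open>L\<close> were larger than \<open>K\<close>, the dilate of \<open>K\<close>
  with the volume of \<open>L\<close> would have a factor \<open>c > 1\<close>. The mean over this
  dilate is \<open>c powr p\<close> times the mean over \<open>K\<close>, and the bathtub principle
  compares it with the mean over \<open>L\<close>. As the mean over \<open>K\<close> is positive and
  finite, the hypotheses then give \<open>c powr p \<ge> 1\<close> for \<open>p < 0\<close> and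
  \<open>c powr p \<le> 1\<close> for \<open>p > 0\<close>, both absurd.\<close>

lemma volume_comparison_of_norm_moments:
  fixes N :: "'a::euclidean_space \<Rightarrow> real" and L :: "'a set"
  assumes N: "norm_fun N" and p: "p \<noteq> 0"
    and [measurable]: "L \<in> sets borel" and L: "0 < measure lborel L" "emeasure lborel L < \<infinity>"
  defines "K \<equiv> {x. N x \<le> 1}"
  assumes K: "0 < measure lborel K"
    and I: "(\<integral>\<^sup>+x\<in>K. N x powr p \<partial>lborel) < \<infinity>"
    and neg: "p < 0 \<Longrightarrow> ennreal (1 / measure lborel K) * (\<integral>\<^sup>+x\<in>K. N x powr p \<partial>lborel)
       \<le> ennreal (1 / measure lborel L) * (\<integral>\<^sup>+x\<in>L. N x powr p \<partial>lborel)"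
    and pos: "p > 0 \<Longrightarrow> ennreal (1 / measure lborel L) * (\<integral>\<^sup>+x\<in>L. N x powr p \<partial>lborel)
       \<le> ennreal (1 / measure lborel K) * (\<integral>\<^sup>+x\<in>K. N x powr p \<partial>lborel)"
  shows "measure lborel L \<le> measure lborel K"
proof (rule ccontr)
  assume less: "\<not> measure lborel L \<le> measure lborel K"
  note [measurable] = norm_fun_measurable[OF N]
  have [measurable]: "{x. N x \<le> c} \<in> sets borel" for c by measurable
  define n where "n = DIM('a)"
  have n: "0 < n" by (simp add: n_def)
  \<comment> \<open>Chosen so that \<open>{x. N x \<le> c}\<close> has the volume of
    \<open>L\<close>.\<close>
  define c where "c = (measure lborel L / measure lborel K) powr (1 / n)"
  define J where "J = (\<integral>\<^sup>+x\<in>K. N x powr p \<partial>lborel)"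
  have c: "1 < c" unfolding c_def using less K n by (intro gr_one_powr) auto
  have cn: "c ^ n = measure lborel L / measure lborel K"
    using n K L by (simp add: c_def powr_powr flip: powr_realpow)
  have finK: "emeasure lborel K < \<infinity>"
    unfolding K_def using norm_fun_ball(1)[OF N] emeasure_compact_finite by blast
  have scaled: "(\<integral>\<^sup>+x\<in>{x. N x \<le> c}. f (N x) \<partial>lborel) = ennreal (c ^ n) * (\<integral>\<^sup>+x\<in>K. f (c * N x) \<partial>lborel)"
    if [measurable]: "f \<in> borel_measurable borel" for f :: "real \<Rightarrow> ennreal"
    using c by (subst nn_integral_lborel_scaleR[of _ c])
      (auto simp: n_def K_def norm_fun_scaleR[OF N] indicator_def intro!: arg_cong2[where f="(*)"] nn_integral_cong)
  have em: "emeasure lborel {x. N x \<le> c} = emeasure lborel L"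
  proof -
    have "emeasure lborel {x. N x \<le> c} = ennreal (c ^ n) * emeasure lborel K"
      using scaled[of "\<lambda>_. 1"] by (simp add: K_def)
    also have "\<dots> = ennreal (c ^ n * measure lborel K)"
      using finK c by (subst emeasure_eq_ennreal_measure) (auto simp: ennreal_mult)
    also have "\<dots> = emeasure lborel L"
      using L K emeasure_eq_ennreal_measure[of lborel L] by (simp add: cn less_top)
    finally show ?thesis .
  qed
  have Jc: "(\<integral>\<^sup>+x\<in>{x. N x \<le> c}. N x powr p \<partial>lborel) = ennreal (c ^ n * c powr p) * J"
  proof -
    have "(\<integral>\<^sup>+x\<in>{x. N x \<le> c}. N x powr p \<partial>lborel) = ennreal (c ^ n) * (\<integral>\<^sup>+x\<in>K. ennreal ((c * N x) powr p) \<partial>lborel)"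
      using scaled[of "\<lambda>t. ennreal (t powr p)"] by simp
    also have "(\<integral>\<^sup>+x\<in>K. ennreal ((c * N x) powr p) \<partial>lborel) = ennreal (c powr p) * J"
      unfolding J_def using c norm_fun_nonneg[OF N]
      by (subst nn_integral_cmult[symmetric]) (auto simp: powr_mult ennreal_mult mult.assoc K_def intro!: nn_integral_cong)
    finally show ?thesis using c by (simp add: ennreal_mult mult.assoc)
  qed
  have J0: "J \<noteq> 0"
  proof
    assume "J = 0"
    hence "AE x in lborel. ennreal (N x powr p) * indicator K x = 0"
      unfolding J_def by (subst (asm) nn_integral_0_iff_AE) (auto simp: K_def)
    hence "AE x in lborel. x \<notin> K"
      using AE_lborel_singleton[of 0] by eventually_elim (use norm_fun_pos[OF N] in \<open>force simp: indicator_def\<close>)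
    hence "emeasure lborel K = 0"
      by (subst (asm) AE_iff_measurable[of K]) (auto simp: K_def)
    thus False using K by (simp add: measure_def)
  qed
  have Jfin: "J < \<infinity>" using I by (simp add: J_def)
  have Lc: "ennreal (1 / measure lborel L) * (\<integral>\<^sup>+x\<in>{x. N x \<le> c}. N x powr p \<partial>lborel)
      = ennreal (c powr p) * (ennreal (1 / measure lborel K) * J)"
  proof -
    have "1 / measure lborel L * (c ^ n * c powr p) = c powr p * (1 / measure lborel K)"
      using L K by (simp add: cn field_simps)
    thus ?thesis using c L K 
      by (simp add: Jc mult.assoc[symmetric] ennreal_mult[symmetric] del: times_divide_eq_left)
  qed
  obtain j where j: "0 < j" "ennreal (1 / measure lborel K) * J = ennreal j"
  proof -
    have "ennreal (1 / measure lborel K) * J \<noteq> 0" "ennreal (1 / measure lborel K) * J < \<infinity>"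
      using K J0 Jfin by (auto simp: ennreal_mult_less_top)
    thus ?thesis using that by (metis ennreal_enn2real ennreal_less_zero_iff infinity_ennreal_def not_gr_zero)
  qed
  show False
  proof (cases "p < 0")
    case True
    \<comment> \<open>The origin is removed from the dilate: there the default
      \<open>0 powr p = 0\<close> stands in place of an infinite value, and the lower bound by
      \<open>c powr p\<close> would fail.\<close>
    have "(\<integral>\<^sup>+x\<in>L. N x powr p \<partial>lborel) \<le> (\<integral>\<^sup>+x\<in>{x. N x \<le> c} - {0}. N x powr p \<partial>lborel)"
    proof (rule nn_integral_bathtub[where \<tau> = "ennreal (c powr p)"])
      have "emeasure lborel ({x. N x \<le> c} - {0}) = emeasure lborel {x. N x \<le> c}"
        by (rule emeasure_Diff_null_set) auto
      thus "emeasure lborel L \<le> emeasure lborel ({x. N x \<le> c} - {0})" by (simp add: em)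
    next
      fix x assume "x \<in> L - ({x. N x \<le> c} - {0})"
      hence "x = 0 \<or> c < N x" by auto
      thus "ennreal (N x powr p) \<le> ennreal (c powr p)"
      proof
        assume "c < N x" thus ?thesis using True c by (intro ennreal_leI powr_mono2') auto
      qed (simp add: norm_fun_zero[OF N])
    next
      fix x assume "x \<in> {x. N x \<le> c} - {0} - L"
      thus "ennreal (c powr p) \<le> ennreal (N x powr p)"
        using True c norm_fun_pos[OF N] by (auto intro!: ennreal_leI powr_mono2')
    qed (use L in auto)
    also have "\<dots> \<le> (\<integral>\<^sup>+x\<in>{x. N x \<le> c}. N x powr p \<partial>lborel)"
      by (intro nn_integral_mono) (auto simp: indicator_def)
    finally have "ennreal (1 / measure lborel L) * (\<integral>\<^sup>+x\<in>L. N x powr p \<partial>lborel)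
       \<le> ennreal (c powr p) * ennreal j"
      unfolding Lc[unfolded j(2), symmetric] by (rule mult_left_mono) simp
    hence "ennreal j \<le> ennreal (c powr p) * ennreal j"
      using neg[OF True] unfolding J_def[symmetric] j(2) by (rule order_trans[rotated])
    hence "j \<le> c powr p * j" using j(1) by (simp flip: ennreal_mult' add: ennreal_le_iff)
    moreover have "c powr p < 1" using c True by (simp add: powr_less_one)
    ultimately show False using j(1) by (simp add: mult_le_cancel_right1)
  next
    case False
    hence p: "0 < p" using p by simp
    have "(\<integral>\<^sup>+x\<in>{x. N x \<le> c}. N x powr p \<partial>lborel) \<le> (\<integral>\<^sup>+x\<in>L. N x powr p \<partial>lborel)"
    proof (rule nn_integral_bathtub[where \<tau> = "ennreal (c powr p)"])
      fix x assume "x \<in> {x. N x \<le> c} - L"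
      thus "ennreal (N x powr p) \<le> ennreal (c powr p)"
        using p c norm_fun_nonneg[OF N] by (auto intro!: ennreal_leI powr_mono2)
    next
      fix x assume "x \<in> L - {x. N x \<le> c}"
      thus "ennreal (c powr p) \<le> ennreal (N x powr p)"
        using p c by (auto intro!: ennreal_leI powr_mono2)
    qed (use L in \<open>auto simp: em\<close>)
    hence "ennreal (c powr p) * ennreal j \<le> ennreal (1 / measure lborel L) * (\<integral>\<^sup>+x\<in>L. N x powr p \<partial>lborel)"
      unfolding Lc[unfolded j(2), symmetric] by (rule mult_left_mono) simp
    hence "ennreal (c powr p) * ennreal j \<le> ennreal j"
      using pos[OF p] unfolding J_def[symmetric] j(2) by (rule order_trans)
    hence "c powr p * j \<le> j" using j(1) by (simp flip: ennreal_mult' add: ennreal_le_iff)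
    moreover have "1 < c powr p" using c p by (simp add: gr_one_powr)
    ultimately show False using j(1) by (simp add: mult_le_cancel_right2)
  qed
qed


section \<open>One-dimensional integrals of powers\<close>

lemma nn_integral_even:
  fixes f :: "real \<Rightarrow> ennreal"
  assumes [measurable]: "f \<in> borel_measurable borel" and even: "\<And>x. f (- x) = f x"
  shows "(\<integral>\<^sup>+x. f x \<partial>lborel) = 2 * (\<integral>\<^sup>+x\<in>{0..}. f x \<partial>lborel)"
proof -
  have "(\<integral>\<^sup>+x. f x \<partial>lborel) = (\<integral>\<^sup>+x. f x * indicator {0..} x + f x * indicator {..0} x \<partial>lborel)"
    by (intro nn_integral_cong_AE eventually_mono[OF AE_lborel_singleton[of 0]])
      (auto simp: indicator_def)
  also have "\<dots> = (\<integral>\<^sup>+x\<in>{0..}. f x \<partial>lborel) + (\<integral>\<^sup>+x\<in>{..0}. f x \<partial>lborel)"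
    by (rule nn_integral_add) auto
  also have "(\<integral>\<^sup>+x\<in>{..0}. f x \<partial>lborel) = (\<integral>\<^sup>+x\<in>{0..}. f x \<partial>lborel)"
    by (subst nn_integral_real_affine[where c="-1" and t=0])
      (auto simp: even indicator_def intro!: nn_integral_cong)
  finally show ?thesis by (simp add: mult_2)
qed

lemma nn_integral_abs_powr:
  assumes "a > -1" "0 \<le> M"
  shows "(\<integral>\<^sup>+u\<in>{-M..M}. ennreal (\<bar>u\<bar> powr a) \<partial>lborel) = ennreal (2 * (M powr (a + 1) / (a + 1)))"
proof -
  have "(\<integral>\<^sup>+u\<in>{-M..M}. ennreal (\<bar>u\<bar> powr a) \<partial>lborel) =
     2 * (\<integral>\<^sup>+u\<in>{0..}. ennreal (\<bar>u\<bar> powr a) * indicator {-M..M} u \<partial>lborel)"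
    by (rule nn_integral_even) (auto simp: indicator_def)
  also have "(\<integral>\<^sup>+u\<in>{0..}. ennreal (\<bar>u\<bar> powr a) * indicator {-M..M} u \<partial>lborel)
     = (\<integral>\<^sup>+u. indicator {0..M} u * (u powr a) \<partial>lborel)"
    using assms by (intro nn_integral_cong) (auto simp: indicator_def)
  also have "\<dots> = ennreal (M powr (a + 1) / (a + 1))"
    by (rule nn_integral_has_integral_lebesgue[OF _ has_integral_powr_from_0]) (use assms in auto)
  finally show ?thesis
    by (simp only: ennreal_mult'[of 2, simplified])
qed

lemma nn_integral_powr_tail:
  assumes "e < -1" "0 < M"
  shows "(\<integral>\<^sup>+b. ennreal ((M + \<bar>b\<bar>) powr e) \<partial>lborel) = ennreal (2 * (M powr (e + 1) / (- e - 1)))"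
proof -
  have "(\<integral>\<^sup>+b. ennreal ((M + \<bar>b\<bar>) powr e) \<partial>lborel) =
     2 * (\<integral>\<^sup>+b\<in>{0..}. ennreal ((M + \<bar>b\<bar>) powr e) \<partial>lborel)"
    by (rule nn_integral_even) auto
  also have "(\<integral>\<^sup>+b\<in>{0..}. ennreal ((M + \<bar>b\<bar>) powr e) \<partial>lborel)
     = (\<integral>\<^sup>+b. indicator {M..} b * (b powr e) \<partial>lborel)"
    using assms by (subst (2) nn_integral_real_affine[where c=1 and t=M])
      (auto simp: indicator_def intro!: nn_integral_cong)
  also have "\<dots> = ennreal (M powr (e + 1) / (- e - 1))"
    by (rule nn_integral_has_integral_lebesgue[OF _ has_integral_eq_rhs[OF has_integral_powr_to_inf]]) (use assms in \<open>auto simp: divide_simps algebra_simps\<close>)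
  finally show ?thesis
    by (simp only: ennreal_mult'[of 2, simplified])
qed

text \<open>Split at distance \<open>M\<close> from the singularity: outside, the power is at most
  \<open>M powr - a\<close>; inside, \<open>k\<close> is at most \<open>B\<close> and the power is
  integrated exactly. For the plane waves the free radius \<open>M\<close> is matched to the width
  of the kernel, so that both terms scale alike.\<close>

lemma nn_integral_singular_kernel_le:
  fixes k :: "real \<Rightarrow> ennreal"
  assumes [measurable]: "k \<in> borel_measurable borel" and a: "0 \<le> a" "a < 1" and M: "0 < M"
    and k: "\<And>u. k u \<le> B"
  shows "(\<integral>\<^sup>+u. ennreal (\<bar>u - c\<bar> powr - a) * k u \<partial>lborel)
     \<le> ennreal (M powr - a) * (\<integral>\<^sup>+u. k u \<partial>lborel) + ennreal (2 * (M powr (1 - a) / (1 - a))) * B"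
proof -
  have "(\<integral>\<^sup>+u. ennreal (\<bar>u - c\<bar> powr - a) * k u \<partial>lborel) \<le>
    (\<integral>\<^sup>+u. ennreal (M powr - a) * k u + ennreal (\<bar>u - c\<bar> powr - a) * indicator {-M..M} (u - c) * B \<partial>lborel)"
  proof (intro nn_integral_mono)
    fix u
    show "ennreal (\<bar>u - c\<bar> powr - a) * k u \<le>
       ennreal (M powr - a) * k u + ennreal (\<bar>u - c\<bar> powr - a) * indicator {-M..M} (u - c) * B"
    proof (cases "\<bar>u - c\<bar> \<le> M")
      case True
      thus ?thesis using k[of u] by (intro add_increasing) (auto simp: indicator_def intro!: mult_left_mono)
    next
      case False
      thus ?thesis using M a
        by (intro add_increasing2 mult_right_mono ennreal_leI powr_mono2') auto
    qed
  qed
  also have "\<dots> = ennreal (M powr - a) * (\<integral>\<^sup>+u. k u \<partial>lborel) +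
     (\<integral>\<^sup>+u. ennreal (\<bar>u - c\<bar> powr - a) * indicator {-M..M} (u - c) \<partial>lborel) * B"
    by (simp add: nn_integral_add nn_integral_cmult nn_integral_multc)
  also have "(\<integral>\<^sup>+u. ennreal (\<bar>u - c\<bar> powr - a) * indicator {-M..M} (u - c) \<partial>lborel)
     = ennreal (2 * (M powr (1 - a) / (1 - a)))"
    by (subst nn_integral_real_affine[where c=1 and t=c])
      (use a M nn_integral_abs_powr[of "- a" M] in auto)
  finally show ?thesis .
qed

subsection \<open>Cauchy variables and planar norms\<close>


lemma nn_integral_FTC_UNIV:
  fixes f F :: "real \<Rightarrow> real"
  assumes F: "\<And>x. DERIV F x :> f x" and f: "\<And>x. isCont f x" "\<And>x. 0 \<le> f x"
    and lim: "(F \<longlongrightarrow> A) at_bot" "(F \<longlongrightarrow> B) at_top"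
  shows "(\<integral>\<^sup>+x. f x \<partial>lborel) = ennreal (B - A)"
proof -
  have "einterval (-\<infinity>) \<infinity> = UNIV" by (auto simp: einterval_def)
  moreover have "set_integrable lborel (einterval (-\<infinity>) \<infinity>) f" "(LBINT x=-\<infinity>..\<infinity>. f x) = B - A"
    using assms by (intro interval_integral_FTC_nonneg[where F=F]; simp add: ereal_tendsto_simps)+
  ultimately show ?thesis
    using f(2) by (subst nn_integral_eq_integral)
      (auto simp: set_integrable_def interval_lebesgue_integral_def set_lebesgue_integral_def)
qed

definition cauchy :: "real \<Rightarrow> real \<Rightarrow> real" where
  "cauchy a t = a / (pi * (a\<^sup>2 + t\<^sup>2))"

lemma cauchy_measurable [measurable]: "cauchy a \<in> borel_measurable borel"
  unfolding cauchy_def by measurable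

lemma cauchy_nonneg: "0 \<le> a \<Longrightarrow> 0 \<le> cauchy a t"
  by (simp add: cauchy_def)

lemma tendsto_arctan_affine:
  assumes "0 < b" "0 < (a::real)"
  shows "((\<lambda>c. arctan ((b * c - t) / a)) \<longlongrightarrow> pi / 2) at_top"
    and "((\<lambda>c. arctan ((b * c - t) / a)) \<longlongrightarrow> - (pi / 2)) at_bot"
proof -
  have "filterlim (\<lambda>c. (b * c - t) / a) at_top at_top"
    using assms by real_asymp
  thus "((\<lambda>c. arctan ((b * c - t) / a)) \<longlongrightarrow> pi / 2) at_top"
    by (rule filterlim_compose[OF tendsto_arctan_at_top])
  have "filterlim (\<lambda>c. (b * c - t) / a) at_bot at_bot"
    using assms by real_asymp
  thus "((\<lambda>c. arctan ((b * c - t) / a)) \<longlongrightarrow> - (pi / 2)) at_bot"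
    by (rule filterlim_compose[OF tendsto_arctan_at_bot])
qed

text \<open>Independent Cauchy variables of scales \<open>a\<close> and \<open>b\<close> have a sum
  of scale \<open>a + b\<close>. The product of the two densities gets an explicit antiderivative by
  partial fractions. The point \<open>t = 0\<close> is left out because \<open>D\<close> vanishes
  there when \<open>a = b\<close>.\<close>

lemma cauchy_convolution:
  assumes a: "0 < a" and b: "0 < b" and t: "t \<noteq> 0"
  shows "(\<integral>\<^sup>+c. cauchy a (t - b * c) * cauchy 1 c \<partial>lborel) = ennreal (cauchy (a + b) t)"
proof -
  \<comment> \<open>\<open>D\<close> is the resultant of \<open>1 + c\<^sup>2\<close> and
    \<open>Q c\<close>. The partial fractions of \<open>1 / ((1 + c\<^sup>2) * Q c)\<close> have the
    numerators \<open>\<alpha> * c + \<beta>\<close> and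
    \<open>\<delta> - \<alpha> * b\<^sup>2 * c\<close>, whose cubic contributions cancel.
    \<open>\<kappa>\<close> is the coefficient left for the arctangent of
    \<open>(b * c - t) / a\<close> once the logarithm has absorbed the linear terms.\<close>
  define D where "D = ((a + b)\<^sup>2 + t\<^sup>2) * ((a - b)\<^sup>2 + t\<^sup>2)"
  define \<alpha> where "\<alpha> = 2 * b * t / D"
  define \<beta> where "\<beta> = (a\<^sup>2 + t\<^sup>2 - b\<^sup>2) / D"
  define \<delta> where "\<delta> = 1 - \<beta> * (a\<^sup>2 + t\<^sup>2)"
  define \<kappa> where "\<kappa> = (\<delta> - \<alpha> * b * t) / (a * b)"
  define Q where "Q c = a\<^sup>2 + (t - b * c)\<^sup>2" for c
  have D: "0 < D" using t by (simp add: D_def add_nonneg_pos)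
  have Q: "0 < Q c" for c using a by (simp add: Q_def add_pos_nonneg)
  have c1: "0 < 1 + c\<^sup>2" for c :: real by (simp add: add_pos_nonneg)
  have D': "D = (a\<^sup>2 + t\<^sup>2 - b\<^sup>2)\<^sup>2 + 4 * b\<^sup>2 * t\<^sup>2"
    by (simp add: D_def power2_eq_square algebra_simps)
  have Dab: "D * \<alpha> = 2 * b * t" "D * \<beta> = a\<^sup>2 + t\<^sup>2 - b\<^sup>2"
    using D by (simp_all add: \<alpha>_def \<beta>_def)
  have partial: "(\<alpha> * c + \<beta>) * Q c + (\<delta> - \<alpha> * b\<^sup>2 * c) * (1 + c\<^sup>2) = 1" for c
  proof -
    have "D * ((\<alpha> * c + \<beta>) * Q c + (\<delta> - \<alpha> * b\<^sup>2 * c) * (1 + c\<^sup>2))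
       = ((D * \<alpha>) * c + D * \<beta>) * Q c + ((D - (D * \<beta>) * (a\<^sup>2 + t\<^sup>2)) - (D * \<alpha>) * b\<^sup>2 * c) * (1 + c\<^sup>2)"
      by (simp add: \<delta>_def algebra_simps)
    also have "\<dots> = D"
      unfolding Dab by (simp add: D' Q_def power2_eq_square algebra_simps)
    finally show ?thesis using D by simp
  qed
  define F where "F c = a / pi\<^sup>2 * (\<alpha> / 2 * ln ((1 + c\<^sup>2) / Q c) + \<beta> * arctan c + \<kappa> * arctan ((b * c - t) / a))" for c
  have deriv: "DERIV F c :> cauchy a (t - b * c) * cauchy 1 c" for c
  proof -
    have "DERIV F c :> a / pi\<^sup>2 * (\<alpha> / 2 * (2 * c / (1 + c\<^sup>2) + 2 * b * (t - b * c) / Q c) + \<beta> / (1 + c\<^sup>2) + \<kappa> * (a * b / Q c))"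
    proof -
      have *: "(b / a) * inverse (1 + ((b * c - t) / a)\<^sup>2) = a * b / Q c"
      proof -
        have "1 + ((b * c - t) / a)\<^sup>2 = Q c / a\<^sup>2"
          using a by (simp add: Q_def field_simps power2_eq_square)
        thus ?thesis using a by (simp add: power2_eq_square)
      qed
      have l: "ln ((1 + c\<^sup>2) / Q c) = ln (1 + c\<^sup>2) - ln (Q c)" for c
        using Q[of c] c1[of c] by (simp add: ln_div)
      have q: "DERIV Q c :> - (2 * b * (t - b * c))"
        unfolding Q_def by (auto intro!: derivative_eq_intros)
      have "DERIV (\<lambda>c. arctan ((b * c - t) / a)) c :> inverse (1 + ((b * c - t) / a)\<^sup>2) * (b / a)"
        using a by (auto intro!: derivative_eq_intros)
      hence *: "DERIV (\<lambda>c. arctan ((b * c - t) / a)) c :> a * b / Q c"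
        using * by (simp add: mult.commute)
      have **: "DERIV (\<lambda>c. ln (Q c)) c :> - (2 * b * (t - b * c)) / Q c"
        using q Q[of c] by (auto intro!: derivative_eq_intros)
      have ***: "DERIV (\<lambda>c. ln (1 + c\<^sup>2)) c :> 2 * c / (1 + c\<^sup>2)"
        using c1[of c] by (auto intro!: derivative_eq_intros)
      have 4: "DERIV arctan c :> 1 / (1 + c\<^sup>2)"
        by (auto intro!: derivative_eq_intros simp: divide_inverse)
      show ?thesis unfolding F_def l
        by (rule DERIV_cong, rule DERIV_cmult, rule DERIV_add, rule DERIV_add,
            rule DERIV_cmult, rule DERIV_diff[OF *** **], rule DERIV_cmult[OF 4],
            rule DERIV_cmult[OF *]) (simp add: algebra_simps diff_divide_distrib)
    qed
    also have "\<alpha> / 2 * (2 * c / (1 + c\<^sup>2) + 2 * b * (t - b * c) / Q c) + \<beta> / (1 + c\<^sup>2) + \<kappa> * (a * b / Q c)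
        = (\<alpha> * c + \<beta>) / (1 + c\<^sup>2) + (\<delta> - \<alpha> * b\<^sup>2 * c) / Q c"
      using a b by (simp add: \<kappa>_def add_divide_distrib diff_divide_distrib power2_eq_square algebra_simps)
    also have "\<dots> = ((\<alpha> * c + \<beta>) * Q c + (\<delta> - \<alpha> * b\<^sup>2 * c) * (1 + c\<^sup>2)) / ((1 + c\<^sup>2) * Q c)"
      using Q[of c] c1[of c] by (simp add: add_frac_eq)
    also have "\<dots> = 1 / ((1 + c\<^sup>2) * Q c)" by (simp add: partial)
    finally show ?thesis by (simp add: cauchy_def Q_def power2_eq_square mult_ac)
  qed
  \<comment> \<open>The logarithm has the same limit at both ends and cancels in the difference. The
    two arctangents each rise by \<open>pi\<close>, which leaves
    \<open>a * (\<beta> + \<kappa>) / pi\<close>.\<close>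
  have limln: "((\<lambda>c. ln ((1 + c\<^sup>2) / Q c)) \<longlongrightarrow> ln (1 / b\<^sup>2)) G" if "G = at_top \<or> G = at_bot" for G
  proof -
    have "((\<lambda>c. (1 + c\<^sup>2) / Q c) \<longlongrightarrow> 1 / b\<^sup>2) at_top" "((\<lambda>c. (1 + c\<^sup>2) / Q c) \<longlongrightarrow> 1 / b\<^sup>2) at_bot"
      unfolding Q_def using a b by (real_asymp simp: power2_eq_square field_simps)+
    thus ?thesis using that b by (auto intro!: tendsto_ln)
  qed
  have lim: "(F \<longlongrightarrow> a / pi\<^sup>2 * (\<alpha> / 2 * ln (1 / b\<^sup>2) + \<beta> * (pi / 2) + \<kappa> * (pi / 2))) at_top"
     "(F \<longlongrightarrow> a / pi\<^sup>2 * (\<alpha> / 2 * ln (1 / b\<^sup>2) + \<beta> * (- (pi / 2)) + \<kappa> * (- (pi / 2)))) at_bot"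
    unfolding F_def using a b
    by (intro tendsto_intros limln tendsto_arctan_at_top tendsto_arctan_at_bot tendsto_arctan_affine; simp)+
  have "(\<integral>\<^sup>+c. cauchy a (t - b * c) * cauchy 1 c \<partial>lborel)
     = ennreal (a / pi\<^sup>2 * (\<alpha> / 2 * ln (1 / b\<^sup>2) + \<beta> * (pi / 2) + \<kappa> * (pi / 2)) -
        a / pi\<^sup>2 * (\<alpha> / 2 * ln (1 / b\<^sup>2) + \<beta> * (- (pi / 2)) + \<kappa> * (- (pi / 2))))"
  proof (rule nn_integral_FTC_UNIV[OF deriv _ _ lim(2,1)])
    show "isCont (\<lambda>c. cauchy a (t - b * c) * cauchy 1 c) c" for c
      using Q[of c] c1[of c] a unfolding cauchy_def Q_def by (intro continuous_intros) auto
  qed (use a in \<open>auto intro!: mult_nonneg_nonneg cauchy_nonneg\<close>)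
  also have "a / pi\<^sup>2 * (\<alpha> / 2 * ln (1 / b\<^sup>2) + \<beta> * (pi / 2) + \<kappa> * (pi / 2)) -
        a / pi\<^sup>2 * (\<alpha> / 2 * ln (1 / b\<^sup>2) + \<beta> * (- (pi / 2)) + \<kappa> * (- (pi / 2))) = a * (\<beta> + \<kappa>) / pi"
    by (simp add: field_simps power2_eq_square)
  also have "a * (\<beta> + \<kappa>) / pi = cauchy (a + b) t"
  proof -
    have s: "0 < (a + b)\<^sup>2 + t\<^sup>2" "0 < (a - b)\<^sup>2 + t\<^sup>2" using t by (simp_all add: add_nonneg_pos)
    have "b * D * (a * (\<beta> + \<kappa>)) = a * b * (D * \<beta>) + D - (D * \<beta>) * (a\<^sup>2 + t\<^sup>2) - (D * \<alpha>) * b * t"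
      using a b by (simp add: \<kappa>_def \<delta>_def field_simps)
    also have "\<dots> = b * ((a + b) * ((a - b)\<^sup>2 + t\<^sup>2))"
      unfolding Dab by (simp add: D' power2_eq_square algebra_simps)
    finally have "((a - b)\<^sup>2 + t\<^sup>2) * (((a + b)\<^sup>2 + t\<^sup>2) * (a * (\<beta> + \<kappa>))) = ((a - b)\<^sup>2 + t\<^sup>2) * (a + b)"
      using b by (simp add: D_def mult_ac)
    hence "((a + b)\<^sup>2 + t\<^sup>2) * (a * (\<beta> + \<kappa>)) = a + b" using s(2) mult_left_cancel by (metis less_irrefl)
    hence "a * (\<beta> + \<kappa>) = (a + b) / ((a + b)\<^sup>2 + t\<^sup>2)"
      using s(1) by (metis less_irrefl nonzero_mult_div_cancel_left)
    thus ?thesis by (simp add: cauchy_def)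
  qed
  finally show ?thesis .
qed

lemma nn_integral_cauchy: "(\<integral>\<^sup>+c. cauchy 1 c \<partial>lborel) = 1"
proof -
  have "(\<integral>\<^sup>+c. cauchy 1 c \<partial>lborel) = ennreal (1 / pi * (pi / 2) - 1 / pi * (- (pi / 2)))"
  proof (rule nn_integral_FTC_UNIV)
    show "DERIV (\<lambda>c. 1 / pi * arctan c) c :> cauchy 1 c" for c
      by (auto intro!: derivative_eq_intros simp: cauchy_def divide_inverse)
    show "isCont (cauchy 1) c" for c
      unfolding cauchy_def by (intro continuous_intros) (simp add: add_nonneg_eq_0_iff)
    show "((\<lambda>c. 1 / pi * arctan c) \<longlongrightarrow> 1 / pi * (- (pi / 2))) at_bot"
      "((\<lambda>c. 1 / pi * arctan c) \<longlongrightarrow> 1 / pi * (pi / 2)) at_top"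
      by (intro tendsto_intros tendsto_arctan_at_top tendsto_arctan_at_bot)+
  qed (simp add: cauchy_nonneg)
  thus ?thesis by simp
qed

text \<open>The \<open>p\<close>-th absolute moment of \<open>v + S * C\<close> for a standard
  Cauchy variable \<open>C\<close>. The offset \<open>v\<close> is carried along so that the
  variables of a longer sum can be integrated out one by one.\<close>

definition cauchy_mean :: "real \<Rightarrow> real \<Rightarrow> real \<Rightarrow> ennreal" where
  "cauchy_mean p S v = (\<integral>\<^sup>+c. ennreal (\<bar>v + S * c\<bar> powr p) * ennreal (cauchy 1 c) \<partial>lborel)"

lemma cauchy_mean_zero: "cauchy_mean p 0 v = ennreal (\<bar>v\<bar> powr p)"
  by (simp add: cauchy_mean_def nn_integral_cmult nn_integral_cauchy)

lemma cauchy_mean_density: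
  assumes "0 < S"
  shows "cauchy_mean p S v = (\<integral>\<^sup>+w. ennreal (\<bar>w\<bar> powr p) * ennreal (cauchy S (w - v)) \<partial>lborel)"
proof -
  have "S * cauchy S (S * c) = cauchy 1 c" for c
  proof -
    have "S\<^sup>2 + (S * c)\<^sup>2 = S * (S * (1 + c\<^sup>2))" by (simp add: power2_eq_square algebra_simps)
    thus ?thesis using assms by (simp add: cauchy_def)
  qed
  hence "ennreal S * (x * ennreal (cauchy S (S * c))) = x * ennreal (cauchy 1 c)" for c x
    using assms by (metis ennreal_mult' less_imp_le mult.left_commute)
  thus ?thesis
    unfolding cauchy_mean_def using assms
    by (subst (2) nn_integral_real_affine[where c=S and t=v]) (auto simp flip: nn_integral_cmult)
qed

text \<open>Stability of the Cauchy law: a further independent variable with coefficient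
  \<open>b\<close> only enlarges the scale, by \<open>\<bar>b\<bar>\<close>. For
  \<open>b > 0\<close> this is Fubini and the convolution formula, which misses only the null set
  \<open>w = v\<close>; negative \<open>b\<close> reduces to this because the density is
  even.\<close>

lemma cauchy_mean_step:
  assumes S: "0 \<le> S"
  shows "(\<integral>\<^sup>+c. cauchy_mean p S (v + b * c) * ennreal (cauchy 1 c) \<partial>lborel) = cauchy_mean p (S + \<bar>b\<bar>) v"
proof -
  have pos: "(\<integral>\<^sup>+c. cauchy_mean p S (v + b * c) * ennreal (cauchy 1 c) \<partial>lborel) = cauchy_mean p (S + b) v"
    if b: "0 < b" for b
  proof (cases "S = 0")
    case True
    thus ?thesis by (simp add: cauchy_mean_zero) (simp add: cauchy_mean_def)
  next
    case False
    hence S: "0 < S" using S by simp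
    have "(\<integral>\<^sup>+c. cauchy_mean p S (v + b * c) * ennreal (cauchy 1 c) \<partial>lborel) =
      (\<integral>\<^sup>+c. (\<integral>\<^sup>+w. ennreal (\<bar>w\<bar> powr p) * ennreal (cauchy S (w - v - b * c) * cauchy 1 c) \<partial>lborel) \<partial>lborel)"
      unfolding cauchy_mean_density[OF S]
      by (subst nn_integral_multc[symmetric])
        (use S in \<open>auto simp: ennreal_mult cauchy_nonneg mult.assoc diff_diff_eq intro!: nn_integral_cong\<close>)
    also have "\<dots> = (\<integral>\<^sup>+w. (\<integral>\<^sup>+c. ennreal (\<bar>w\<bar> powr p) * ennreal (cauchy S (w - v - b * c) * cauchy 1 c) \<partial>lborel) \<partial>lborel)"
      unfolding cauchy_def by (rule lborel_pair.Fubini') measurable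
    also have "\<dots> = (\<integral>\<^sup>+w. ennreal (\<bar>w\<bar> powr p) * (\<integral>\<^sup>+c. ennreal (cauchy S (w - v - b * c) * cauchy 1 c) \<partial>lborel) \<partial>lborel)"
      by (intro nn_integral_cong nn_integral_cmult) measurable
    also have "\<dots> = (\<integral>\<^sup>+w. ennreal (\<bar>w\<bar> powr p) * ennreal (cauchy (S + b) (w - v)) \<partial>lborel)"
      by (intro nn_integral_cong_AE eventually_mono[OF AE_lborel_singleton[of v]])
        (simp add: cauchy_convolution[OF S b])
    also have "\<dots> = cauchy_mean p (S + b) v" using S b by (simp add: cauchy_mean_density)
    finally show ?thesis .
  qed
  consider "b > 0" | "b = 0" | "b < 0" by linarith
  thus ?thesis
  proof cases
    case 3
    have "(\<integral>\<^sup>+c. cauchy_mean p S (v + b * c) * ennreal (cauchy 1 c) \<partial>lborel) =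
      (\<integral>\<^sup>+c. cauchy_mean p S (v + (- b) * c) * ennreal (cauchy 1 c) \<partial>lborel)"
      unfolding cauchy_mean_def cauchy_def
      by (subst nn_integral_real_affine[where c="-1" and t=0]) auto
    thus ?thesis using pos[of "-b"] 3 by simp
  qed (use pos in \<open>auto simp: nn_integral_cmult nn_integral_cauchy\<close>)
qed

lemma cauchy_mean_homogeneous:
  assumes "0 \<le> S"
  shows "cauchy_mean p S 0 = ennreal (S powr p) * cauchy_mean p 1 0"
  unfolding cauchy_mean_def using assms
  by (subst nn_integral_cmult[symmetric]) (auto simp: abs_mult powr_mult ennreal_mult mult.assoc)


lemma cauchy_mean_measurable [measurable (raw)]:
  assumes [measurable]: "S \<in> borel_measurable M" "v \<in> borel_measurable M"
  shows "(\<lambda>x. cauchy_mean p (S x) (v x)) \<in> borel_measurable M"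
  unfolding cauchy_mean_def by measurable

text \<open>Trades one summand \<open>\<bar>x \<bullet> \<eta>\<bar>\<close> of the scale for an
  average over the shifted directions \<open>\<xi> + c *\<^sub>R \<eta>\<close>. Iterated, it
  reduces a sum of absolute linear forms to directional moments.\<close>

lemma nn_integral_cauchy_mean_add:
  fixes S :: "'a::euclidean_space \<Rightarrow> real"
  assumes [measurable]: "S \<in> borel_measurable borel" and S: "\<And>x. 0 \<le> S x"
    and \<mu>: "finite_measure \<mu>" and [measurable_cong]: "sets \<mu> = sets borel"
  shows "(\<integral>\<^sup>+x. cauchy_mean p (\<bar>x \<bullet> \<eta>\<bar> + S x) (x \<bullet> \<xi>) \<partial>\<mu>) =
    (\<integral>\<^sup>+c. (\<integral>\<^sup>+x. cauchy_mean p (S x) (x \<bullet> (\<xi> + c *\<^sub>R \<eta>)) \<partial>\<mu>) * ennreal (cauchy 1 c) \<partial>lborel)"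
proof -
  interpret \<mu>: finite_measure \<mu> by fact
  interpret pair_sigma_finite lborel \<mu> by unfold_locales
  have "(\<integral>\<^sup>+x. cauchy_mean p (\<bar>x \<bullet> \<eta>\<bar> + S x) (x \<bullet> \<xi>) \<partial>\<mu>) =
    (\<integral>\<^sup>+x. (\<integral>\<^sup>+c. cauchy_mean p (S x) (x \<bullet> \<xi> + (x \<bullet> \<eta>) * c) * ennreal (cauchy 1 c) \<partial>lborel) \<partial>\<mu>)"
    by (simp add: cauchy_mean_step[OF S] add.commute)
  also have "\<dots> = (\<integral>\<^sup>+c. (\<integral>\<^sup>+x. cauchy_mean p (S x) (x \<bullet> \<xi> + (x \<bullet> \<eta>) * c) * ennreal (cauchy 1 c) \<partial>\<mu>) \<partial>lborel)"
    by (rule Fubini') measurable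
  also have "\<dots> = (\<integral>\<^sup>+c. (\<integral>\<^sup>+x. cauchy_mean p (S x) (x \<bullet> (\<xi> + c *\<^sub>R \<eta>)) \<partial>\<mu>) * ennreal (cauchy 1 c) \<partial>lborel)"
    by (intro nn_integral_cong) (simp add: nn_integral_multc inner_add_right mult.commute[of "x \<bullet> \<eta>" for x])
  finally show ?thesis .
qed

text \<open>The singularity at 0 is integrable for \<open>p > -1\<close>, and the tail, of order
  \<open>\<bar>c\<bar> powr (p - 2)\<close>, for \<open>p < 1\<close>. Finiteness and positivity
  together allow this factor to be cancelled from an inequality.\<close>

lemma cauchy_moment_finite:
  assumes p: "-1 < p" "p < 1"
  shows "cauchy_mean p 1 0 < \<infinity>" "0 < cauchy_mean p 1 0"
proof -
  show "cauchy_mean p 1 0 < \<infinity>"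
  proof (cases "p \<le> 0")
    case True
    have "(\<integral>\<^sup>+u. ennreal (\<bar>u - 0\<bar> powr - (- p)) * ennreal (cauchy 1 u) \<partial>lborel)
     \<le> ennreal (1 powr - (- p)) * (\<integral>\<^sup>+u. ennreal (cauchy 1 u) \<partial>lborel) + ennreal (2 * (1 powr (1 - (- p)) / (1 - (- p)))) * ennreal (1 / pi)"
      by (rule nn_integral_singular_kernel_le)
        (use p True in \<open>auto simp: cauchy_def intro!: ennreal_leI divide_left_mono mult_pos_pos add_pos_nonneg\<close>)
    also have "\<dots> < \<infinity>" by (simp add: nn_integral_cauchy ennreal_mult_less_top)
    finally show ?thesis by (simp add: cauchy_mean_def)
  next
    case False
    have "cauchy_mean p 1 0 \<le> (\<integral>\<^sup>+c. ennreal (2 * cauchy 1 c) + ennreal (((1 + \<bar>c\<bar>) powr (p - 2)) * 4) \<partial>lborel)"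
      unfolding cauchy_mean_def
    proof (intro nn_integral_mono)
      fix c :: real
      have "\<bar>c\<bar> powr p * cauchy 1 c \<le> (1 + \<bar>c\<bar>) powr (p - 2) * 4"
      proof -
        have "\<bar>c\<bar> powr p * cauchy 1 c \<le> (1 + \<bar>c\<bar>) powr p * (4 / (1 + \<bar>c\<bar>)\<^sup>2)"
        proof (rule mult_mono)
          have "(1 + \<bar>c\<bar>)\<^sup>2 \<le> 2 * (1 + c\<^sup>2)"
            using sum_squares_bound[of 1 "\<bar>c\<bar>"] by (simp add: power2_eq_square algebra_simps)
          also have "\<dots> \<le> 4 * (pi * (1 + c\<^sup>2))"
            unfolding mult.assoc[symmetric] using pi_gt3 by (intro mult_right_mono) auto
          finally have "(1 + \<bar>c\<bar>)\<^sup>2 \<le> 4 * (pi * (1 + c\<^sup>2))" .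
          moreover have "0 < pi * (1 + c\<^sup>2)" by (simp add: add_pos_nonneg)
          ultimately show "cauchy 1 c \<le> 4 / (1 + \<bar>c\<bar>)\<^sup>2"
            by (simp add: cauchy_def field_simps add_nonneg_eq_0_iff)
        qed (use False in \<open>auto intro!: powr_mono2 cauchy_nonneg\<close>)
        also have "\<dots> = (1 + \<bar>c\<bar>) powr (p - 2) * 4"
          by (simp add: powr_diff powr_numeral)
        finally show ?thesis .
      qed
      thus "ennreal (\<bar>0 + 1 * c\<bar> powr p) * ennreal (cauchy 1 c) \<le>
        ennreal (2 * cauchy 1 c) + ennreal (((1 + \<bar>c\<bar>) powr (p - 2)) * 4)"
        by (intro add_increasing) (auto simp flip: ennreal_mult' intro!: ennreal_leI)
    qed
    also have "\<dots> < \<infinity>"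
      using p nn_integral_powr_tail[of "p - 2" 1]
      by (simp add: nn_integral_add nn_integral_cmult nn_integral_multc ennreal_mult' nn_integral_cauchy ennreal_mult_less_top)
    finally show ?thesis .
  qed
  show "0 < cauchy_mean p 1 0"
  proof (rule ccontr)
    assume "\<not> 0 < cauchy_mean p 1 0"
    hence "AE c in lborel. ennreal (\<bar>c\<bar> powr p) * ennreal (cauchy 1 c) = 0"
      unfolding cauchy_mean_def by (subst (asm) not_gr_zero, subst (asm) nn_integral_0_iff_AE) auto
    hence "AE c::real in lborel. False"
      using AE_lborel_singleton[of 0]
    proof eventually_elim
      case (elim c)
      have "0 < 1 + c\<^sup>2" by (simp add: add_pos_nonneg)
      hence "0 < \<bar>c\<bar> powr p" "0 < cauchy 1 c" using elim by (simp_all add: cauchy_def)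
      thus False using elim by (simp add: ennreal_zero_less_mult_iff flip: not_gr_zero)
    qed
    thus False by (simp add: trivial_limit_def[symmetric] ae_filter_eq_bot_iff)
  qed
qed

lemma nn_integral_sum_abs_inner_powr_le:
  fixes \<mu> \<nu> :: "'a::euclidean_space measure"
  assumes p: "-1 < p" "p < 1"
    and \<mu>: "finite_measure \<mu>" "sets \<mu> = sets borel"
    and \<nu>: "finite_measure \<nu>" "sets \<nu> = sets borel"
    and le: "\<And>\<xi>. directional_moment p \<mu> \<xi> \<le> directional_moment p \<nu> \<xi>"
    and I: "finite I"
  shows "(\<integral>\<^sup>+x. ennreal ((\<Sum>i\<in>I. \<bar>x \<bullet> \<eta> i\<bar>) powr p) \<partial>\<mu>) \<le> (\<integral>\<^sup>+x. ennreal ((\<Sum>i\<in>I. \<bar>x \<bullet> \<eta> i\<bar>) powr p) \<partial>\<nu>)"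
proof -
  note [measurable_cong] = \<mu>(2) \<nu>(2)
  \<comment> \<open>The induction needs all offsets \<open>x \<bullet> \<xi>\<close> at once, since
    each step moves \<open>\<xi>\<close>. Only \<open>\<xi> = 0\<close> is used afterwards, where
    homogeneity turns the mean into the power of the sum times
    \<open>cauchy_mean p 1 0\<close>.\<close>
  have "(\<integral>\<^sup>+x. cauchy_mean p (\<Sum>i\<in>I. \<bar>x \<bullet> \<eta> i\<bar>) (x \<bullet> \<xi>) \<partial>\<mu>) \<le> (\<integral>\<^sup>+x. cauchy_mean p (\<Sum>i\<in>I. \<bar>x \<bullet> \<eta> i\<bar>) (x \<bullet> \<xi>) \<partial>\<nu>)" for \<xi>
    using I
  proof (induction I arbitrary: \<xi>)
    case empty
    thus ?case by (simp add: cauchy_mean_zero le)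
  next
    case (insert i I)
    have "(\<lambda>x. \<Sum>i\<in>I. \<bar>x \<bullet> \<eta> i\<bar>) \<in> borel_measurable borel" by measurable
    note * = nn_integral_cauchy_mean_add[OF this sum_nonneg[OF abs_ge_zero]]
    show ?case
      using insert.hyps by (simp add: *[OF \<mu>] *[OF \<nu>] insert.IH nn_integral_mono mult_right_mono)
  qed
  from this[of 0] have "cauchy_mean p 1 0 * (\<integral>\<^sup>+x. ennreal ((\<Sum>i\<in>I. \<bar>x \<bullet> \<eta> i\<bar>) powr p) \<partial>\<mu>)
      \<le> cauchy_mean p 1 0 * (\<integral>\<^sup>+x. ennreal ((\<Sum>i\<in>I. \<bar>x \<bullet> \<eta> i\<bar>) powr p) \<partial>\<nu>)"
    by (simp add: cauchy_mean_homogeneous[of "\<Sum>i\<in>I. \<bar>x \<bullet> \<eta> i\<bar>" for x] sum_nonneg nn_integral_multc)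
      (simp only: mult.commute)
  thus ?thesis
    using cauchy_moment_finite[OF p] by (simp add: ennreal_mult_le_mult_iff)
qed


text \<open>The approximants interpolate \<open>t \<mapsto> N (1, t)\<close> linearly between the nodes \<open>-k + i / k\<close> and
  continue it with slope \<open>\<plusminus>N (0, 1)\<close>; convexity makes the coefficients nonnegative.\<close>

lemma norm_fun_zonotope_approximation:
  fixes N :: "real \<times> real \<Rightarrow> real"
  assumes N: "norm_fun N" and k: "0 < k"
  obtains \<eta> :: "nat \<Rightarrow> real \<times> real" and m :: nat where
    "\<And>x. N x \<le> (\<Sum>i\<le>m. \<bar>x \<bullet> \<eta> i\<bar>)"
    "\<And>t. \<bar>t\<bar> \<le> real k \<Longrightarrow> (\<Sum>i\<le>m. \<bar>(1, t) \<bullet> \<eta> i\<bar>) \<le> N (1, t) + 2 * N (0, 1) / k"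
    "\<And>s. (\<Sum>i\<le>m. \<bar>(0, s) \<bullet> \<eta> i\<bar>) = N (0, 1) * \<bar>s\<bar>"
proof -
  define b where "b = N (0, 1)"
  define \<phi> where "\<phi> t = N (1, t)" for t
  \<comment> \<open>The interval from \<open>- k\<close> to \<open>k\<close> consists of
    \<open>2 * k * k\<close> steps of length \<open>h = 1 / k\<close>, so that
    \<open>\<tau> n = k\<close>.\<close>
  define n where "n = 2 * k * k"
  define h where "h = 1 / real k"
  define \<tau> where "\<tau> i = - real k + real i * h" for i
  define d where "d i = (if i = 0 then - b else if i \<le> n then (\<phi> (\<tau> i) - \<phi> (\<tau> (i - 1))) / h else b)" for i
  \<comment> \<open>The jumps of the slope at the nodes. They telescope to \<open>2 * b\<close>,
    which is why the approximant equals \<open>b * \<bar>s\<bar>\<close> on the vertical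
    axis.\<close>
  define e where "e i = d (Suc i) - d i" for i
  \<comment> \<open>Each hinge \<open>max 0 (t - \<tau> i)\<close> is half of
    \<open>\<bar>t - \<tau> i\<bar>\<close> plus half of a linear function. The linear halves cancel
    the initial slope \<open>- b\<close>, and \<open>c\<close> is the constant that remains.\<close>
  define c where "c = (\<phi> (\<tau> 0) + \<phi> (\<tau> n) - b * (\<tau> n - \<tau> 0)) / 2"
  have h: "0 < h" using k by (simp add: h_def)
  have b: "0 < b" unfolding b_def by (rule norm_fun_pos[OF N]) (simp add: zero_prod_def)
  have N0: "N (0, s) = b * \<bar>s\<bar>" for s
    using norm_fun_scaleR[OF N, of s "(0, 1)"] by (simp add: b_def)
  have lip: "\<bar>\<phi> s - \<phi> t\<bar> \<le> b * \<bar>s - t\<bar>" for s t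
    using norm_fun_diff[OF N, of "(1, s)" "(1, t)"] by (simp add: \<phi>_def N0)
  have mid: "2 * \<phi> t \<le> \<phi> (t - h) + \<phi> (t + h)" for t
    using norm_fun_triangle[OF N, of "(1, t - h)" "(1, t + h)"] norm_fun_scaleR[OF N, of 2 "(1, t)"]
    by (simp add: \<phi>_def)
  have \<tau>_Suc: "\<tau> (Suc i) = \<tau> i + h" for i by (simp add: \<tau>_def algebra_simps)
  have \<tau>_mono: "\<tau> i \<le> \<tau> j" if "i \<le> j" for i j using that h by (simp add: \<tau>_def)
  have \<tau>0: "\<tau> 0 = - real k" by (simp add: \<tau>_def)
  have \<tau>n: "\<tau> n = real k" using k by (simp add: \<tau>_def n_def h_def)
  have dS: "d (Suc i) = (\<phi> (\<tau> (Suc i)) - \<phi> (\<tau> i)) / h" if "i < n" for i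
    using that by (simp add: d_def)
  have n: "0 < n" using k by (simp add: n_def)
  have dn: "d (Suc n) = b" and d0: "d 0 = - b" by (simp_all add: d_def)
  have d_le: "\<bar>d i\<bar> \<le> b" for i
  proof (cases "i = 0 \<or> i > n")
    case True thus ?thesis using b by (auto simp: d_def)
  next
    case False
    then obtain i' where i': "i = Suc i'" "i' < n" by (cases i) auto
    have "\<bar>\<phi> (\<tau> i) - \<phi> (\<tau> i')\<bar> \<le> b * h" using lip[of "\<tau> i" "\<tau> i'"] h by (simp add: i' \<tau>_Suc)
    thus ?thesis using h by (simp add: i' dS field_simps)
  qed
  have e: "0 \<le> e i" if "i \<le> n" for i
  proof -
    have "i = 0 \<or> i = n \<or> (\<exists>j. i = Suc j \<and> i < n)" using that by (cases i) auto
    then consider "i = 0" | "i = n" | j where "i = Suc j" "i < n" by blast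
    thus ?thesis
    proof cases
      case 1 thus ?thesis using d_le[of 1] by (simp add: e_def d0)
    next
      case 2 thus ?thesis using d_le[of n] by (simp add: e_def dn)
    next
      case 3
      have "0 \<le> \<phi> (\<tau> j) + \<phi> (\<tau> j + h + h) - 2 * \<phi> (\<tau> j + h)" using mid[of "\<tau> j + h"] by simp
      thus ?thesis using 3 h by (simp add: e_def dS \<tau>_Suc flip: diff_divide_distrib)
    qed
  qed
  define L where "L t = \<phi> (\<tau> 0) - b * (t - \<tau> 0) + (\<Sum>i\<le>n. e i * max 0 (t - \<tau> i))" for t
  have partial: "\<phi> (\<tau> 0) - b * (t - \<tau> 0) + (\<Sum>i\<le>j. e i * (t - \<tau> i)) = \<phi> (\<tau> j) + d (Suc j) * (t - \<tau> j)"
    if "j \<le> n" for j t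
    using that
  proof (induction j)
    case 0 thus ?case by (simp add: e_def d0 algebra_simps)
  next
    case (Suc j)
    have "h * d (Suc j) = \<phi> (\<tau> (Suc j)) - \<phi> (\<tau> j)" using Suc.prems h by (simp add: dS)
    thus ?case using Suc by (simp add: e_def \<tau>_Suc algebra_simps)
  qed
  have L_eq: "L t = \<phi> (\<tau> j) + d (Suc j) * (t - \<tau> j)" if "j \<le> n" "\<tau> j \<le> t" "j < n \<Longrightarrow> t \<le> \<tau> (Suc j)" for j t
  proof -
    have "(\<Sum>i\<le>n. e i * max 0 (t - \<tau> i)) = (\<Sum>i\<le>j. e i * (t - \<tau> i))"
    proof (rule sum.mono_neutral_cong_right)
      show "\<forall>i\<in>{..n} - {..j}. e i * max 0 (t - \<tau> i) = 0"
      proof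
        fix i assume "i \<in> {..n} - {..j}"
        hence "t \<le> \<tau> i" using that \<tau>_mono[of "Suc j" i] by auto
        thus "e i * max 0 (t - \<tau> i) = 0" by simp
      qed
      show "e i * max 0 (t - \<tau> i) = e i * (t - \<tau> i)" if "i \<in> {..j}" for i
        using that \<open>\<tau> j \<le> t\<close> \<tau>_mono[of i j] by simp
    qed (use that in auto)
    thus ?thesis using partial[OF that(1), of t] by (simp add: L_def)
  qed
  have L_abs: "L t = c + (\<Sum>i\<le>n. e i / 2 * \<bar>t - \<tau> i\<bar>)" for t
  proof -
    have "(\<Sum>i\<le>n. e i * max 0 (t - \<tau> i)) = (\<Sum>i\<le>n. e i * (t - \<tau> i)) / 2 + (\<Sum>i\<le>n. e i / 2 * \<bar>t - \<tau> i\<bar>)"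
      unfolding sum_divide_distrib sum.distrib[symmetric]
      by (intro sum.cong) (auto simp: max_def field_simps)
    moreover have "(\<Sum>i\<le>n. e i * (t - \<tau> i)) = \<phi> (\<tau> n) + b * (t - \<tau> n) - (\<phi> (\<tau> 0) - b * (t - \<tau> 0))"
      using partial[of n t] by (simp add: dn)
    ultimately show ?thesis by (simp add: L_def c_def field_simps)
  qed
  have index: "\<exists>j\<le>n. \<tau> j \<le> t \<and> t \<le> \<tau> (Suc j)" if "\<bar>t\<bar> \<le> real k" for t
  proof -
    define j where "j = nat \<lfloor>(t + k) / h\<rfloor>"
    have nn: "0 \<le> (t + k) / h" using that h by auto
    have j: "real j \<le> (t + k) / h" "(t + k) / h \<le> real j + 1"
      using nn by (auto simp: j_def)
    have "(t + k) / h \<le> (\<tau> n + k) / h" using that h by (simp add: \<tau>n divide_right_mono)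
    also have "\<dots> = real n" using h by (simp add: \<tau>_def)
    finally have "j \<le> n" using j(1) by linarith
    moreover have "\<tau> j \<le> t" "t \<le> \<tau> (Suc j)" using j h by (simp_all add: \<tau>_def field_simps)
    ultimately show ?thesis by blast
  qed
  \<comment> \<open>One Lipschitz error for \<open>\<phi>\<close> and one for its interpolant, each
    at most \<open>b * h\<close>.\<close>
  have L_upper: "L t \<le> \<phi> t + 2 * b / k" if t: "\<bar>t\<bar> \<le> real k" for t
  proof -
    obtain j where j: "j \<le> n" "\<tau> j \<le> t" "t \<le> \<tau> (Suc j)" using index[OF t] by blast
    have "\<phi> (\<tau> j) - \<phi> t \<le> b * (t - \<tau> j)" using lip[of "\<tau> j" t] j by simp
    moreover have "d (Suc j) * (t - \<tau> j) \<le> b * (t - \<tau> j)"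
      using d_le[of "Suc j"] j by (intro mult_right_mono) auto
    moreover have "b * (t - \<tau> j) \<le> b * h" using j b by (simp add: \<tau>_Suc)
    ultimately have "L t \<le> \<phi> t + 2 * (b * h)" using L_eq[of j t] j by simp
    thus ?thesis by (simp add: h_def)
  qed
  have L_lower: "\<phi> t \<le> L t" for t
  proof -
    consider "t < - real k" | "\<bar>t\<bar> \<le> real k" | "t > k" by linarith
    thus ?thesis
    proof cases
      case 1
      have "(\<Sum>i\<le>n. e i * max 0 (t - \<tau> i)) = 0"
      proof (rule sum.neutral, rule ballI)
        fix i show "e i * max 0 (t - \<tau> i) = 0" using \<tau>_mono[of 0 i] 1 \<tau>0 by simp
      qed
      thus ?thesis using lip[of t "\<tau> 0"] 1 by (simp add: L_def \<tau>0 algebra_simps)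
    next
      case 2
      obtain j where j: "j \<le> n" "\<tau> j \<le> t" "t \<le> \<tau> (Suc j)" using index[OF 2] by blast
      show ?thesis
      proof (cases "j = n")
        case True
        thus ?thesis using L_eq[of n t] j lip[of t "\<tau> n"] by (simp add: dn algebra_simps)
      next
        case False
        hence jn: "j < n" using j by simp
        define u where "u = (t - \<tau> j) / h"
        have u: "0 \<le> u" "u \<le> 1" "t = \<tau> j + u * h" using j h by (simp_all add: u_def \<tau>_Suc)
        have eq: "(1, t) = (1 - u) *\<^sub>R (1, \<tau> j) + u *\<^sub>R (1, \<tau> (Suc j))"
          by (simp add: u \<tau>_Suc algebra_simps)
        have "\<phi> t \<le> (1 - u) * \<phi> (\<tau> j) + u * \<phi> (\<tau> (Suc j))"
          using norm_fun_triangle[OF N, of "(1 - u) *\<^sub>R (1, \<tau> j)" "u *\<^sub>R (1, \<tau> (Suc j))"] u(1,2)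
          unfolding \<phi>_def eq by (simp add: norm_fun_scaleR[OF N] del: scaleR_Pair)
        also have "\<dots> = \<phi> (\<tau> j) + d (Suc j) * (t - \<tau> j)"
        proof -
          have "\<phi> (\<tau> (Suc j)) = \<phi> (\<tau> j) + h * d (Suc j)" using h by (simp add: dS[OF jn])
          thus ?thesis by (simp only: u(3)) (simp add: algebra_simps)
        qed
        also have "\<dots> = L t" using j by (simp add: L_eq)
        finally show ?thesis .
      qed
    next
      case 3
      thus ?thesis using L_eq[of n t] lip[of t "\<tau> n"] by (simp add: dn \<tau>n algebra_simps)
    qed
  qed
  \<comment> \<open>The difference of \<open>(1, \<tau> n)\<close> and \<open>(1, \<tau> 0)\<close>
    is vertical with norm \<open>b * (\<tau> n - \<tau> 0)\<close>, so this is the triangle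
    inequality.\<close>
  have c: "0 \<le> c"
    using norm_fun_triangle[OF N, of "(1, \<tau> n)" "- (1, \<tau> 0)"] norm_fun_minus[OF N, of "(1, \<tau> 0)"] \<tau>_mono[of 0 n]
    by (simp add: c_def \<phi>_def N0)
  \<comment> \<open>Pairing with \<open>(1, t)\<close> gives
    \<open>e i / 2 * (t - \<tau> i)\<close>. The extra vector \<open>(c, 0)\<close> supplies the
    constant, so that \<open>L\<close> extends to a function homogeneous of degree one.\<close>
  define \<eta> :: "nat \<Rightarrow> real \<times> real" where "\<eta> i = (if i \<le> n then (e i / 2) *\<^sub>R (- \<tau> i, 1) else (c, 0))" for i
  define M where "M x = (\<Sum>i\<le>Suc n. \<bar>x \<bullet> \<eta> i\<bar>)" for x
  have M: "M x = c * \<bar>fst x\<bar> + (\<Sum>i\<le>n. e i / 2 * \<bar>snd x - \<tau> i * fst x\<bar>)" for x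
  proof -
    have "(\<Sum>i\<le>n. \<bar>x \<bullet> \<eta> i\<bar>) = (\<Sum>i\<le>n. e i / 2 * \<bar>snd x - \<tau> i * fst x\<bar>)"
    proof (intro sum.cong refl)
      fix i assume "i \<in> {..n}"
      hence i: "i \<le> n" by simp
      have eq: "x \<bullet> \<eta> i = e i / 2 * (snd x - \<tau> i * fst x)"
        using i by (simp add: \<eta>_def inner_prod_def algebra_simps diff_divide_distrib)
      show "\<bar>x \<bullet> \<eta> i\<bar> = e i / 2 * \<bar>snd x - \<tau> i * fst x\<bar>"
        using e[OF i] by (simp only: eq abs_mult)
    qed
    thus ?thesis using c by (simp add: M_def \<eta>_def inner_prod_def abs_mult)
  qed
  have M1: "M (1, t) = L t" for t by (simp add: M L_abs)
  have Mhom: "M (r *\<^sub>R x) = \<bar>r\<bar> * M x" for r x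
    by (simp add: M_def abs_mult sum_distrib_left del: sum.atMost_Suc)
  have M0: "M (0, s) = b * \<bar>s\<bar>" for s
  proof -
    have "(\<Sum>i\<le>n. e i) = d (Suc n) - d 0"
      unfolding e_def using sum_lessThan_telescope[of d "Suc n"] by (simp only: lessThan_Suc_atMost)
    hence "(\<Sum>i\<le>n. e i / 2) = b" by (simp add: dn d0 flip: sum_divide_distrib)
    moreover have "M (0, s) = (\<Sum>i\<le>n. e i / 2) * \<bar>s\<bar>"
      unfolding M sum_distrib_right by simp
    ultimately show ?thesis by simp
  qed
  have "N x \<le> M x" for x
  proof (cases "fst x = 0")
    case True
    thus ?thesis using N0[of "snd x"] M0[of "snd x"] by (cases x) simp
  next
    case False
    have x: "x = fst x *\<^sub>R (1, snd x / fst x)" using False by (cases x) simp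
    have "N x = \<bar>fst x\<bar> * \<phi> (snd x / fst x)" by (subst x) (simp only: norm_fun_scaleR[OF N] \<phi>_def)
    also have "\<dots> \<le> \<bar>fst x\<bar> * M (1, snd x / fst x)" using L_lower by (simp add: M1 mult_left_mono)
    also have "\<dots> = M x" by (subst (3) x) (simp only: Mhom)
    finally show ?thesis .
  qed
  thus ?thesis using that[of \<eta> "Suc n"] L_upper M0 M1 by (simp add: M_def \<phi>_def b_def)
qed


text \<open>Since hyperplanes are null sets, the junk value \<open>0 powr p = 0\<close> for \<open>p < 0\<close> is harmless.\<close>

definition moment_measure :: "real \<Rightarrow> 'a::euclidean_space measure \<Rightarrow> bool" where
  "moment_measure p \<mu> \<longleftrightarrow> finite_measure \<mu> \<and> sets \<mu> = sets borel \<and>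
     (\<forall>\<xi>. \<xi> \<noteq> 0 \<longrightarrow> (AE x in \<mu>. x \<bullet> \<xi> \<noteq> 0)) \<and> (\<integral>\<^sup>+x. ennreal (norm x powr p) \<partial>\<mu>) < \<infinity>"

text \<open>A measure-theoretic substitute for the representation of \<open>N\<^sup>p\<close> as a mixture of the functions
  \<open>\<bar>x \<bullet> \<xi>\<bar>\<^sup>p\<close>, that is, for the isometric embedding of \<open>N\<close> into \<open>L\<^sub>p\<close>.\<close>

definition embeds_in_Lp :: "real \<Rightarrow> ('a::euclidean_space \<Rightarrow> real) \<Rightarrow> bool" where
  "embeds_in_Lp p N \<longleftrightarrow> (\<forall>\<mu> \<nu>. moment_measure p \<mu> \<longrightarrow> moment_measure p \<nu> \<longrightarrow>
     (\<forall>\<xi>. directional_moment p \<mu> \<xi> \<le> directional_moment p \<nu> \<xi>) \<longrightarrow>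
     norm_moment p \<mu> N \<le> norm_moment p \<nu> N)"

text \<open>The approximants \<open>M k\<close> are sums of absolute linear forms and satisfy the
  comparison; dominated convergence carries it to \<open>N\<close>. Domination uses a uniform upper
  bound for \<open>p \<ge> 0\<close>. For \<open>p < 0\<close> it uses that the approximants lie
  above \<open>N\<close>, hence above a fixed multiple of the Euclidean norm.\<close>

lemma planar_norm_embeds_in_Lp:
  fixes N :: "real \<times> real \<Rightarrow> real"
  assumes N: "norm_fun N" and p: "-1 < p" "p < 1"
  shows "embeds_in_Lp p N"
  unfolding embeds_in_Lp_def
proof (intro allI impI)
  fix \<mu> \<nu> :: "(real \<times> real) measure"
  assume \<mu>: "moment_measure p \<mu>" and \<nu>: "moment_measure p \<nu>"
    and le: "\<forall>\<xi>. directional_moment p \<mu> \<xi> \<le> directional_moment p \<nu> \<xi>"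
  define b where "b = N (0, 1)"
  have b: "0 \<le> b" unfolding b_def by (rule norm_fun_nonneg[OF N])
  have "\<exists>\<eta> m. (\<forall>x. N x \<le> (\<Sum>i\<le>(m::nat). \<bar>x \<bullet> \<eta> i\<bar>)) \<and>
     (\<forall>t. \<bar>t\<bar> \<le> real (Suc k) \<longrightarrow> (\<Sum>i\<le>m. \<bar>(1, t) \<bullet> \<eta> i\<bar>) \<le> N (1, t) + 2 * b / Suc k) \<and>
     (\<forall>s. (\<Sum>i\<le>m. \<bar>(0, s) \<bullet> \<eta> i\<bar>) = b * \<bar>s\<bar>)" for k
    using norm_fun_zonotope_approximation[OF N, of "Suc k"] unfolding b_def
    by (metis zero_less_Suc)
  then obtain \<eta> m where
    lower: "\<And>k x. N x \<le> (\<Sum>i\<le>(m k::nat). \<bar>x \<bullet> \<eta> k i\<bar>)" and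
    upper: "\<And>k t. \<bar>t\<bar> \<le> real (Suc k) \<Longrightarrow> (\<Sum>i\<le>m k. \<bar>(1, t) \<bullet> \<eta> k i\<bar>) \<le> N (1, t) + 2 * b / Suc k" and
    vert: "\<And>k s. (\<Sum>i\<le>m k. \<bar>(0, s) \<bullet> \<eta> k i\<bar>) = b * \<bar>s\<bar>"
    by metis
  define M where "M k x = (\<Sum>i\<le>m k. \<bar>x \<bullet> \<eta> k i\<bar>)" for k x
  have [measurable]: "M k \<in> borel_measurable borel" for k unfolding M_def by measurable
  note [measurable] = norm_fun_measurable[OF N]
  have Mhom: "M k (r *\<^sub>R x) = \<bar>r\<bar> * M k x" for k r x
    by (simp add: M_def abs_mult sum_distrib_left)
  have Mtri: "M k (x + y) \<le> M k x + M k y" for k x y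
    unfolding M_def sum.distrib[symmetric]
    by (intro sum_mono) (simp add: inner_add_left abs_triangle_ineq)
  \<comment> \<open>The horizontal unit vector costs \<open>N (1, 0)\<close> plus an approximation
    error of at most \<open>2 * b\<close>, the vertical one exactly \<open>b\<close>.\<close>
  define C where "C = N (1, 0) + 3 * b"
  have C: "M k x \<le> C * norm x" for k x
  proof -
    have "M k x \<le> M k (fst x *\<^sub>R (1, 0)) + M k (snd x *\<^sub>R (0, 1))"
      using Mtri[of k "fst x *\<^sub>R (1, 0)" "snd x *\<^sub>R (0, 1)"] by simp
    also have "\<dots> = \<bar>fst x\<bar> * M k (1, 0) + \<bar>snd x\<bar> * b"
      by (simp only: Mhom) (simp add: M_def vert)
    also have "\<dots> \<le> norm x * (N (1, 0) + 2 * b) + norm x * b"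
    proof (intro add_mono mult_mono)
      have "2 * b / Suc k \<le> 2 * b" using b by (simp add: divide_le_eq mult_le_cancel_left1)
      thus "M k (1, 0) \<le> N (1, 0) + 2 * b" using upper[of 0 k] by (simp add: M_def)
    qed (use b norm_fst_le[of "fst x" "snd x"] norm_snd_le[of "snd x" "fst x"] in \<open>auto simp: M_def sum_nonneg\<close>)
    finally show ?thesis by (simp add: C_def algebra_simps)
  qed
  have lim: "(\<lambda>k. M k x) \<longlonglongrightarrow> N x" if x: "fst x \<noteq> 0" for x
  proof -
    define t where "t = snd x / fst x"
    have xt: "x = fst x *\<^sub>R (1, t)" using x by (cases x) (simp add: t_def)
    have "(\<lambda>k. M k (1, t)) \<longlonglongrightarrow> N (1, t)"
    proof (rule tendsto_sandwich[where h="\<lambda>k. N (1, t) + 2 * b / Suc k" and f="\<lambda>_. N (1, t)"])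
      show "\<forall>\<^sub>F k in sequentially. N (1, t) \<le> M k (1, t)" using lower by (simp add: M_def)
      show "\<forall>\<^sub>F k in sequentially. M k (1, t) \<le> N (1, t) + 2 * b / Suc k"
        unfolding eventually_sequentially
      proof (intro exI allI impI)
        fix k assume "nat \<lceil>\<bar>t\<bar>\<rceil> \<le> k"
        hence "\<bar>t\<bar> \<le> real (Suc k)" by linarith
        thus "M k (1, t) \<le> N (1, t) + 2 * b / Suc k" using upper by (simp add: M_def)
      qed
      have "(\<lambda>k. N (1, t) + 2 * b * (1 / Suc k)) \<longlonglongrightarrow> N (1, t) + 2 * b * 0"
        by (intro tendsto_intros LIMSEQ_Suc[OF lim_1_over_n])
      thus "(\<lambda>k. N (1, t) + 2 * b / Suc k) \<longlonglongrightarrow> N (1, t)" by simp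
    qed simp
    hence "(\<lambda>k. \<bar>fst x\<bar> * M k (1, t)) \<longlonglongrightarrow> \<bar>fst x\<bar> * N (1, t)" by (intro tendsto_intros)
    thus ?thesis by (subst (1 2) xt) (simp only: Mhom norm_fun_scaleR[OF N])
  qed
  obtain c where c: "0 < c" "\<And>x. c * norm x \<le> N x" using norm_fun_bounds[OF N] by metis
  have C0: "0 \<le> C" using b norm_fun_nonneg[OF N] by (simp add: C_def)
  define w where "w x = ennreal ((C powr p + c powr p) * norm x powr p)" for x :: "real \<times> real"
  have bound: "ennreal (M k x powr p) \<le> w x" if x: "fst x \<noteq> 0" for k x
  proof (cases "p \<ge> 0")
    case True
    have "M k x powr p \<le> (C * norm x) powr p" using True C by (intro powr_mono2) (auto simp: M_def sum_nonneg)
    also have "\<dots> \<le> (C powr p + c powr p) * norm x powr p"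
      using C0 by (simp add: powr_mult mult_right_mono)
    finally show ?thesis unfolding w_def by (rule ennreal_leI)
  next
    case False
    have "x \<noteq> 0" using x by auto
    hence "0 < c * norm x" using c(1) by simp
    moreover have "c * norm x \<le> M k x" using c(2)[of x] lower[of x k] by (simp add: M_def)
    ultimately have "M k x powr p \<le> (c * norm x) powr p" using False by (intro powr_mono2') auto
    also have "\<dots> \<le> (C powr p + c powr p) * norm x powr p"
      using c by (simp add: powr_mult mult_right_mono)
    finally show ?thesis unfolding w_def by (rule ennreal_leI)
  qed
  have conv: "(\<lambda>k. \<integral>\<^sup>+x. ennreal (M k x powr p) \<partial>\<kappa>) \<longlonglongrightarrow> norm_moment p \<kappa> N"
    if \<kappa>: "moment_measure p \<kappa>" for \<kappa>
  proof -
    have [measurable_cong]: "sets \<kappa> = sets borel" using \<kappa> by (simp add: moment_measure_def)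
    have "AE x in \<kappa>. x \<bullet> (1, 0) \<noteq> 0" using \<kappa> by (auto simp: moment_measure_def zero_prod_def)
    hence ae: "AE x in \<kappa>. fst x \<noteq> 0" by (simp add: inner_prod_def)
    show ?thesis
    proof (rule nn_integral_dominated_convergence[where w = w])
      show "AE x in \<kappa>. ennreal (M j x powr p) \<le> w x" for j using ae bound by auto
      show "(\<integral>\<^sup>+x. w x \<partial>\<kappa>) < \<infinity>"
        using \<kappa> unfolding w_def moment_measure_def
        by (simp add: ennreal_mult' nn_integral_cmult ennreal_mult_less_top)
      show "AE x in \<kappa>. (\<lambda>i. ennreal (M i x powr p)) \<longlonglongrightarrow> ennreal (N x powr p)"
        using ae
      proof eventually_elim
        case (elim x)
        hence "0 < N x" by (intro norm_fun_pos[OF N]) auto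
        thus ?case using lim[OF elim] by (intro tendsto_ennrealI tendsto_intros) auto
      qed
    qed (simp_all add: w_def[abs_def])
  qed
  have "(\<integral>\<^sup>+x. ennreal (M k x powr p) \<partial>\<mu>) \<le> (\<integral>\<^sup>+x. ennreal (M k x powr p) \<partial>\<nu>)" for k
    unfolding M_def using \<mu> \<nu> le p
    by (intro nn_integral_sum_abs_inner_powr_le) (auto simp: moment_measure_def)
  thus "norm_moment p \<mu> N \<le> norm_moment p \<nu> N"
    by (intro LIMSEQ_le[OF conv[OF \<mu>] conv[OF \<nu>]]) auto
qed

section \<open>Transfer between Euclidean spaces of equal dimension\<close>

text \<open>Matching the standard bases carries \<open>real ^ 'n\<close> to iterated products of the
  real line, where Fubini and explicit coordinates are at hand. That bases go to bases is what makes
  the map take boxes to boxes and so preserve Lebesgue measure.\<close>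

lemma linear_iso_exists:
  assumes "DIM('a::euclidean_space) = DIM('b::euclidean_space)"
  obtains T :: "'a::euclidean_space \<Rightarrow> 'b::euclidean_space" and S :: "'b \<Rightarrow> 'a" where
    "linear T" "linear S" "\<And>x. S (T x) = x" "\<And>y. T (S y) = y" "\<And>x y. T x \<bullet> T y = x \<bullet> y"
    "T ` Basis = Basis"
proof -
  obtain f where f: "bij_betw f (Basis :: 'a set) (Basis :: 'b set)"
    using assms finite_same_card_bij[OF finite_Basis finite_Basis] by blast
  define g where "g = the_inv_into Basis f"
  have g: "bij_betw g Basis Basis" unfolding g_def using f by (rule bij_betw_the_inv_into)
  define T where "T x = (\<Sum>b\<in>Basis. (x \<bullet> b) *\<^sub>R f b)" for x
  define S where "S y = (\<Sum>b\<in>Basis. (y \<bullet> b) *\<^sub>R g b)" for y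
  have lT: "linear T" unfolding T_def
    by (intro linearI) (simp_all add: inner_add_left scaleR_add_left sum.distrib scaleR_sum_right)
  have lS: "linear S" unfolding S_def
    by (intro linearI) (simp_all add: inner_add_left scaleR_add_left sum.distrib scaleR_sum_right)
  have Tb: "T b = f b" if "b \<in> Basis" for b
    using that by (simp add: T_def inner_Basis if_distrib[of "\<lambda>r. r *\<^sub>R _"] sum.delta cong: if_cong)
  have Sb: "S b = g b" if "b \<in> Basis" for b
    using that by (simp add: S_def inner_Basis if_distrib[of "\<lambda>r. r *\<^sub>R _"] sum.delta cong: if_cong)
  have ST: "S (T b) = b" if "b \<in> Basis" for b
    using that f by (simp add: Tb Sb bij_betwE[OF f] g_def the_inv_into_f_f bij_betw_imp_inj_on)
  have TS: "T (S b) = b" if "b \<in> Basis" for b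
    using that f by (simp add: Tb Sb bij_betwE[OF g]) (simp add: g_def f_the_inv_into_f_bij_betw)
  have ST': "S (T x) = x" for x
    using linear_eq_stdbasis[of "S \<circ> T" id] lT lS ST by (auto simp: linear_compose linear_id fun_eq_iff)
  have TS': "T (S y) = y" for y
    using linear_eq_stdbasis[of "T \<circ> S" id] lT lS TS by (auto simp: linear_compose linear_id fun_eq_iff)
  have "T x \<bullet> T y = x \<bullet> y" for x y
  proof -
    have Txb: "T x \<bullet> f b = x \<bullet> b" if b: "b \<in> Basis" for b
    proof -
      have "T x \<bullet> f b = (\<Sum>c\<in>Basis. (x \<bullet> c) * (if c = b then 1 else 0))"
        unfolding T_def inner_sum_left using b f
        by (intro sum.cong) (auto simp: inner_Basis bij_betwE[OF f] inj_on_eq_iff[OF bij_betw_imp_inj_on[OF f]])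
      thus ?thesis using b by (simp add: if_distrib[of "\<lambda>r. _ * r"] cong: if_cong)
    qed
    have "T x \<bullet> T y = (\<Sum>b\<in>Basis. (y \<bullet> b) * (x \<bullet> b))"
      unfolding T_def[of y] by (simp add: inner_sum_right Txb)
    thus ?thesis by (simp add: euclidean_inner[of x y] mult.commute)
  qed
  moreover have "T ` Basis = Basis"
    using f by (auto simp: Tb bij_betw_def image_iff)
  ultimately show ?thesis using that lT lS ST' TS' by blast
qed

text \<open>Both measures are pushed forward by \<open>T\<close>. Since \<open>S\<close> is the
  adjoint of the isometry \<open>T\<close>, the moment in direction \<open>\<xi>\<close> becomes the
  moment in direction \<open>S \<xi>\<close>.\<close>

lemma embeds_in_Lp_linear_iso:
  fixes T :: "'a::euclidean_space \<Rightarrow> 'b::euclidean_space"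
  assumes T: "linear T" and S: "linear S" and ST: "\<And>x. S (T x) = x" and TS: "\<And>y. T (S y) = y"
    and iso: "\<And>x y. T x \<bullet> T y = x \<bullet> y"
    and N: "N \<in> borel_measurable borel" and emb: "embeds_in_Lp p (\<lambda>y. N (S y))"
  shows "embeds_in_Lp p N"
  unfolding embeds_in_Lp_def
proof (intro allI impI)
  fix \<mu> \<nu> :: "'a measure"
  assume \<mu>: "moment_measure p \<mu>" and \<nu>: "moment_measure p \<nu>"
    and le: "\<forall>\<xi>. directional_moment p \<mu> \<xi> \<le> directional_moment p \<nu> \<xi>"
  have [measurable]: "T \<in> borel_measurable borel" "S \<in> borel_measurable borel" "N \<in> borel_measurable borel"
    using T S N by (simp_all add: linear_linear borel_measurable_continuous_onI linear_continuous_on)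
  have adj: "T x \<bullet> y = x \<bullet> S y" for x y using iso[of x "S y"] by (simp add: TS)
  have norm: "norm (T x) = norm x" for x by (simp add: norm_eq_sqrt_inner iso)
  have push: "moment_measure p (distr \<kappa> borel T)" if \<kappa>: "moment_measure p \<kappa>" for \<kappa>
  proof -
    have [measurable_cong]: "sets \<kappa> = sets borel" using \<kappa> by (simp add: moment_measure_def)
    have "AE x in distr \<kappa> borel T. x \<bullet> \<xi> \<noteq> 0" if "\<xi> \<noteq> 0" for \<xi>
    proof -
      have "S \<xi> \<noteq> 0" using that TS[of \<xi>] linear_0[OF T] by auto
      thus ?thesis using \<kappa> by (subst AE_distr_iff) (auto simp: adj moment_measure_def)
    qed
    thus ?thesis using \<kappa> by (auto simp: moment_measure_def nn_integral_distr norm intro!: finite_measure.finite_measure_distr)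
  qed
  have eq: "(\<integral>\<^sup>+y. ennreal (N (S y) powr p) \<partial>distr \<kappa> borel T) = norm_moment p \<kappa> N"
     "directional_moment p (distr \<kappa> borel T) \<xi> = directional_moment p \<kappa> (S \<xi>)"
    if \<kappa>: "moment_measure p \<kappa>" for \<kappa> \<xi>
  proof -
    have [measurable_cong]: "sets \<kappa> = sets borel" using \<kappa> by (simp add: moment_measure_def)
    show "(\<integral>\<^sup>+y. ennreal (N (S y) powr p) \<partial>distr \<kappa> borel T) = norm_moment p \<kappa> N"
     "directional_moment p (distr \<kappa> borel T) \<xi> = directional_moment p \<kappa> (S \<xi>)"
      by (simp_all add: nn_integral_distr ST adj)
  qed
  show "norm_moment p \<mu> N \<le> norm_moment p \<nu> N"
    using emb[unfolded embeds_in_Lp_def, rule_format, OF push[OF \<mu>] push[OF \<nu>]] le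
    by (simp add: eq[OF \<mu>] eq[OF \<nu>])
qed

subsection \<open>Slicing symmetric convex bodies\<close>


text \<open>Interior points are not asked for, so that the slices taken below, which may be flat or
  empty, qualify.\<close>

definition symmetric_body :: "'a::euclidean_space set \<Rightarrow> bool" where
  "symmetric_body C \<longleftrightarrow> compact C \<and> convex C \<and> uminus ` C \<subseteq> C"

lemma borel_measurable_fst_comp [measurable (raw)]:
  fixes f :: "'c \<Rightarrow> 'a::euclidean_space \<times> 'b::euclidean_space"
  shows "f \<in> borel_measurable M \<Longrightarrow> (\<lambda>x. fst (f x)) \<in> borel_measurable M"
  by (rule borel_measurable_continuous_on[OF continuous_on_fst[OF continuous_on_id]])

lemma borel_measurable_snd_comp [measurable (raw)]:
  fixes f :: "'c \<Rightarrow> 'a::euclidean_space \<times> 'b::euclidean_space"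
  shows "f \<in> borel_measurable M \<Longrightarrow> (\<lambda>x. snd (f x)) \<in> borel_measurable M"
  by (rule borel_measurable_continuous_on[OF continuous_on_snd[OF continuous_on_id]])

lemma symmetric_body_linear_image:
  assumes "symmetric_body C" "linear f"
  shows "symmetric_body (f ` C)"
  using assms unfolding symmetric_body_def
  by (auto simp: linear_neg[symmetric] linear_continuous_on linear_linear
      intro!: compact_continuous_image convex_linear_image)

lemma integrable_on_compact_bounded:
  fixes h :: "'a::euclidean_space \<Rightarrow> real"
  assumes [measurable]: "h \<in> borel_measurable borel" and h: "\<And>x. \<bar>h x\<bar> \<le> B" and C: "compact C"
  shows "integrable lborel (\<lambda>x. indicator C x * h x)"
proof (rule Bochner_Integration.integrable_bound)
  have [measurable]: "C \<in> sets borel" using C by (simp add: borel_compact)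
  show "integrable lborel (\<lambda>x. indicator C x * B)"
    using emeasure_compact_finite[OF C] by (simp add: integrable_real_mult_indicator mult.commute)
  show "(\<lambda>x. indicator C x * h x) \<in> borel_measurable lborel" by measurable
  show "AE x in lborel. norm (indicator C x * h x) \<le> norm (indicator C x * B)"
    using h order_trans[OF h abs_ge_self] by (auto simp: indicator_def)
qed

text \<open>The distances between two points of a segment fill the interval from 0 to its length.
  This turns the length of a fibre into an integral over \<open>s\<close> of the condition that the
  fibre contains two points at distance \<open>s\<close>.\<close>

lemma fiber_length:
  fixes F :: "real set"
  assumes "compact F" "convex F"
  shows "measure lborel {s. 0 \<le> s \<and> (\<exists>u\<in>F. u + s \<in> F)} = measure lborel F"
proof -
  obtain a b where F: "F = {a..b}"
    using assms connected_compact_interval_1[of F] convex_connected by blast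
  show ?thesis
  proof (cases "a \<le> b")
    case True
    have "{s. 0 \<le> s \<and> (\<exists>u\<in>F. u + s \<in> F)} = {0..b - a}"
      using True by (auto simp: F intro!: bexI[of _ a])
    thus ?thesis using True by (simp add: F)
  qed (auto simp: F)
qed

text \<open>Slicing a body \<open>C\<close> by the length of its fibres over \<open>'a\<close> writes the integral of \<open>h \<circ> fst\<close> over
  \<open>C\<close> as a superposition of integrals of \<open>h\<close> over bodies \<open>S s\<close>. Iterated, this replaces the use of the
  Brunn-Minkowski inequality for the parallel section function.\<close>

lemma symmetric_body_integral_fst_nonneg:
  fixes h :: "'a::euclidean_space \<Rightarrow> real" and C :: "('a \<times> real) set"
  assumes [measurable]: "h \<in> borel_measurable borel" and h: "\<And>x. \<bar>h x\<bar> \<le> B"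
    and pos: "\<And>S. symmetric_body S \<Longrightarrow> 0 \<le> (\<integral>x. indicator S x * h x \<partial>lborel)"
    and C: "symmetric_body C"
  shows "0 \<le> (\<integral>z. indicator C z * h (fst z) \<partial>lborel)"
proof -
  have C': "compact C" "convex C" "\<And>z. z \<in> C \<Longrightarrow> - z \<in> C" using C by (auto simp: symmetric_body_def)
  define P where "P = (C \<times> C) \<inter> {w. fst (fst w) = fst (snd w) \<and> snd (fst w) \<le> snd (snd w)}"
  \<comment> \<open>\<open>E\<close> collects the pairs \<open>(z, s)\<close> for which the fibre
    over \<open>z\<close> contains two points at distance \<open>s\<close>. As a continuous image of
    the compact set \<open>P\<close> it is compact, which yields its measurability.\<close>
  define E where "E = (\<lambda>w. (fst (fst w), snd (snd w) - snd (fst w))) ` P"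
  define S where "S s = {z. \<exists>u. (z, u) \<in> C \<and> (z, u + s) \<in> C}" for s
  have E_iff: "(z, s) \<in> E \<longleftrightarrow> 0 \<le> s \<and> z \<in> S s" for z s
  proof
    assume "(z, s) \<in> E"
    then obtain u v where "(z, u) \<in> C" "(z, v) \<in> C" "u \<le> v" "s = v - u"
      by (auto simp: E_def P_def)
    thus "0 \<le> s \<and> z \<in> S s" by (auto simp: S_def intro!: exI[of _ u])
  next
    assume "0 \<le> s \<and> z \<in> S s"
    then obtain u where "0 \<le> s" "(z, u) \<in> C" "(z, u + s) \<in> C" by (auto simp: S_def)
    hence "((z, u), (z, u + s)) \<in> P" by (simp add: P_def)
    thus "(z, s) \<in> E" unfolding E_def by (rule image_eqI[rotated]) simp
  qed
  have "closed {w :: ('a \<times> real) \<times> ('a \<times> real). fst (fst w) = fst (snd w) \<and> snd (fst w) \<le> snd (snd w)}"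
    by (intro closed_Collect_conj closed_Collect_eq closed_Collect_le continuous_intros)
  hence "compact P" unfolding P_def using C'(1) by (intro compact_Int_closed compact_Times)
  hence E: "compact E" unfolding E_def
    by (rule compact_continuous_image[rotated]) (intro continuous_intros)
  have [measurable]: "E \<in> sets borel" "C \<in> sets borel" using E C'(1) by (auto simp: borel_compact)
  have S: "symmetric_body (S s)" if s: "0 \<le> s" for s
    unfolding symmetric_body_def
  proof (intro conjI)
    have "S s = fst ` (E \<inter> {w. snd w = s})"
      using s by (auto simp: E_iff intro!: image_eqI[of _ fst "(_, s)"])
    moreover have "compact (E \<inter> {w. snd w = s})"
      by (intro compact_Int_closed E closed_Collect_eq continuous_intros)
    ultimately show "compact (S s)"
      by (simp add: compact_continuous_image continuous_on_fst)
    show "convex (S s)"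
    proof (rule convexI)
      fix z z' and a b :: real assume "z \<in> S s" "z' \<in> S s" and ab: "0 \<le> a" "0 \<le> b" "a + b = 1"
      then obtain u u' where u: "(z, u) \<in> C" "(z, u + s) \<in> C" "(z', u') \<in> C" "(z', u' + s) \<in> C"
        by (auto simp: S_def)
      have "a *\<^sub>R (z, u) + b *\<^sub>R (z', u') \<in> C" "a *\<^sub>R (z, u + s) + b *\<^sub>R (z', u' + s) \<in> C"
        using u ab C'(2) by (auto intro!: convexD simp del: scaleR_Pair)
      moreover have "a * (u + s) + b * (u' + s) = a * u + b * u' + (a + b) * s"
        by (simp add: algebra_simps)
      ultimately show "a *\<^sub>R z + b *\<^sub>R z' \<in> S s"
        using ab by (auto simp: S_def intro!: exI[of _ "a * u + b * u'"])
    qed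
    show "uminus ` S s \<subseteq> S s"
    proof
      fix z assume "z \<in> uminus ` S s"
      then obtain u where "(- z, u) \<in> C" "(- z, u + s) \<in> C" by (auto simp: S_def)
      \<comment> \<open>Reflection sends the segment from \<open>u\<close> to \<open>u + s\<close>
        to the one from \<open>- u - s\<close> to \<open>- u\<close>.\<close>
      from this[THEN C'(3)] show "z \<in> S s" by (auto simp: S_def intro!: exI[of _ "- u - s"])
    qed
  qed
  have "(\<integral>z. indicator C z * h (fst z) \<partial>lborel) = (\<integral>z. (\<integral>u. indicator C (z, u) * h z \<partial>lborel) \<partial>lborel)"
    using lborel_pair.integral_fst'[of "\<lambda>z. indicator C z * h (fst z)"]
      integrable_on_compact_bounded[of "\<lambda>z. h (fst z)" B C] h C'(1) by (simp add: lborel_prod)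
  also have "\<dots> = (\<integral>z. measure lborel {u. (z, u) \<in> C} * h z \<partial>lborel)"
  proof -
    have "(\<integral>u. indicator C (z, u) * h z \<partial>lborel) = measure lborel {u. (z, u) \<in> C} * h z" for z
    proof -
      have "indicator C (z, u) = (indicator {u. (z, u) \<in> C} u :: real)" for u
        by (simp add: indicator_def)
      thus ?thesis by (simp only:) simp
    qed
    thus ?thesis by (simp only:)
  qed
  also have "\<dots> = (\<integral>z. measure lborel {s. (z, s) \<in> E} * h z \<partial>lborel)"
  proof -
    have "measure lborel {u. (z, u) \<in> C} = measure lborel {s. (z, s) \<in> E}" for z
    proof -
      have "{u. (z, u) \<in> C} = snd ` (C \<inter> {w. fst w = z})"
        by (auto intro!: image_eqI[of _ snd "(z, _)"])
      moreover have "compact (C \<inter> {w. fst w = z})"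
        by (intro compact_Int_closed C' closed_Collect_eq continuous_intros)
      ultimately have "compact {u. (z, u) \<in> C}"
        by (simp add: compact_continuous_image continuous_on_snd)
      moreover have "convex {u. (z, u) \<in> C}"
      proof (rule convexI)
        fix u v a b :: real assume "u \<in> {u. (z, u) \<in> C}" "v \<in> {u. (z, u) \<in> C}" "0 \<le> a" "0 \<le> b" "a + b = 1"
        thus "a *\<^sub>R u + b *\<^sub>R v \<in> {u. (z, u) \<in> C}"
          using convexD[OF C'(2), of "(z, u)" "(z, v)" a b] by (simp flip: scaleR_left.add)
      qed
      ultimately show ?thesis using fiber_length[of "{u. (z, u) \<in> C}"]
        by (simp add: E_iff S_def)
    qed
    thus ?thesis by simp
  qed
  also have "\<dots> = (\<integral>z. (\<integral>s. indicator E (z, s) * h z \<partial>lborel) \<partial>lborel)"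
  proof -
    have "(\<integral>u. indicator E (z, u) * h z \<partial>lborel) = measure lborel {u. (z, u) \<in> E} * h z" for z
    proof -
      have "indicator E (z, u) = (indicator {u. (z, u) \<in> E} u :: real)" for u
        by (simp add: indicator_def)
      thus ?thesis by (simp only:) simp
    qed
    thus ?thesis by (simp only:)
  qed
  also have "\<dots> = (\<integral>s. (\<integral>z. indicator E (z, s) * h z \<partial>lborel) \<partial>lborel)"
    using lborel_pair.Fubini_integral[of "\<lambda>z s. indicator E (z, s) * h z"]
      integrable_on_compact_bounded[of "\<lambda>z. h (fst z)" B E] h E by (simp add: lborel_prod case_prod_beta')
  also have "0 \<le> \<dots>"
  proof (rule Bochner_Integration.integral_nonneg)
    fix s
    show "0 \<le> (\<integral>z. indicator E (z, s) * h z \<partial>lborel)"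
    proof (cases "0 \<le> s")
      case True
      hence "indicator E (z, s) = (indicator (S s) z :: real)" for z by (simp add: indicator_def E_iff)
      thus ?thesis using pos[OF S[OF True]] by (simp only:)
    qed (simp add: E_iff)
  qed
  finally show ?thesis .
qed

lemma symmetric_body_real:
  fixes S :: "real set"
  assumes "symmetric_body S"
  obtains "S = {}" | T where "0 \<le> T" "S = {-T..T}"
proof -
  obtain a b where S: "S = {a..b}"
    using assms connected_compact_interval_1[of S] convex_connected by (auto simp: symmetric_body_def)
  show ?thesis
  proof (cases "a \<le> b")
    case True
    have "- a \<in> S" "- b \<in> S" using assms True by (auto simp: symmetric_body_def S)
    hence "a = - b" by (auto simp: S)
    thus ?thesis using True that(2)[of b] S by auto
  qed (use that S in auto)
qed

lemma nn_integral_lborel_triple: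
  fixes f :: "(real \<times> real) \<times> real \<Rightarrow> ennreal"
  assumes [measurable]: "f \<in> borel_measurable borel"
  shows "(\<integral>\<^sup>+z. f z \<partial>lborel) = (\<integral>\<^sup>+u. (\<integral>\<^sup>+v. (\<integral>\<^sup>+t. f ((t, v), u) \<partial>lborel) \<partial>lborel) \<partial>lborel)"
proof -
  have "(\<integral>\<^sup>+z. f z \<partial>lborel) = (\<integral>\<^sup>+u. (\<integral>\<^sup>+w. f (w, u) \<partial>lborel) \<partial>lborel)"
    using lborel_pair.nn_integral_snd[of f] by (simp add: lborel_prod)
  also have "\<dots> = (\<integral>\<^sup>+u. (\<integral>\<^sup>+v. (\<integral>\<^sup>+t. f ((t, v), u) \<partial>lborel) \<partial>lborel) \<partial>lborel)"
    using lborel_pair.nn_integral_snd[of "\<lambda>w. f (w, u)" for u] by (simp add: lborel_prod)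
  finally show ?thesis .
qed

text \<open>The innermost integration is over the first coordinate, on which the shear acts as a
  translation once the other two are fixed.\<close>

lemma lborel_distr_shear:
  "distr lborel borel (\<lambda>z. ((fst (fst z) + a * snd (fst z) + b * snd z, snd (fst z)), snd z)) =
    (lborel :: ((real \<times> real) \<times> real) measure)" (is "distr lborel borel ?f = _")
proof (rule measure_eqI)
  have [measurable]: "?f \<in> borel_measurable borel"
    by (intro borel_measurable_continuous_onI continuous_intros)
  fix A :: "((real \<times> real) \<times> real) set" assume "A \<in> sets (distr lborel borel ?f)"
  hence [measurable]: "A \<in> sets borel" by simp
  have "emeasure (distr lborel borel ?f) A = (\<integral>\<^sup>+z. indicator A (?f z) \<partial>lborel)"
    by (subst nn_integral_indicator[symmetric], simp, subst nn_integral_distr) simp_all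
  also have "\<dots> = (\<integral>\<^sup>+u. (\<integral>\<^sup>+v. (\<integral>\<^sup>+t. indicator A ((t + a * v + b * u, v), u) \<partial>lborel) \<partial>lborel) \<partial>lborel)"
    by (subst nn_integral_lborel_triple) simp_all
  also have "\<dots> = (\<integral>\<^sup>+u. (\<integral>\<^sup>+v. (\<integral>\<^sup>+t. indicator A ((t, v), u) \<partial>lborel) \<partial>lborel) \<partial>lborel)"
  proof (rule nn_integral_cong, rule nn_integral_cong)
    fix u v :: real
    show "(\<integral>\<^sup>+t. indicator A ((t + a * v + b * u, v), u) \<partial>lborel) = (\<integral>\<^sup>+t. indicator A ((t, v), u) \<partial>lborel)"
      using nn_integral_lborel_translate[of "\<lambda>t. indicator A ((t, v), u)" "a * v + b * u"]
      by (simp add: add_ac)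
  qed
  also have "\<dots> = emeasure lborel A" by (subst nn_integral_lborel_triple[symmetric]) simp_all
  finally show "emeasure (distr lborel borel ?f) A = emeasure lborel A" .
qed simp

text \<open>A volume-preserving shear makes \<open>y \<bullet> ((1, a), b)\<close> the first
  coordinate. Slicing twice then descends from three dimensions to one, where the only symmetric
  bodies are centred intervals and the empty set.\<close>

lemma symmetric_body_integral_ridge_nonneg:
  fixes h :: "real \<Rightarrow> real" and K :: "((real \<times> real) \<times> real) set"
  assumes [measurable]: "h \<in> borel_measurable borel" and h: "\<And>x. \<bar>h x\<bar> \<le> B"
    and pos: "\<And>T. 0 \<le> T \<Longrightarrow> 0 \<le> (\<integral>t. indicator {-T..T} t * h t \<partial>lborel)"
    and K: "symmetric_body K"
  shows "0 \<le> (\<integral>y. indicator K y * h (y \<bullet> ((1, a), b)) \<partial>lborel)"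
proof -
  have 1: "0 \<le> (\<integral>t. indicator S t * h t \<partial>lborel)" if "symmetric_body S" for S
    using that by (rule symmetric_body_real) (use pos in auto)
  have 2: "0 \<le> (\<integral>w. indicator S w * h (fst w) \<partial>lborel)" if "symmetric_body S" for S :: "(real \<times> real) set"
    by (rule symmetric_body_integral_fst_nonneg[OF _ h 1 that]) simp_all
  have 3: "0 \<le> (\<integral>w. indicator S w * h (fst (fst w)) \<partial>lborel)" if "symmetric_body S" for S :: "((real \<times> real) \<times> real) set"
    by (rule symmetric_body_integral_fst_nonneg[OF _ _ 2 that, of B]) (use h in simp_all)
  let ?f = "\<lambda>z :: (real \<times> real) \<times> real. ((fst (fst z) + a * snd (fst z) + b * snd z, snd (fst z)), snd z)"
  let ?g = "\<lambda>z :: (real \<times> real) \<times> real. ((fst (fst z) - a * snd (fst z) - b * snd z, snd (fst z)), snd z)"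
  have f: "linear ?f" by (intro linearI) (auto simp: algebra_simps)
  have [measurable]: "?f \<in> borel_measurable borel"
    by (intro borel_measurable_continuous_onI continuous_intros)
  have gf: "?g (?f z) = z" and fg: "?f (?g z) = z" for z by (simp_all add: prod_eq_iff)
  have K': "symmetric_body (?f ` K)" using symmetric_body_linear_image[OF K f] .
  have [measurable]: "K \<in> sets borel" "?f ` K \<in> sets borel" using K K' by (auto simp: symmetric_body_def borel_compact)
  have iff: "?f z \<in> ?f ` K \<longleftrightarrow> z \<in> K" for z
    by (rule inj_image_mem_iff[OF inj_on_inverseI[where g="?g", OF gf]])
  have "(\<integral>w. indicator (?f ` K) w * h (fst (fst w)) \<partial>lborel) =
     (\<integral>w. indicator (?f ` K) w * h (fst (fst w)) \<partial>distr lborel borel ?f)"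
    by (simp only: lborel_distr_shear)
  also have "\<dots> = (\<integral>z. indicator (?f ` K) (?f z) * h (fst (fst (?f z))) \<partial>lborel)"
    by (rule integral_distr) measurable
  also have "\<dots> = (\<integral>y. indicator K y * h (y \<bullet> ((1, a), b)) \<partial>lborel)"
  proof (intro Bochner_Integration.integral_cong refl)
    fix y
    have "fst (fst (?f y)) = y \<bullet> ((1, a), b)" by (simp add: inner_prod_def mult.commute)
    thus "indicator (?f ` K) (?f y) * h (fst (fst (?f y))) = indicator K y * h (y \<bullet> ((1, a), b))"
      unfolding indicator_def iff by (simp only:)
  qed
  finally show ?thesis using 3[OF K'] by simp
qed

subsection \<open>Plane waves and the Poisson kernel\<close>


text \<open>The real part of \<open>(M + i t)\<^sup>-\<^sup>3\<close> and an antiderivative of it.\<close>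

definition ridge :: "real \<Rightarrow> real \<Rightarrow> real" where
  "ridge M t = (M ^ 3 - 3 * M * t\<^sup>2) / (M\<^sup>2 + t\<^sup>2) ^ 3"

definition ridge_prim :: "real \<Rightarrow> real \<Rightarrow> real" where
  "ridge_prim M t = M * t / (M\<^sup>2 + t\<^sup>2)\<^sup>2"

lemma ridge_measurable [measurable (raw)]:
  assumes [measurable]: "f \<in> borel_measurable M" "g \<in> borel_measurable M"
  shows "(\<lambda>x. ridge (f x) (g x)) \<in> borel_measurable M"
  unfolding ridge_def by measurable

lemma ridge_prim_measurable [measurable]: "ridge_prim M \<in> borel_measurable borel"
  unfolding ridge_prim_def by measurable

lemma Re_inverse_cube: "Re (1 / (Complex M t) ^ 3) = ridge M t"
proof -
  have "Re ((Complex M t) ^ 3) = M ^ 3 - 3 * M * t\<^sup>2"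
    by (simp add: power3_eq_cube power2_eq_square algebra_simps)
  moreover have "cmod ((Complex M t) ^ 3) ^ 2 = (M\<^sup>2 + t\<^sup>2) ^ 3"
  proof -
    have "cmod ((Complex M t) ^ 3) ^ 2 = (cmod (Complex M t) ^ 2) ^ 3"
      by (simp add: norm_power flip: power_mult)
    thus ?thesis by (simp add: cmod_power2)
  qed
  moreover have "Re (1 / w) = Re w / (cmod w)\<^sup>2" for w
    by (simp add: Re_divide cmod_power2)
  ultimately show ?thesis by (simp only: ridge_def)
qed

text \<open>The real part is at most the modulus \<open>1 / r ^ 3\<close>, and
  \<open>M + \<bar>t\<bar> \<le> sqrt 2 * r\<close>; the constant 3 rounds up
  \<open>sqrt 2 ^ 3\<close>. In terms of \<open>M + \<bar>t\<bar>\<close> the bound can be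
  integrated by the elementary tail formula.\<close>

lemma ridge_bound:
  assumes "0 < M"
  shows "\<bar>ridge M t\<bar> \<le> 3 * (M + \<bar>t\<bar>) powr -3"
proof -
  define r where "r = cmod (Complex M t)"
  have r2: "r\<^sup>2 = M\<^sup>2 + t\<^sup>2" by (simp add: r_def cmod_power2)
  have r: "0 < r" using assms by (simp add: r_def complex_eq_iff)
  have "\<bar>ridge M t\<bar> \<le> cmod (1 / (Complex M t) ^ 3)"
    using abs_Re_le_cmod by (metis Re_inverse_cube)
  also have "\<dots> = 1 / r ^ 3" by (simp add: norm_divide norm_power r_def)
  also have "\<dots> \<le> 3 / (M + \<bar>t\<bar>) ^ 3"
  proof -
    have "(M + \<bar>t\<bar>)\<^sup>2 \<le> 2 * r\<^sup>2"
      using sum_squares_bound[of M "\<bar>t\<bar>"] by (simp add: r2 power2_sum)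
    also have "\<dots> = (sqrt 2 * r)\<^sup>2" by (simp add: power_mult_distrib)
    finally have "M + \<bar>t\<bar> \<le> sqrt 2 * r" by (rule power2_le_imp_le) (use r in simp)
    hence "(M + \<bar>t\<bar>) ^ 3 \<le> (sqrt 2 * r) ^ 3" using assms by (intro power_mono) auto
    also have "\<dots> = sqrt 2 * 2 * r ^ 3"
    proof -
      have "sqrt 2 ^ 3 = sqrt 2 * 2" by (simp add: power3_eq_cube)
      thus ?thesis by (simp only: power_mult_distrib)
    qed
    also have "\<dots> \<le> 3 * r ^ 3"
    proof -
      have "sqrt 2 \<le> 3 / 2" by (rule real_le_lsqrt) (simp_all add: power2_eq_square)
      thus ?thesis using r by (intro mult_right_mono) auto
    qed
    finally show ?thesis using r assms by (simp add: field_simps)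
  qed
  also have "\<dots> = 3 * (M + \<bar>t\<bar>) powr -3"
    using assms by (simp add: powr_minus powr_numeral divide_inverse)
  finally show ?thesis .
qed

lemma ridge_prim_bound:
  assumes "0 < M"
  shows "\<bar>ridge_prim M t\<bar> \<le> (M + \<bar>t\<bar>) powr -2"
proof -
  define r where "r = M\<^sup>2 + t\<^sup>2"
  have r: "0 < r" using assms by (simp add: r_def add_pos_nonneg)
  have 1: "2 * (M * \<bar>t\<bar>) \<le> r"
    using sum_squares_bound[of M "\<bar>t\<bar>"] by (simp add: r_def)
  have 2: "(M + \<bar>t\<bar>)\<^sup>2 \<le> 2 * r"
    using 1 by (simp add: r_def power2_eq_square algebra_simps)
  have "\<bar>ridge_prim M t\<bar> = (M * \<bar>t\<bar>) / r\<^sup>2" using assms by (simp add: ridge_prim_def r_def abs_mult)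
  also have "\<dots> \<le> (r / 2) / r\<^sup>2" using 1 by (intro divide_right_mono) auto
  also have "\<dots> = 1 / (2 * r)" using r by (simp add: power2_eq_square)
  also have "\<dots> \<le> 1 / (M + \<bar>t\<bar>)\<^sup>2" using 2 assms by (intro divide_left_mono) (auto intro!: mult_pos_pos r)
  also have "\<dots> = (M + \<bar>t\<bar>) powr -2"
    using assms by (simp add: powr_minus powr_numeral divide_inverse)
  finally show ?thesis .
qed

lemma DERIV_ridge_prim:
  assumes "0 < M" shows "DERIV (ridge_prim M) t :> ridge M t"
proof -
  have r: "0 < M\<^sup>2 + t\<^sup>2" using assms by (simp add: add_pos_nonneg)
  have "DERIV (ridge_prim M) t :> (M * (M\<^sup>2 + t\<^sup>2)\<^sup>2 - M * t * (2 * (M\<^sup>2 + t\<^sup>2) * (2 * t))) / ((M\<^sup>2 + t\<^sup>2)\<^sup>2 * (M\<^sup>2 + t\<^sup>2)\<^sup>2)"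
    unfolding ridge_prim_def using r by (auto intro!: derivative_eq_intros)
  also have "M * (M\<^sup>2 + t\<^sup>2)\<^sup>2 - M * t * (2 * (M\<^sup>2 + t\<^sup>2) * (2 * t)) = (M\<^sup>2 + t\<^sup>2) * (M ^ 3 - 3 * M * t\<^sup>2)"
    by (simp add: power2_eq_square power3_eq_cube algebra_simps)
  also have "(M\<^sup>2 + t\<^sup>2) * (M ^ 3 - 3 * M * t\<^sup>2) / ((M\<^sup>2 + t\<^sup>2)\<^sup>2 * (M\<^sup>2 + t\<^sup>2)\<^sup>2) = ridge M t"
    using r by (simp add: ridge_def power2_eq_square power3_eq_cube)
  finally show ?thesis .
qed

text \<open>After a shift by \<open>Y\<close> the kernel is centred and only the singularity has
  moved. Splitting at the kernel's own width \<open>M\<close> makes both terms multiples of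
  \<open>M powr (e + q)\<close>, uniformly in \<open>Y\<close>.\<close>

lemma nn_integral_powr_times_kernel_le:
  assumes q: "0 < q" "q < 1" and M: "0 < M" and e: "e < -1"
    and [measurable]: "f \<in> borel_measurable borel" and f: "\<And>t. \<bar>f t\<bar> \<le> B * (M + \<bar>t\<bar>) powr e" and B: "0 \<le> B"
  shows "(\<integral>\<^sup>+u. ennreal (\<bar>u\<bar> powr (q - 1) * \<bar>f (u - Y)\<bar>) \<partial>lborel) \<le> ennreal (B * (2 / (- e - 1) + 2 / q) * M powr (e + q))"
proof -
  have "(\<integral>\<^sup>+u. ennreal (\<bar>u\<bar> powr (q - 1) * \<bar>f (u - Y)\<bar>) \<partial>lborel)
     \<le> (\<integral>\<^sup>+u. ennreal (\<bar>u - (- Y)\<bar> powr - (1 - q)) * (ennreal B * ennreal ((M + \<bar>u\<bar>) powr e)) \<partial>lborel)"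
  proof -
    have "(\<integral>\<^sup>+u. ennreal (\<bar>u\<bar> powr (q - 1) * \<bar>f (u - Y)\<bar>) \<partial>lborel)
      \<le> (\<integral>\<^sup>+u. ennreal (\<bar>u\<bar> powr (q - 1) * (B * (M + \<bar>u - Y\<bar>) powr e)) \<partial>lborel)"
      by (intro nn_integral_mono ennreal_leI mult_left_mono f) auto
    also have "\<dots> = (\<integral>\<^sup>+u. ennreal (\<bar>u - (- Y)\<bar> powr - (1 - q)) * (ennreal B * ennreal ((M + \<bar>u\<bar>) powr e)) \<partial>lborel)"
      by (subst nn_integral_lborel_translate[symmetric, where a=Y]) (simp_all add: ennreal_mult B add.commute)
    finally show ?thesis .
  qed
  also have "\<dots> \<le> ennreal (M powr - (1 - q)) * (\<integral>\<^sup>+u. ennreal B * ennreal ((M + \<bar>u\<bar>) powr e) \<partial>lborel)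
      + ennreal (2 * (M powr (1 - (1 - q)) / (1 - (1 - q)))) * ennreal (B * M powr e)"
    by (rule nn_integral_singular_kernel_le)
      (use q M e B in \<open>auto simp flip: ennreal_mult' intro!: ennreal_leI mult_left_mono powr_mono2'\<close>)
  also have "\<dots> = ennreal (M powr (q - 1)) * ennreal (B * (2 * (M powr (e + 1) / (- e - 1)))) + ennreal (2 * (M powr q / q)) * ennreal (B * M powr e)"
  proof -
    have "(\<integral>\<^sup>+u. ennreal B * ennreal ((M + \<bar>u\<bar>) powr e) \<partial>lborel) = ennreal (B * (2 * (M powr (e + 1) / (- e - 1))))"
      by (subst nn_integral_cmult) (simp, simp only: nn_integral_powr_tail[OF e M] ennreal_mult'[OF B])
    thus ?thesis by (simp only:) simp
  qed
  also have "\<dots> = ennreal (M powr (q - 1) * (B * (2 * (M powr (e + 1) / (- e - 1)))) + 2 * (M powr q / q) * (B * M powr e))"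
  proof -
    have *: "ennreal a * ennreal b + ennreal c * ennreal d = ennreal (a * b + c * d)"
      if "0 \<le> a" "0 \<le> b" "0 \<le> c" "0 \<le> d" for a b c d
      using that by (simp add: ennreal_mult ennreal_plus)
    show ?thesis using q e B by (intro *) auto
  qed
  also have "M powr (q - 1) * (B * (2 * (M powr (e + 1) / (- e - 1)))) + 2 * (M powr q / q) * (B * M powr e)
     = B * (2 / (- e - 1) + 2 / q) * M powr (e + q)"
  proof -
    have "M powr (q - 1) * M powr (e + 1) = M powr (e + q)" "M powr q * M powr e = M powr (e + q)"
      by (simp_all flip: powr_add add: add.commute)
    moreover have "M powr (q - 1) * (B * (2 * (M powr (e + 1) / (- e - 1)))) + 2 * (M powr q / q) * (B * M powr e)
      = B * (2 / (- e - 1)) * (M powr (q - 1) * M powr (e + 1)) + B * (2 / q) * (M powr q * M powr e)"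
      by (simp add: mult_ac)
    ultimately show ?thesis by (simp only: distrib_left distrib_right)
  qed
  finally show ?thesis .
qed

text \<open>The plane-wave profile convolved with \<open>\<bar>u\<bar> powr (q - 1)\<close>, the
  density by which a central chord yields the power \<open>- q\<close> of the norm. Its integrals
  over the body are the weights of the mixture.\<close>

definition ridge_transform :: "real \<Rightarrow> real \<Rightarrow> real \<Rightarrow> real" where
  "ridge_transform q M Y = (\<integral>u. \<bar>u\<bar> powr (q - 1) * ridge M (u - Y) \<partial>lborel)"

lemma ridge_transform_measurable [measurable (raw)]:
  assumes [measurable]: "f \<in> borel_measurable M" "g \<in> borel_measurable M"
  shows "(\<lambda>x. ridge_transform q (f x) (g x)) \<in> borel_measurable M"
  unfolding ridge_transform_def by measurable

lemma ridge_transform_integrable: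
  assumes q: "0 < q" "q < 1" and M: "0 < M"
  shows "integrable lborel (\<lambda>u. \<bar>u\<bar> powr (q - 1) * ridge M (u - Y))"
proof (rule integrableI_bounded)
  have "(\<integral>\<^sup>+u. ennreal (norm (\<bar>u\<bar> powr (q - 1) * ridge M (u - Y))) \<partial>lborel) \<le> ennreal (3 * (2 / (- (-3) - 1) + 2 / q) * M powr (-3 + q))"
    using nn_integral_powr_times_kernel_le[OF q M _ _ ridge_bound[OF M], of Y] by (simp add: abs_mult)
  thus "(\<integral>\<^sup>+u. ennreal (norm (\<bar>u\<bar> powr (q - 1) * ridge M (u - Y))) \<partial>lborel) < \<infinity>"
    by (rule le_less_trans) simp
qed measurable

lemma ridge_transform_bound:
  assumes q: "0 < q" "q < 1" and M: "0 < M"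
  shows "\<bar>ridge_transform q M Y\<bar> \<le> (3 + 6 / q) * M powr (q - 3)"
proof -
  have "ennreal (norm (ridge_transform q M Y)) \<le> (\<integral>\<^sup>+u. ennreal (norm (\<bar>u\<bar> powr (q - 1) * ridge M (u - Y))) \<partial>lborel)"
    unfolding ridge_transform_def by (rule integral_norm_bound_ennreal[OF ridge_transform_integrable[OF assms]])
  also have "\<dots> \<le> ennreal (3 * (2 / (- (-3) - 1) + 2 / q) * M powr (-3 + q))"
    using nn_integral_powr_times_kernel_le[OF q M _ _ ridge_bound[OF M], of Y] by (simp add: abs_mult)
  also have "3 * (2 / (- (-3) - 1) + 2 / q) * M powr (-3 + q) = (3 + 6 / q) * M powr (q - 3)"
    by (simp add: algebra_simps)
  finally show ?thesis using q by (subst (asm) ennreal_le_iff) auto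
qed

lemma ridge_prim_integrable:
  assumes q: "0 < q" "q < 1" and M: "0 < M"
  shows "integrable lborel (\<lambda>u. \<bar>u\<bar> powr (q - 1) * ridge_prim M (u - Y))"
proof (rule integrableI_bounded)
  have "(\<integral>\<^sup>+u. ennreal (norm (\<bar>u\<bar> powr (q - 1) * ridge_prim M (u - Y))) \<partial>lborel) \<le> ennreal (1 * (2 / (- (-2) - 1) + 2 / q) * M powr (-2 + q))"
    using nn_integral_powr_times_kernel_le[OF q M, of "-2" "ridge_prim M" 1 Y] ridge_prim_bound[OF M] by (simp add: abs_mult)
  thus "(\<integral>\<^sup>+u. ennreal (norm (\<bar>u\<bar> powr (q - 1) * ridge_prim M (u - Y))) \<partial>lborel) < \<infinity>"
    by (rule le_less_trans) simp
qed measurable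

text \<open>The source of positivity. The profile \<open>ridge M\<close> changes sign, but over a
  centred interval it integrates to a difference of two values of \<open>ridge_prim M\<close>.
  Shifting the variable moves this difference onto the power, and the integrand becomes
  \<open>(\<bar>u - T\<bar> powr (q - 1) - \<bar>u + T\<bar> powr (q - 1)) * ridge_prim M u\<close>.
  As \<open>q < 1\<close>, the sign of \<open>u\<close> governs both factors alike, so the product
  is nonnegative.\<close>

lemma ridge_transform_integral_nonneg:
  assumes q: "0 < q" "q < 1" and M: "0 < M" and T: "0 \<le> T"
  shows "0 \<le> (\<integral>Y. indicator {-T..T} Y * ridge_transform q M Y \<partial>lborel)"
proof -
  let ?F = "\<lambda>(Y, u). indicator {-T..T} Y * (\<bar>u\<bar> powr (q - 1) * ridge M (u - Y))"
  have int: "integrable (lborel \<Otimes>\<^sub>M lborel) ?F"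
  proof (rule integrableI_bounded)
    define c where "c = 3 * (2 / (- (-3) - 1) + 2 / q) * M powr (-3 + q)"
    have "(\<integral>\<^sup>+w. ennreal (norm (?F w)) \<partial>(lborel \<Otimes>\<^sub>M lborel)) =
      (\<integral>\<^sup>+Y. (\<integral>\<^sup>+u. ennreal (norm (?F (Y, u))) \<partial>lborel) \<partial>lborel)"
      by (rule lborel.nn_integral_fst[symmetric]) measurable
    also have "\<dots> \<le> (\<integral>\<^sup>+Y. indicator {-T..T} Y * ennreal c \<partial>lborel)"
    proof (rule nn_integral_mono)
      fix Y
      have "(\<integral>\<^sup>+u. ennreal (\<bar>u\<bar> powr (q - 1) * \<bar>ridge M (u - Y)\<bar>) \<partial>lborel) \<le> ennreal c"
        unfolding c_def by (rule nn_integral_powr_times_kernel_le[OF q M _ _ ridge_bound[OF M]]) auto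
      thus "(\<integral>\<^sup>+u. ennreal (norm (?F (Y, u))) \<partial>lborel) \<le> indicator {-T..T} Y * ennreal c"
        by (simp add: indicator_def abs_mult)
    qed
    also have "\<dots> < \<infinity>" using T by (simp add: nn_integral_multc ennreal_mult_less_top)
    finally show "(\<integral>\<^sup>+w. ennreal (norm (?F w)) \<partial>(lborel \<Otimes>\<^sub>M lborel)) < \<infinity>" .
  qed measurable
  have "(\<integral>Y. indicator {-T..T} Y * ridge_transform q M Y \<partial>lborel) = (\<integral>Y. (\<integral>u. ?F (Y, u) \<partial>lborel) \<partial>lborel)"
    by (simp add: ridge_transform_def)
  also have "\<dots> = (\<integral>u. (\<integral>Y. ?F (Y, u) \<partial>lborel) \<partial>lborel)"
    using lborel_pair.Fubini_integral[of "\<lambda>Y u. ?F (Y, u)"] int by simp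
  also have "\<dots> = (\<integral>u. \<bar>u\<bar> powr (q - 1) * (ridge_prim M (u - - T) - ridge_prim M (u - T)) \<partial>lborel)"
  proof (rule Bochner_Integration.integral_cong[OF refl])
    fix u
    have "(\<integral>Y. ridge M (u - Y) * indicator {-T..T} Y \<partial>lborel) = - ridge_prim M (u - T) - (- ridge_prim M (u - - T))"
    proof (rule integral_FTC_Icc_real)
      show "- T \<le> T" using T by simp
      show "DERIV (\<lambda>Y. - ridge_prim M (u - Y)) Y :> ridge M (u - Y)" for Y
        by (rule DERIV_cong[OF DERIV_minus[OF DERIV_chain'[OF _ DERIV_ridge_prim[OF M]]]])
          (auto intro!: derivative_eq_intros)
      show "isCont (\<lambda>Y. ridge M (u - Y)) Y" for Y
        using M unfolding ridge_def by (intro continuous_intros) (simp add: add_pos_nonneg pos_add_strict add_nonneg_eq_0_iff)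
    qed
    moreover have "?F (Y, u) = \<bar>u\<bar> powr (q - 1) * (ridge M (u - Y) * indicator {-T..T} Y)" for Y
      by (simp add: mult_ac)
    ultimately show "(\<integral>Y. ?F (Y, u) \<partial>lborel) = \<bar>u\<bar> powr (q - 1) * (ridge_prim M (u - - T) - ridge_prim M (u - T))"
      by (simp only: integral_mult_right_zero) simp
  qed
  also have "\<dots> = (\<integral>u. \<bar>u\<bar> powr (q - 1) * ridge_prim M (u - - T) \<partial>lborel) - (\<integral>u. \<bar>u\<bar> powr (q - 1) * ridge_prim M (u - T) \<partial>lborel)"
    unfolding right_diff_distrib
    by (rule Bochner_Integration.integral_diff) (rule ridge_prim_integrable[OF q M])+
  also have "\<dots> = (\<integral>u. \<bar>u - T\<bar> powr (q - 1) * ridge_prim M u \<partial>lborel) - (\<integral>u. \<bar>u + T\<bar> powr (q - 1) * ridge_prim M u \<partial>lborel)"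
  proof -
    have shift: "(\<integral>u. f u \<partial>lborel) = (\<integral>u. f (c + u) \<partial>lborel)" for f :: "real \<Rightarrow> real" and c
      using lborel_integral_real_affine[of 1 f c] by simp
    show ?thesis
      using shift[of "\<lambda>u. \<bar>u\<bar> powr (q - 1) * ridge_prim M (u - - T)" "- T"]
        shift[of "\<lambda>u. \<bar>u\<bar> powr (q - 1) * ridge_prim M (u - T)" T]
      by (simp add: add.commute)
  qed
  also have "\<dots> = (\<integral>u. (\<bar>u - T\<bar> powr (q - 1) - \<bar>u + T\<bar> powr (q - 1)) * ridge_prim M u \<partial>lborel)"
  proof -
    have "integrable lborel (\<lambda>u. \<bar>u - T\<bar> powr (q - 1) * ridge_prim M u)"
      "integrable lborel (\<lambda>u. \<bar>u + T\<bar> powr (q - 1) * ridge_prim M u)"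
      using lborel_integrable_real_affine[OF ridge_prim_integrable[OF q M, of "- T"], of 1 "- T"]
        lborel_integrable_real_affine[OF ridge_prim_integrable[OF q M, of T], of 1 T]
      by (simp_all add: add.commute)
    thus ?thesis by (simp add: left_diff_distrib)
  qed
  also have "0 \<le> \<dots>"
  proof (rule integral_nonneg_AE)
    \<comment> \<open>At \<open>u = T\<close> and \<open>u = - T\<close> the default
      \<open>0 powr (q - 1) = 0\<close> may reverse the comparison of the powers; these points are
      null.\<close>
    show "AE u in lborel. 0 \<le> (\<bar>u - T\<bar> powr (q - 1) - \<bar>u + T\<bar> powr (q - 1)) * ridge_prim M u"
      using AE_lborel_singleton[of T] AE_lborel_singleton[of "- T"]
    proof eventually_elim
      case (elim u)
      show ?case
      proof (cases "0 \<le> u")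
        case True
        have "\<bar>u + T\<bar> powr (q - 1) \<le> \<bar>u - T\<bar> powr (q - 1)"
          using elim q True T by (intro powr_mono2') auto
        moreover have "0 \<le> ridge_prim M u" using M True by (simp add: ridge_prim_def)
        ultimately show ?thesis by simp
      next
        case False
        have "\<bar>u - T\<bar> powr (q - 1) \<le> \<bar>u + T\<bar> powr (q - 1)"
          using elim q False T by (intro powr_mono2') auto
        moreover have "ridge_prim M u \<le> 0" using M False
          by (auto simp: ridge_prim_def intro!: divide_nonpos_nonneg mult_nonneg_nonpos)
        ultimately show ?thesis by (simp add: mult_nonpos_nonpos)
      qed
    qed
  qed
  finally show ?thesis .
qed


section \<open>Superposition of plane waves\<close>

lemma AE_lborel_inner_neq:
  fixes \<xi> :: "'a::euclidean_space"
  assumes "\<xi> \<noteq> 0"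
  shows "AE x in lborel. x \<bullet> \<xi> \<noteq> c"
proof -
  have "negligible {x. \<xi> \<bullet> x = c}" using assms by (intro negligible_hyperplane) auto
  hence "AE x in lebesgue. x \<notin> {x. \<xi> \<bullet> x = c}"
    by (intro AE_not_in) (simp add: negligible_iff_null_sets)
  thus ?thesis by (simp add: AE_completion_iff inner_commute)
qed

text \<open>\<open>F\<close> is an antiderivative along the ray. The positive real parts of
  \<open>w\<close> and \<open>\<zeta>\<close> keep the ray away from 0 and let its modulus grow at
  least linearly, so that \<open>F\<close> vanishes at infinity.\<close>

lemma cpow_ray_integral:
  fixes w \<zeta> :: complex
  assumes w: "0 < Re w" and \<zeta>: "0 < Re \<zeta>" and n: "0 < n"
  shows "integrable lborel (\<lambda>b. indicator {0..} b *\<^sub>R (1 / (w + of_real b * \<zeta>) ^ Suc n))"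
    and "(\<integral>b. indicator {0..} b *\<^sub>R (1 / (w + of_real b * \<zeta>) ^ Suc n) \<partial>lborel) = 1 / (of_nat n * \<zeta> * w ^ n)"
proof -
  define f where "f b = 1 / (w + of_real b * \<zeta>) ^ Suc n" for b
  define F where "F b = - 1 / (of_nat n * \<zeta> * (w + of_real b * \<zeta>) ^ n)" for b
  have re: "Re w + b * Re \<zeta> \<le> cmod (w + of_real b * \<zeta>)" for b
    using complex_Re_le_cmod[of "w + of_real b * \<zeta>"] by simp
  have ne: "w + of_real b * \<zeta> \<noteq> 0" if "0 \<le> b" for b
  proof -
    have "0 < Re w + b * Re \<zeta>" using w \<zeta> that by (simp add: add_pos_nonneg)
    thus ?thesis using re[of b] by auto
  qed
  have \<zeta>0: "\<zeta> \<noteq> 0" using \<zeta> by auto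
  have [measurable]: "f \<in> borel_measurable borel" unfolding f_def by measurable
  define M where "M = Re w / Re \<zeta>"
  have M: "0 < M" using w \<zeta> by (simp add: M_def)
  define e where "e = - real (Suc n)"
  have "(\<integral>\<^sup>+b. ennreal (norm (indicator {0..} b *\<^sub>R f b)) \<partial>lborel) \<le>
     (\<integral>\<^sup>+b. ennreal (Re \<zeta> powr e) * ennreal ((M + \<bar>b\<bar>) powr e) \<partial>lborel)"
  proof (rule nn_integral_mono)
    fix b :: real
    show "ennreal (norm (indicator {0..} b *\<^sub>R f b)) \<le> ennreal (Re \<zeta> powr e) * ennreal ((M + \<bar>b\<bar>) powr e)"
    proof (cases "0 \<le> b")
      case True
      have eq: "Re \<zeta> * (M + \<bar>b\<bar>) = Re w + b * Re \<zeta>"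
        using True \<zeta> by (simp add: M_def field_simps)
      have pos: "0 < Re \<zeta> * (M + \<bar>b\<bar>)" using \<zeta> M by (simp add: add_pos_nonneg)
      have "norm (f b) = 1 / cmod (w + of_real b * \<zeta>) ^ Suc n" by (simp add: f_def norm_divide norm_power norm_mult)
      also have "\<dots> \<le> 1 / (Re \<zeta> * (M + \<bar>b\<bar>)) ^ Suc n"
        using pos re[of b] ne[OF True] unfolding eq by (intro divide_left_mono power_mono mult_pos_pos zero_less_power) auto
      also have "\<dots> = Re \<zeta> powr e * (M + \<bar>b\<bar>) powr e"
        using pos \<zeta> M unfolding e_def powr_minus
        by (subst (1 2) powr_realpow) (auto simp: power_mult_distrib divide_inverse add_pos_nonneg)
      finally show ?thesis using True by (simp flip: ennreal_mult' add: ennreal_leI)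
    qed simp
  qed
  also have "\<dots> < \<infinity>"
    using n M by (simp add: nn_integral_cmult nn_integral_powr_tail e_def ennreal_mult_less_top)
  finally have int: "integrable lborel (\<lambda>b. indicator {0..} b *\<^sub>R f b)"
    by (intro integrableI_bounded) auto
  thus "integrable lborel (\<lambda>b. indicator {0..} b *\<^sub>R (1 / (w + of_real b * \<zeta>) ^ Suc n))"
    by (simp add: f_def)
  have ae: "AE b in lborel. indicator {0..} b *\<^sub>R f b = indicator (einterval 0 \<infinity>) b *\<^sub>R f b"
    using AE_lborel_singleton[of 0] by eventually_elim (auto simp: indicator_def einterval_def)
  have int': "set_integrable lborel (einterval 0 \<infinity>) f"
    unfolding set_integrable_def by (rule integrable_cong_AE_imp[OF int _ ae]) measurable
  have lim: "(F \<longlongrightarrow> 0) at_top"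
  proof -
    have "filterlim (\<lambda>b. Re w + b * Re \<zeta>) at_top at_top" using \<zeta> by real_asymp
    hence "filterlim (\<lambda>b. cmod (w + of_real b * \<zeta>)) at_top at_top"
      by (rule filterlim_at_top_mono) (rule always_eventually, rule allI, rule re)
    hence "filterlim (\<lambda>b. w + of_real b * \<zeta>) at_infinity at_top"
      by (rule filterlim_norm_at_top_imp_at_infinity)
    hence "((\<lambda>b. inverse ((w + of_real b * \<zeta>) ^ n)) \<longlongrightarrow> 0) at_top"
      using n tendsto_power[OF filterlim_compose[OF tendsto_inverse_0], of "\<lambda>b. w + of_real b * \<zeta>" at_top n]
      by (simp add: power_inverse power_0_left)
    hence "((\<lambda>b. - 1 / (of_nat n * \<zeta>) * inverse ((w + of_real b * \<zeta>) ^ n)) \<longlongrightarrow> - 1 / (of_nat n * \<zeta>) * 0) at_top"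
      by (intro tendsto_intros)
    thus ?thesis by (simp add: F_def[abs_def] divide_inverse mult.assoc)
  qed
  have "(LBINT b=0..\<infinity>. f b) = 0 - F 0"
  proof (rule interval_integral_FTC_integrable[OF _ _ _ int'])
    fix b :: real assume "0 < ereal b"
    hence b: "0 \<le> b" by simp
    have "((\<lambda>z. - 1 / (of_nat n * \<zeta> * (w + z * \<zeta>) ^ n)) has_field_derivative f b) (at (of_real b))"
    proof -
      obtain m where m: "n = Suc m" using n by (cases n) auto
      define u where "u = w + of_real b * \<zeta>"
      have u: "u \<noteq> 0" using ne[OF b] by (simp add: u_def)
      have "((\<lambda>z. (w + z * \<zeta>) ^ n) has_field_derivative of_nat n * u ^ m * \<zeta>) (at (of_real b))"
      proof -
        have "((\<lambda>z. w + z * \<zeta>) has_field_derivative \<zeta>) (at (of_real b))"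
          by (auto intro!: derivative_eq_intros)
        from DERIV_power[OF this, of n] show ?thesis by (simp add: m u_def mult_ac)
      qed
      hence "((\<lambda>z. inverse ((w + z * \<zeta>) ^ n)) has_field_derivative - (of_nat n * u ^ m * \<zeta> * inverse ((u ^ n) ^ 2))) (at (of_real b))"
        using DERIV_inverse_fun[where s=UNIV and x="of_real b :: complex" and f="\<lambda>z. (w + z * \<zeta>) ^ n"] u
        by (simp add: u_def numeral_2_eq_2)
      from DERIV_cmult[OF this, of "- 1 / (of_nat n * \<zeta>)"]
      have D: "((\<lambda>z. - 1 / (of_nat n * \<zeta>) * inverse ((w + z * \<zeta>) ^ n)) has_field_derivative
         - 1 / (of_nat n * \<zeta>) * - (of_nat n * u ^ m * \<zeta> * inverse ((u ^ n) ^ 2))) (at (of_real b))" .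
      have "- 1 / (of_nat n * \<zeta>) * - (of_nat n * u ^ m * \<zeta> * inverse ((u ^ n) ^ 2)) = u ^ m * inverse ((u ^ n) ^ 2)"
        using \<zeta>0 n by simp
      also have "\<dots> = f b"
        using u by (simp add: f_def m u_def[symmetric] divide_inverse power2_eq_square)
      finally have "((\<lambda>z. - 1 / (of_nat n * \<zeta>) * inverse ((w + z * \<zeta>) ^ n)) has_field_derivative f b) (at (of_real b))"
        using D by simp
      thus ?thesis by (simp add: divide_inverse mult.assoc)
    qed
    thus "(F has_vector_derivative f b) (at b)"
      unfolding F_def by (rule has_vector_derivative_real_field)
    show "isCont f b" unfolding f_def using ne[OF b] by (intro continuous_intros) auto
  next
    have "isCont F 0" unfolding F_def using ne[of 0] \<zeta>0 n by (intro continuous_intros) auto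
    hence "(F \<longlongrightarrow> F 0) (at_right 0)" by (simp add: continuous_at filterlim_at_split isCont_def)
    thus "((F \<circ> real_of_ereal) \<longlongrightarrow> F 0) (at_right 0)"
      by (simp add: zero_ereal_def ereal_tendsto_simps)
    show "((F \<circ> real_of_ereal) \<longlongrightarrow> 0) (at_left \<infinity>)" using lim by (simp add: ereal_tendsto_simps)
  qed auto
  moreover have "(LBINT b=0..\<infinity>. f b) = (\<integral>b. indicator {0..} b *\<^sub>R f b \<partial>lborel)"
    unfolding interval_lebesgue_integral_def set_lebesgue_integral_def
    using integral_cong_AE[OF _ _ ae] by simp
  ultimately show "(\<integral>b. indicator {0..} b *\<^sub>R (1 / (w + of_real b * \<zeta>) ^ Suc n) \<partial>lborel) = 1 / (of_nat n * \<zeta> * w ^ n)"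
    by (simp add: f_def F_def)
qed

text \<open>The absolute value of \<open>b\<close> in the real part bends the line into two rays
  with directions \<open>\<sigma> + i z\<close> and \<open>\<sigma> - i z\<close>. The reciprocals
  of these directions add up to \<open>2 * \<sigma> / (\<sigma>\<^sup>2 + z\<^sup>2)\<close>: the
  integration lowers the exponent by one and splits off a Cauchy profile in
  \<open>z\<close>.\<close>

lemma cpow_line_integral:
  fixes A X \<sigma> z :: real
  assumes A: "0 < A" and \<sigma>: "0 < \<sigma>" and n: "0 < n"
  shows "integrable lborel (\<lambda>b. 1 / (Complex (A + \<sigma> * \<bar>b\<bar>) (X + b * z)) ^ Suc n)"
    and "(\<integral>b. 1 / (Complex (A + \<sigma> * \<bar>b\<bar>) (X + b * z)) ^ Suc n \<partial>lborel) =
      of_real (2 * \<sigma> / (\<sigma>\<^sup>2 + z\<^sup>2) / n) * (1 / (Complex A X) ^ n)"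
proof -
  define g where "g \<zeta> b = indicator {0..} b *\<^sub>R (1 / (Complex A X + of_real b * \<zeta>) ^ Suc n)" for \<zeta> and b :: real
  have g: "integrable lborel (g (Complex \<sigma> z))" "integrable lborel (g (Complex \<sigma> (- z)))"
    "(\<integral>b. g (Complex \<sigma> z) b \<partial>lborel) = 1 / (of_nat n * Complex \<sigma> z * (Complex A X) ^ n)"
    "(\<integral>b. g (Complex \<sigma> (- z)) b \<partial>lborel) = 1 / (of_nat n * Complex \<sigma> (- z) * (Complex A X) ^ n)"
    unfolding g_def by (intro cpow_ray_integral; use A \<sigma> n in simp)+
  have g': "integrable lborel (\<lambda>b. g (Complex \<sigma> (- z)) (- b))"
    using lborel_integrable_real_affine[OF g(2), of "-1" 0] by simp
  have ae: "AE b in lborel. g (Complex \<sigma> z) b + g (Complex \<sigma> (- z)) (- b) = 1 / (Complex (A + \<sigma> * \<bar>b\<bar>) (X + b * z)) ^ Suc n"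
    using AE_lborel_singleton[of 0]
  proof eventually_elim
    case (elim b)
    have 1: "Complex A X + of_real b * Complex \<sigma> z = Complex (A + \<sigma> * b) (X + b * z)" 
      "Complex A X + of_real (- b) * Complex \<sigma> (- z) = Complex (A + \<sigma> * - b) (X + b * z)"
      by (simp_all add: complex_eq_iff mult.commute)
    show ?case unfolding g_def 1 using elim by (cases "b > 0") (auto simp: indicator_def)
  qed
  have [measurable]: "(\<lambda>b. Complex (A + \<sigma> * \<bar>b\<bar>) (X + b * z)) \<in> borel_measurable borel"
    unfolding Complex_eq by measurable
  show "integrable lborel (\<lambda>b. 1 / (Complex (A + \<sigma> * \<bar>b\<bar>) (X + b * z)) ^ Suc n)"
    by (rule integrable_cong_AE_imp[OF Bochner_Integration.integrable_add[OF g(1) g'] _ ae]) measurable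
  have "(\<integral>b. 1 / (Complex (A + \<sigma> * \<bar>b\<bar>) (X + b * z)) ^ Suc n \<partial>lborel) =
     (\<integral>b. g (Complex \<sigma> z) b + g (Complex \<sigma> (- z)) (- b) \<partial>lborel)"
    using ae g(1) g' by (intro integral_cong_AE) auto
  also have "\<dots> = (\<integral>b. g (Complex \<sigma> z) b \<partial>lborel) + (\<integral>b. g (Complex \<sigma> (- z)) (- b) \<partial>lborel)"
    by (rule Bochner_Integration.integral_add[OF g(1) g'])
  also have "(\<integral>b. g (Complex \<sigma> (- z)) (- b) \<partial>lborel) = (\<integral>b. g (Complex \<sigma> (- z)) b \<partial>lborel)"
    by (subst (2) lborel_integral_real_affine[where c="-1" and t=0]) simp_all
  also have "(\<integral>b. g (Complex \<sigma> z) b \<partial>lborel) + \<dots> = 1 / of_nat n * (1 / Complex \<sigma> z + 1 / Complex \<sigma> (- z)) * (1 / (Complex A X) ^ n)"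
    unfolding g by (simp add: add_divide_distrib mult_ac)
  also have "1 / Complex \<sigma> z + 1 / Complex \<sigma> (- z) = of_real (2 * \<sigma> / (\<sigma>\<^sup>2 + z\<^sup>2))"
  proof -
    have "\<sigma>\<^sup>2 + z\<^sup>2 \<noteq> 0" using \<sigma> by (simp add: add_nonneg_eq_0_iff)
    thus ?thesis by (simp add: complex_eq_iff Re_divide Im_divide power2_eq_square[of "\<sigma>\<^sup>2 + z\<^sup>2"])
  qed
  finally show "(\<integral>b. 1 / (Complex (A + \<sigma> * \<bar>b\<bar>) (X + b * z)) ^ Suc n \<partial>lborel) =
      of_real (2 * \<sigma> / (\<sigma>\<^sup>2 + z\<^sup>2) / n) * (1 / (Complex A X) ^ n)"
    by simp
qed

text \<open>For fixed \<open>a\<close> the singularity in \<open>b\<close> is split off with radius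
  \<open>1 + \<bar>a\<bar>\<close>. The power \<open>q\<close> lost to it is given back by the
  weight, and an integrable multiple of \<open>(1 + \<bar>a\<bar>) powr - 2\<close> remains.\<close>

lemma nn_integral_ridge_weight_finite:
  assumes q: "0 \<le> q" "q < 1" and x: "x3 \<noteq> 0"
  shows "(\<integral>\<^sup>+(a, b). ennreal (\<bar>x1 + a * x2 + b * x3\<bar> powr - q * (1 + \<bar>a\<bar> + \<bar>b\<bar>) powr (q - 3)) \<partial>(lborel \<Otimes>\<^sub>M lborel)) < \<infinity>"
proof -
  define C where "C = \<bar>x3\<bar> powr - q * (2 / (2 - q) + 2 / (1 - q))"
  have "(\<integral>\<^sup>+(a, b). ennreal (\<bar>x1 + a * x2 + b * x3\<bar> powr - q * (1 + \<bar>a\<bar> + \<bar>b\<bar>) powr (q - 3)) \<partial>(lborel \<Otimes>\<^sub>M lborel))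
    = (\<integral>\<^sup>+a. (\<integral>\<^sup>+b. ennreal (\<bar>x1 + a * x2 + b * x3\<bar> powr - q * (1 + \<bar>a\<bar> + \<bar>b\<bar>) powr (q - 3)) \<partial>lborel) \<partial>lborel)"
    by (subst lborel.nn_integral_fst[symmetric]) (simp_all add: case_prod_beta')
  also have "\<dots> \<le> (\<integral>\<^sup>+a. ennreal C * ennreal ((1 + \<bar>a\<bar>) powr - 2) \<partial>lborel)"
  proof (rule nn_integral_mono)
    fix a :: real
    define M where "M = 1 + \<bar>a\<bar>"
    define c where "c = - (x1 + a * x2) / x3"
    have M: "0 < M" by (simp add: M_def add_pos_nonneg)
    have fac: "\<bar>x1 + a * x2 + b * x3\<bar> = \<bar>x3\<bar> * \<bar>b - c\<bar>" for b
    proof -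
      have "x1 + a * x2 + b * x3 = x3 * (b - c)" using x by (simp add: c_def field_simps)
      thus ?thesis by (simp only: abs_mult)
    qed
    have "(\<integral>\<^sup>+b. ennreal (\<bar>x1 + a * x2 + b * x3\<bar> powr - q * (1 + \<bar>a\<bar> + \<bar>b\<bar>) powr (q - 3)) \<partial>lborel)
      = ennreal (\<bar>x3\<bar> powr - q) * (\<integral>\<^sup>+b. ennreal (\<bar>b - c\<bar> powr - q) * ennreal ((M + \<bar>b\<bar>) powr (q - 3)) \<partial>lborel)"
      unfolding fac by (subst nn_integral_cmult[symmetric]) (simp_all add: powr_mult ennreal_mult mult.assoc M_def)
    also have "\<dots> \<le> ennreal (\<bar>x3\<bar> powr - q) * (ennreal (M powr - q) * (\<integral>\<^sup>+b. ennreal ((M + \<bar>b\<bar>) powr (q - 3)) \<partial>lborel)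
       + ennreal (2 * (M powr (1 - q) / (1 - q))) * ennreal (M powr (q - 3)))"
      using q M by (intro mult_left_mono nn_integral_singular_kernel_le) (auto intro!: ennreal_leI powr_mono2')
    also have "\<dots> = ennreal (\<bar>x3\<bar> powr - q * (M powr - q * (2 * (M powr (q - 2) / (2 - q))) + 2 * (M powr (1 - q) / (1 - q)) * M powr (q - 3)))"
    proof -
      have "(\<integral>\<^sup>+b. ennreal ((M + \<bar>b\<bar>) powr (q - 3)) \<partial>lborel) = ennreal (2 * (M powr (q - 2) / (2 - q)))"
        using nn_integral_powr_tail[of "q - 3" M] q M by simp
      moreover have "ennreal k * (ennreal a * ennreal b + ennreal c * ennreal d) = ennreal (k * (a * b + c * d))"
        if "0 \<le> k" "0 \<le> a" "0 \<le> b" "0 \<le> c" "0 \<le> d" for a b c d k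
        using that by (simp add: ennreal_mult ennreal_plus)
      ultimately show ?thesis using q by (simp only:) auto
    qed
    also have "M powr - q * (2 * (M powr (q - 2) / (2 - q))) + 2 * (M powr (1 - q) / (1 - q)) * M powr (q - 3)
       = (2 / (2 - q) + 2 / (1 - q)) * M powr - 2"
    proof -
      have "M powr - q * M powr (q - 2) = M powr - 2" "M powr (1 - q) * M powr (q - 3) = M powr - 2"
        by (simp_all flip: powr_add)
      moreover have "M powr - q * (2 * (M powr (q - 2) / (2 - q))) + 2 * (M powr (1 - q) / (1 - q)) * M powr (q - 3)
        = 2 / (2 - q) * (M powr - q * M powr (q - 2)) + 2 / (1 - q) * (M powr (1 - q) * M powr (q - 3))"
        by (simp add: mult_ac)
      ultimately show ?thesis by (simp only: distrib_right)
    qed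
    also have "ennreal (\<bar>x3\<bar> powr - q * ((2 / (2 - q) + 2 / (1 - q)) * M powr - 2)) = ennreal C * ennreal ((1 + \<bar>a\<bar>) powr - 2)"
      by (subst ennreal_mult''[symmetric]) (simp_all add: C_def M_def mult.assoc)
    finally show "(\<integral>\<^sup>+b. ennreal (\<bar>x1 + a * x2 + b * x3\<bar> powr - q * (1 + \<bar>a\<bar> + \<bar>b\<bar>) powr (q - 3)) \<partial>lborel)
      \<le> ennreal C * ennreal ((1 + \<bar>a\<bar>) powr - 2)" .
  qed
  also have "\<dots> < \<infinity>"
    using nn_integral_powr_tail[of "-2" 1] by (simp add: nn_integral_cmult ennreal_mult_less_top)
  finally show ?thesis .
qed

text \<open>A product of three half-plane kernels, each without its factor \<open>1 / pi\<close>,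
  and not the rotation-invariant kernel of a half-space. Its total mass is therefore
  \<open>pi ^ 3\<close>.\<close>

definition poisson_kernel :: "real \<Rightarrow> (real \<times> real) \<times> real \<Rightarrow> real" where
  "poisson_kernel \<sigma> z = \<sigma> / (\<sigma>\<^sup>2 + (fst (fst z))\<^sup>2) * (\<sigma> / (\<sigma>\<^sup>2 + (snd (fst z))\<^sup>2)) * (\<sigma> / (\<sigma>\<^sup>2 + (snd z)\<^sup>2))"

text \<open>The weight \<open>1 + \<bar>a\<bar> + \<bar>b\<bar>\<close> is chosen so that this superposition of plane waves is a product of
  one-dimensional kernels.\<close>

lemma ridge_plane_integral:
  assumes \<sigma>: "0 < \<sigma>"
  shows "integrable (lborel \<Otimes>\<^sub>M lborel) (\<lambda>(a, b). ridge (\<sigma> * (1 + \<bar>a\<bar> + \<bar>b\<bar>)) (z \<bullet> ((1, a), b)))"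
    and "(\<integral>(a, b). ridge (\<sigma> * (1 + \<bar>a\<bar> + \<bar>b\<bar>)) (z \<bullet> ((1, a), b)) \<partial>(lborel \<Otimes>\<^sub>M lborel)) = 2 * poisson_kernel \<sigma> z"
proof -
  define z1 where "z1 = fst (fst z)"
  define z2 where "z2 = snd (fst z)"
  define z3 where "z3 = snd z"
  have zz: "z \<bullet> ((1, a), b) = z1 + a * z2 + b * z3" for a b
    by (simp add: inner_prod_def z1_def z2_def z3_def mult.commute)
  show int: "integrable (lborel \<Otimes>\<^sub>M lborel) (\<lambda>(a, b). ridge (\<sigma> * (1 + \<bar>a\<bar> + \<bar>b\<bar>)) (z \<bullet> ((1, a), b)))"
  proof (rule integrableI_bounded)
    have "(\<integral>\<^sup>+w. ennreal (norm (case w of (a, b) \<Rightarrow> ridge (\<sigma> * (1 + \<bar>a\<bar> + \<bar>b\<bar>)) (z \<bullet> ((1, a), b)))) \<partial>(lborel \<Otimes>\<^sub>M lborel))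
      \<le> (\<integral>\<^sup>+w. ennreal (3 * \<sigma> powr -3) * (case w of (a, b) \<Rightarrow> ennreal (\<bar>0 + a * 0 + b * 1\<bar> powr - 0 * (1 + \<bar>a\<bar> + \<bar>b\<bar>) powr (0 - 3))) \<partial>(lborel \<Otimes>\<^sub>M lborel))"
    proof (rule nn_integral_mono_AE)
      \<comment> \<open>The weight estimate is reused with exponent 0. The factor
        \<open>\<bar>b\<bar> powr - 0\<close> is then 1 except for \<open>b = 0\<close>, where
        \<open>0 powr 0 = 0\<close> would spoil the bound; that line is null.\<close>
      have "AE w in (lborel :: (real \<times> real) measure). w \<bullet> (0, 1) \<noteq> 0"
        by (rule AE_lborel_inner_neq) (simp add: zero_prod_def)
      hence "AE w in (lborel :: (real \<times> real) measure). snd w \<noteq> 0"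
        by (simp add: inner_prod_def)
      hence "AE w in (lborel \<Otimes>\<^sub>M lborel :: (real \<times> real) measure). snd w \<noteq> 0" unfolding lborel_prod .
      thus "AE w in (lborel \<Otimes>\<^sub>M lborel). ennreal (norm (case w of (a, b) \<Rightarrow> ridge (\<sigma> * (1 + \<bar>a\<bar> + \<bar>b\<bar>)) (z \<bullet> ((1, a), b)))) \<le>
         ennreal (3 * \<sigma> powr -3) * (case w of (a, b) \<Rightarrow> ennreal (\<bar>0 + a * 0 + b * 1\<bar> powr - 0 * (1 + \<bar>a\<bar> + \<bar>b\<bar>) powr (0 - 3)))"
      proof eventually_elim
        case (elim w)
        obtain a b where w: "w = (a, b)" by (cases w)
        define N where "N = 1 + \<bar>a\<bar> + \<bar>b\<bar>"
        have N: "0 < N" by (simp add: N_def add_pos_nonneg)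
        have "\<bar>ridge (\<sigma> * N) t\<bar> \<le> 3 * (\<sigma> * N) powr -3" for t
        proof -
          have "\<bar>ridge (\<sigma> * N) t\<bar> \<le> 3 * (\<sigma> * N + \<bar>t\<bar>) powr -3" using \<sigma> N by (intro ridge_bound) simp
          also have "\<dots> \<le> 3 * (\<sigma> * N) powr -3" using \<sigma> N by (intro mult_left_mono powr_mono2') auto
          finally show ?thesis .
        qed
        hence "\<bar>ridge (\<sigma> * N) t\<bar> \<le> 3 * \<sigma> powr -3 * N powr - 3" for t
          using \<sigma> N by (simp add: powr_mult mult.assoc)
        thus ?case using elim by (simp add: w N_def[symmetric] ennreal_leI flip: ennreal_mult')
      qed
    qed
    also have "\<dots> < \<infinity>"
      using nn_integral_ridge_weight_finite[of 0 1 0 0]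
      by (subst nn_integral_cmult) (auto simp: ennreal_mult_less_top case_prod_beta')
    finally show "(\<integral>\<^sup>+w. ennreal (norm (case w of (a, b) \<Rightarrow> ridge (\<sigma> * (1 + \<bar>a\<bar> + \<bar>b\<bar>)) (z \<bullet> ((1, a), b)))) \<partial>(lborel \<Otimes>\<^sub>M lborel)) < \<infinity>" .
  qed (simp add: zz case_prod_beta')
  \<comment> \<open>Integrating over \<open>b\<close> lowers the exponent from 3 to 2 and brings
    \<open>2 * \<sigma> / (\<sigma>\<^sup>2 + z3\<^sup>2) / 2\<close>; integrating over
    \<open>a\<close> lowers it from 2 to 1 and brings
    \<open>2 * \<sigma> / (\<sigma>\<^sup>2 + z2\<^sup>2)\<close>. The remaining
    \<open>Re (1 / Complex \<sigma> z1)\<close> is the third kernel, whence the overall factor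
    2.\<close>
  define c3 where "c3 = \<sigma> / (\<sigma>\<^sup>2 + z3\<^sup>2)"
  define c2 where "c2 = 2 * \<sigma> / (\<sigma>\<^sup>2 + z2\<^sup>2)"
  have "(\<integral>(a, b). ridge (\<sigma> * (1 + \<bar>a\<bar> + \<bar>b\<bar>)) (z \<bullet> ((1, a), b)) \<partial>(lborel \<Otimes>\<^sub>M lborel)) =
    (\<integral>a. (\<integral>b. ridge (\<sigma> * (1 + \<bar>a\<bar> + \<bar>b\<bar>)) (z \<bullet> ((1, a), b)) \<partial>lborel) \<partial>lborel)"
    using lborel_pair.integral_fst'[OF int] by simp
  also have "\<dots> = (\<integral>a. c3 * Re (1 / (Complex (\<sigma> + \<sigma> * \<bar>a\<bar>) (z1 + a * z2)) ^ 2) \<partial>lborel)"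
  proof (rule Bochner_Integration.integral_cong[OF refl])
    fix a :: real
    have A: "0 < \<sigma> + \<sigma> * \<bar>a\<bar>" using \<sigma> by (simp add: add_pos_nonneg)
    note L = cpow_line_integral[OF A \<sigma>, of 2 "z1 + a * z2" z3]
    have "(\<integral>b. ridge (\<sigma> * (1 + \<bar>a\<bar> + \<bar>b\<bar>)) (z \<bullet> ((1, a), b)) \<partial>lborel) =
       (\<integral>b. Re (1 / (Complex ((\<sigma> + \<sigma> * \<bar>a\<bar>) + \<sigma> * \<bar>b\<bar>) (z1 + a * z2 + b * z3)) ^ 3) \<partial>lborel)"
      unfolding Re_inverse_cube zz by (simp add: algebra_simps)
    also have "\<dots> = Re (\<integral>b. 1 / (Complex ((\<sigma> + \<sigma> * \<bar>a\<bar>) + \<sigma> * \<bar>b\<bar>) (z1 + a * z2 + b * z3)) ^ 3 \<partial>lborel)"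
      using L(1) by (intro integral_Re) (simp add: numeral_eq_Suc)
    also have "\<dots> = c3 * Re (1 / (Complex (\<sigma> + \<sigma> * \<bar>a\<bar>) (z1 + a * z2)) ^ 2)"
    proof -
      have "2 * \<sigma> / r / real 2 = \<sigma> / r" for r by simp
      hence c: "2 * \<sigma> / (\<sigma>\<^sup>2 + z3\<^sup>2) / real 2 = c3" 
        unfolding c3_def by (simp only:)
      have n: "Suc 2 = 3" by simp
      have "Re (of_real r * u) = r * Re u" for r u by simp
      thus ?thesis using L(2) unfolding c n by (simp only:)
    qed
    finally show "(\<integral>b. ridge (\<sigma> * (1 + \<bar>a\<bar> + \<bar>b\<bar>)) (z \<bullet> ((1, a), b)) \<partial>lborel) = c3 * Re (1 / (Complex (\<sigma> + \<sigma> * \<bar>a\<bar>) (z1 + a * z2)) ^ 2)" .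
  qed
  also have "\<dots> = c3 * Re (\<integral>a. 1 / (Complex (\<sigma> + \<sigma> * \<bar>a\<bar>) (z1 + a * z2)) ^ 2 \<partial>lborel)"
    using cpow_line_integral(1)[OF \<sigma> \<sigma>, of 1 z1 z2] by (simp add: integral_Re numeral_2_eq_2)
  also have "(\<integral>a. 1 / (Complex (\<sigma> + \<sigma> * \<bar>a\<bar>) (z1 + a * z2)) ^ 2 \<partial>lborel) = of_real c2 * (1 / Complex \<sigma> z1)"
    using cpow_line_integral(2)[OF \<sigma> \<sigma>, of 1 z1 z2] by (simp add: numeral_2_eq_2 c2_def)
  also have "c3 * Re (of_real c2 * (1 / Complex \<sigma> z1)) = 2 * poisson_kernel \<sigma> z"
  proof -
    have "Re (of_real r * u) = r * Re u" for r u by simp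
    hence "Re (of_real c2 * (1 / Complex \<sigma> z1)) = c2 * Re (1 / Complex \<sigma> z1)" .
    also have "Re (1 / Complex \<sigma> z1) = \<sigma> / (\<sigma>\<^sup>2 + z1\<^sup>2)" by (simp add: Re_divide)
    finally have "Re (of_real c2 * (1 / Complex \<sigma> z1)) = c2 * (\<sigma> / (\<sigma>\<^sup>2 + z1\<^sup>2))" .
    thus ?thesis
      by (simp only:) (simp add: c2_def c3_def poisson_kernel_def z1_def z2_def z3_def mult_ac)
  qed
  finally show "(\<integral>(a, b). ridge (\<sigma> * (1 + \<bar>a\<bar> + \<bar>b\<bar>)) (z \<bullet> ((1, a), b)) \<partial>(lborel \<Otimes>\<^sub>M lborel)) = 2 * poisson_kernel \<sigma> z" .
qed


section \<open>Integration over directions in an affine chart\<close>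

text \<open>Directions are normalised to have first coordinate 1. This is the form that the shear of
  the slicing argument can straighten, and integration over directions becomes Lebesgue integration
  over the plane.\<close>

definition chart :: "real \<times> real \<Rightarrow> (real \<times> real) \<times> real" where
  "chart w = ((1, fst w), snd w)"

text \<open>This is the l1-norm of \<open>chart w\<close>.\<close>

definition chart_weight :: "real \<times> real \<Rightarrow> real" where
  "chart_weight w = 1 + \<bar>fst w\<bar> + \<bar>snd w\<bar>"

lemma chart_measurable [measurable]: "chart \<in> borel_measurable borel"
  unfolding chart_def[abs_def] by (intro borel_measurable_continuous_onI continuous_intros)

lemma chart_weight_measurable [measurable]: "chart_weight \<in> borel_measurable borel"
  unfolding chart_weight_def[abs_def] by (intro borel_measurable_continuous_onI continuous_intros)

lemma poisson_kernel_measurable [measurable]: "poisson_kernel \<sigma> \<in> borel_measurable borel"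
  unfolding poisson_kernel_def[abs_def] by measurable

lemma chart_weight_pos: "0 < chart_weight w"
  by (simp add: chart_weight_def add_pos_nonneg)

lemma inner_chart: "x \<bullet> chart w = fst (fst x) + fst w * snd (fst x) + snd w * snd x"
  by (simp add: chart_def inner_prod_def mult.commute)

lemma poisson_kernel_nonneg: "0 \<le> \<sigma> \<Longrightarrow> 0 \<le> poisson_kernel \<sigma> z"
  by (simp add: poisson_kernel_def)

lemma AE_inner_chart_neq:
  assumes "snd x \<noteq> 0"
  shows "AE w in lborel. x \<bullet> chart w \<noteq> 0"
proof -
  have "AE w in (lborel :: (real \<times> real) measure). w \<bullet> (snd (fst x), snd x) \<noteq> - fst (fst x)"
    using assms by (intro AE_lborel_inner_neq) (auto simp: zero_prod_def)
  thus ?thesis unfolding inner_chart by eventually_elim (auto simp: inner_prod_def)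
qed

lemma ridge_chart_integral:
  assumes "0 < \<sigma>"
  shows "integrable lborel (\<lambda>w. ridge (\<sigma> * chart_weight w) (z \<bullet> chart w))"
    and "(\<integral>w. ridge (\<sigma> * chart_weight w) (z \<bullet> chart w) \<partial>lborel) = 2 * poisson_kernel \<sigma> z"
  using ridge_plane_integral[OF assms, of z]
  by (simp_all add: lborel_prod chart_def chart_weight_def case_prod_beta')

lemma chart_weight_integral_finite:
  assumes "0 \<le> q" "q < 1" "snd x \<noteq> 0"
  shows "integrable lborel (\<lambda>w. \<bar>x \<bullet> chart w\<bar> powr - q * chart_weight w powr (q - 3))"
proof (rule integrableI_bounded)
  show "(\<integral>\<^sup>+w. ennreal (norm (\<bar>x \<bullet> chart w\<bar> powr - q * chart_weight w powr (q - 3))) \<partial>lborel) < \<infinity>"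
    using nn_integral_ridge_weight_finite[OF assms, of "fst (fst x)" "snd (fst x)"]
    by (simp add: lborel_prod inner_chart chart_weight_def case_prod_beta')
qed measurable

text \<open>The substitution \<open>u = s * X\<close> pulls \<open>\<bar>X\<bar> powr - q\<close>
  out of the integral. With \<open>X = x \<bullet> chart w\<close> this is where the functions
  \<open>\<bar>x \<bullet> chart w\<bar> powr - q\<close> of the mixture come from.\<close>

lemma ridge_scaled:
  assumes q: "0 < q" "q < 1" and M: "0 < M" and X: "X \<noteq> 0"
  shows "integrable lborel (\<lambda>s. \<bar>s\<bar> powr (q - 1) * ridge M (s * X - Y))"
    and "(\<integral>s. \<bar>s\<bar> powr (q - 1) * ridge M (s * X - Y) \<partial>lborel) = \<bar>X\<bar> powr - q * ridge_transform q M Y"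
    and "(\<integral>s. \<bar>\<bar>s\<bar> powr (q - 1) * ridge M (s * X - Y)\<bar> \<partial>lborel) \<le> \<bar>X\<bar> powr - q * ((3 + 6 / q) * M powr (q - 3))"
proof -
  define f where "f u = \<bar>u\<bar> powr (q - 1) * ridge M (u - Y)" for u
  have f: "integrable lborel f" unfolding f_def by (rule ridge_transform_integrable[OF q M])
  have eq: "f (0 + X * s) = \<bar>X\<bar> powr (q - 1) * (\<bar>s\<bar> powr (q - 1) * ridge M (s * X - Y))" for s
    by (simp add: f_def abs_mult powr_mult mult.commute)
  have Xq: "\<bar>X\<bar> * \<bar>X\<bar> powr (q - 1) = \<bar>X\<bar> powr q" using X by (simp add: powr_mult_base)
  have X0: "\<bar>X\<bar> powr (q - 1) \<noteq> 0" "0 < \<bar>X\<bar> powr q" using X by auto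
  have "integrable lborel (\<lambda>s. f (0 + X * s))" by (rule lborel_integrable_real_affine[OF f X])
  thus 1: "integrable lborel (\<lambda>s. \<bar>s\<bar> powr (q - 1) * ridge M (s * X - Y))"
    unfolding eq using X by simp
  have "ridge_transform q M Y = \<bar>X\<bar> *\<^sub>R (\<integral>s. f (0 + X * s) \<partial>lborel)"
    using lborel_integral_real_affine[OF X, of f 0] by (simp add: f_def ridge_transform_def)
  also have "\<dots> = \<bar>X\<bar> powr q * (\<integral>s. \<bar>s\<bar> powr (q - 1) * ridge M (s * X - Y) \<partial>lborel)"
    unfolding eq Xq[symmetric] by simp
  finally show "(\<integral>s. \<bar>s\<bar> powr (q - 1) * ridge M (s * X - Y) \<partial>lborel) = \<bar>X\<bar> powr - q * ridge_transform q M Y"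
    using X0 by (simp add: powr_minus field_simps)
  have "\<bar>X\<bar> powr q * (\<integral>s. \<bar>\<bar>s\<bar> powr (q - 1) * ridge M (s * X - Y)\<bar> \<partial>lborel) = \<bar>X\<bar> *\<^sub>R (\<integral>s. \<bar>f (0 + X * s)\<bar> \<partial>lborel)"
    unfolding eq Xq[symmetric] by (simp add: abs_mult)
  also have "\<dots> = (\<integral>u. \<bar>f u\<bar> \<partial>lborel)"
    using lborel_integral_real_affine[OF X, of "\<lambda>u. \<bar>f u\<bar>" 0] by simp
  also have "\<dots> \<le> (3 + 6 / q) * M powr (q - 3)"
  proof -
    have "ennreal (\<integral>u. \<bar>f u\<bar> \<partial>lborel) = (\<integral>\<^sup>+u. ennreal \<bar>f u\<bar> \<partial>lborel)"
      using f by (subst nn_integral_eq_integral) auto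
    also have "\<dots> \<le> ennreal (3 * (2 / (- (-3) - 1) + 2 / q) * M powr (-3 + q))"
      using nn_integral_powr_times_kernel_le[OF q M _ _ ridge_bound[OF M], of Y] by (simp add: f_def abs_mult)
    finally have "(\<integral>u. \<bar>f u\<bar> \<partial>lborel) \<le> 3 * (2 / (- (-3) - 1) + 2 / q) * M powr (-3 + q)"
      using q by (subst (asm) ennreal_le_iff) auto
    thus ?thesis by (simp add: algebra_simps)
  qed
  finally show "(\<integral>s. \<bar>\<bar>s\<bar> powr (q - 1) * ridge M (s * X - Y)\<bar> \<partial>lborel) \<le> \<bar>X\<bar> powr - q * ((3 + 6 / q) * M powr (q - 3))"
    using X0 by (simp add: powr_minus field_simps)
qed

text \<open>Integrating the plane wave expansion of the Poisson kernel along the line \<open>\<real>x\<close>.\<close>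

lemma poisson_kernel_line_integral:
  assumes q: "0 < q" "q < 1" and \<sigma>: "0 < \<sigma>" and x: "snd x \<noteq> 0"
  shows "integrable lborel (\<lambda>s. \<bar>s\<bar> powr (q - 1) * (2 * poisson_kernel \<sigma> (s *\<^sub>R x - y)))"
    and "(\<integral>s. \<bar>s\<bar> powr (q - 1) * (2 * poisson_kernel \<sigma> (s *\<^sub>R x - y)) \<partial>lborel) =
      (\<integral>w. \<bar>x \<bullet> chart w\<bar> powr - q * ridge_transform q (\<sigma> * chart_weight w) (y \<bullet> chart w) \<partial>lborel)"
proof -
  define G where "G w s = \<bar>s\<bar> powr (q - 1) * ridge (\<sigma> * chart_weight w) (s * (x \<bullet> chart w) - y \<bullet> chart w)" for w s
  have M: "0 < \<sigma> * chart_weight w" for w using \<sigma> chart_weight_pos by simp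
  have [measurable]: "case_prod G \<in> borel_measurable (lborel \<Otimes>\<^sub>M lborel)"
    unfolding G_def by measurable
  have ae: "AE w in lborel. x \<bullet> chart w \<noteq> 0" by (rule AE_inner_chart_neq[OF x])
  \<comment> \<open>Fubini needs absolute convergence. The integral over \<open>s\<close> of the
    absolute value is at most a constant times \<open>\<bar>x \<bullet> chart w\<bar> powr - q *
    chart_weight w powr (q - 3)\<close>, which is integrable over the chart because
    \<open>snd x \<noteq> 0\<close>.\<close>
  have int: "integrable (lborel \<Otimes>\<^sub>M lborel) (case_prod G)"
  proof (rule lborel_pair.Fubini_integrable)
    show "integrable lborel (\<lambda>w. \<integral>s. norm (case_prod G (w, s)) \<partial>lborel)"
    proof (rule Bochner_Integration.integrable_bound)
      show "integrable lborel (\<lambda>w. (3 + 6 / q) * \<sigma> powr (q - 3) * (\<bar>x \<bullet> chart w\<bar> powr - q * chart_weight w powr (q - 3)))"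
        by (intro integrable_mult_right chart_weight_integral_finite) (use q x in auto)
      show "AE w in lborel. norm (\<integral>s. norm (case_prod G (w, s)) \<partial>lborel) \<le>
        norm ((3 + 6 / q) * \<sigma> powr (q - 3) * (\<bar>x \<bullet> chart w\<bar> powr - q * chart_weight w powr (q - 3)))"
        using ae
      proof eventually_elim
        case (elim w)
        have "(\<integral>s. \<bar>G w s\<bar> \<partial>lborel) \<le> \<bar>x \<bullet> chart w\<bar> powr - q * ((3 + 6 / q) * (\<sigma> * chart_weight w) powr (q - 3))"
          unfolding G_def by (rule ridge_scaled(3)[OF q M elim])
        also have "\<dots> = (3 + 6 / q) * \<sigma> powr (q - 3) * (\<bar>x \<bullet> chart w\<bar> powr - q * chart_weight w powr (q - 3))"
          using \<sigma> chart_weight_pos[of w] by (simp add: powr_mult)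
        finally show ?case using q by (simp add: integral_nonneg_AE)
      qed
    qed measurable
    show "AE w in lborel. integrable lborel (\<lambda>s. case_prod G (w, s))"
      using ae by eventually_elim (simp add: G_def ridge_scaled(1)[OF q M])
  qed measurable
  have inner: "(\<integral>w. G w s \<partial>lborel) = \<bar>s\<bar> powr (q - 1) * (2 * poisson_kernel \<sigma> (s *\<^sub>R x - y))" for s
  proof -
    have "s * (x \<bullet> chart w) - y \<bullet> chart w = (s *\<^sub>R x - y) \<bullet> chart w" for w
      by (simp add: inner_diff_left)
    thus ?thesis unfolding G_def by (simp only: integral_mult_right_zero ridge_chart_integral(2)[OF \<sigma>])
  qed
  show "integrable lborel (\<lambda>s. \<bar>s\<bar> powr (q - 1) * (2 * poisson_kernel \<sigma> (s *\<^sub>R x - y)))"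
    using lborel_pair.integrable_snd[OF int] unfolding inner .
  have "(\<integral>s. \<bar>s\<bar> powr (q - 1) * (2 * poisson_kernel \<sigma> (s *\<^sub>R x - y)) \<partial>lborel) = (\<integral>w. (\<integral>s. G w s \<partial>lborel) \<partial>lborel)"
    unfolding inner[symmetric] by (rule lborel_pair.Fubini_integral[OF int])
  also have "\<dots> = (\<integral>w. \<bar>x \<bullet> chart w\<bar> powr - q * ridge_transform q (\<sigma> * chart_weight w) (y \<bullet> chart w) \<partial>lborel)"
  proof (rule integral_cong_AE)
    show "AE w in lborel. (\<integral>s. G w s \<partial>lborel) = \<bar>x \<bullet> chart w\<bar> powr - q * ridge_transform q (\<sigma> * chart_weight w) (y \<bullet> chart w)"
      using ae by eventually_elim (simp add: G_def ridge_scaled(2)[OF q M])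
  qed measurable
  finally show "(\<integral>s. \<bar>s\<bar> powr (q - 1) * (2 * poisson_kernel \<sigma> (s *\<^sub>R x - y)) \<partial>lborel) =
      (\<integral>w. \<bar>x \<bullet> chart w\<bar> powr - q * ridge_transform q (\<sigma> * chart_weight w) (y \<bullet> chart w) \<partial>lborel)" .
qed

text \<open>The coefficient of \<open>\<bar>x \<bullet> chart w\<bar> powr - q\<close> in the
  smoothed mixture. It does not depend on \<open>x\<close>, so one mixture serves all
  points.\<close>

definition direction_weight :: "real \<Rightarrow> real \<Rightarrow> ((real \<times> real) \<times> real) set \<Rightarrow> real \<times> real \<Rightarrow> real" where
  "direction_weight q \<sigma> K w = (\<integral>y. indicator K y * ridge_transform q (\<sigma> * chart_weight w) (y \<bullet> chart w) \<partial>lborel)"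

text \<open>The integrand depends on \<open>y\<close> only through
  \<open>y \<bullet> chart w\<close>, so slicing reduces the claim to integrals of
  \<open>ridge_transform\<close> over centred intervals.\<close>

lemma direction_weight_nonneg:
  assumes q: "0 < q" "q < 1" and \<sigma>: "0 < \<sigma>" and K: "symmetric_body K"
  shows "0 \<le> direction_weight q \<sigma> K w"
proof -
  have M: "0 < \<sigma> * chart_weight w" using \<sigma> chart_weight_pos by simp
  show ?thesis
    unfolding direction_weight_def chart_def
    by (rule symmetric_body_integral_ridge_nonneg[OF _ ridge_transform_bound[OF q M[unfolded chart_def]] _ K])
      (use ridge_transform_integral_nonneg[OF q M] in auto)
qed

text \<open>The line formula integrated over \<open>y\<close> in \<open>K\<close>. The integrals are
  exchanged for signed functions, with a bound on \<open>ridge_transform\<close> uniform over the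
  compact \<open>K\<close>. The passage to nonnegative integrals comes last, since it is the weight
  integrated over \<open>K\<close> that is known to be nonnegative.\<close>

lemma poisson_smoothing_eq:
  assumes q: "0 < q" "q < 1" and \<sigma>: "0 < \<sigma>" and K: "symmetric_body K" and x: "snd x \<noteq> 0"
  shows "(\<integral>\<^sup>+y. indicator K y * (\<integral>\<^sup>+s. ennreal (\<bar>s\<bar> powr (q - 1)) * ennreal (2 * poisson_kernel \<sigma> (s *\<^sub>R x - y)) \<partial>lborel) \<partial>lborel) =
    (\<integral>\<^sup>+w. ennreal (\<bar>x \<bullet> chart w\<bar> powr - q) * ennreal (direction_weight q \<sigma> K w) \<partial>lborel)"
proof -
  have Kc: "compact K" using K by (simp add: symmetric_body_def)
  have [measurable]: "K \<in> sets borel" using Kc by (simp add: borel_compact)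
  have finK: "emeasure lborel K < \<infinity>" using Kc by (rule emeasure_compact_finite)
  have M: "0 < \<sigma> * chart_weight w" for w using \<sigma> chart_weight_pos by simp
  define J where "J y = (\<integral>s. \<bar>s\<bar> powr (q - 1) * (2 * poisson_kernel \<sigma> (s *\<^sub>R x - y)) \<partial>lborel)" for y
  define G where "G w y = \<bar>x \<bullet> chart w\<bar> powr - q * (indicator K y * ridge_transform q (\<sigma> * chart_weight w) (y \<bullet> chart w))" for w y
  have J0: "0 \<le> J y" for y
    unfolding J_def using \<sigma> by (intro integral_nonneg_AE AE_I2 mult_nonneg_nonneg) (auto intro: poisson_kernel_nonneg)
  have GJ: "(\<integral>w. G w y \<partial>lborel) = indicator K y * J y" for y
  proof -
    have "G w y = indicator K y * (\<bar>x \<bullet> chart w\<bar> powr - q * ridge_transform q (\<sigma> * chart_weight w) (y \<bullet> chart w))" for w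
      by (simp add: G_def)
    thus ?thesis unfolding J_def poisson_kernel_line_integral(2)[OF q \<sigma> x] by (simp only: integral_mult_right_zero)
  qed
  have [measurable]: "case_prod G \<in> borel_measurable (lborel \<Otimes>\<^sub>M lborel)"
    unfolding G_def by measurable
  have int: "integrable (lborel \<Otimes>\<^sub>M lborel) (case_prod G)"
  proof (rule integrableI_bounded)
    define C where "C = (3 + 6 / q) * \<sigma> powr (q - 3)"
    define v where "v w = \<bar>x \<bullet> chart w\<bar> powr - q * chart_weight w powr (q - 3)" for w
    have [measurable]: "v \<in> borel_measurable borel" unfolding v_def[abs_def] by measurable
    have C: "0 \<le> C" using q by (simp add: C_def)
    have "(\<integral>\<^sup>+z. ennreal (norm (case_prod G z)) \<partial>(lborel \<Otimes>\<^sub>M lborel)) = (\<integral>\<^sup>+w. (\<integral>\<^sup>+y. ennreal (norm (G w y)) \<partial>lborel) \<partial>lborel)"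
      by (subst lborel.nn_integral_fst[symmetric]) simp_all
    also have "\<dots> \<le> (\<integral>\<^sup>+w. (\<integral>\<^sup>+y. ennreal (C * v w) * indicator K y \<partial>lborel) \<partial>lborel)"
    proof (intro nn_integral_mono)
      fix w y
      have "\<bar>x \<bullet> chart w\<bar> powr - q * \<bar>ridge_transform q (\<sigma> * chart_weight w) (y \<bullet> chart w)\<bar>
         \<le> \<bar>x \<bullet> chart w\<bar> powr - q * ((3 + 6 / q) * (\<sigma> * chart_weight w) powr (q - 3))"
        by (intro mult_left_mono ridge_transform_bound[OF q M]) simp
      also have "\<dots> = C * v w"
        using \<sigma> chart_weight_pos[of w] by (simp add: C_def v_def powr_mult)
      finally show "ennreal (norm (G w y)) \<le> ennreal (C * v w) * indicator K y"
        by (auto simp: G_def indicator_def abs_mult intro!: ennreal_leI)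
    qed
    also have "\<dots> = (\<integral>\<^sup>+w. ennreal (C * v w) \<partial>lborel) * emeasure lborel K"
      by (simp add: nn_integral_cmult nn_integral_multc)
    also have "\<dots> < \<infinity>"
    proof -
      have "integrable lborel (\<lambda>w. C * v w)"
        unfolding v_def by (intro integrable_mult_right chart_weight_integral_finite) (use q x in auto)
      hence "(\<integral>\<^sup>+w. ennreal (norm (C * v w)) \<partial>lborel) < \<infinity>" by (simp only: integrable_iff_bounded)
      moreover have "norm (C * v w) = C * v w" for w using C by (simp add: v_def)
      ultimately show ?thesis using finK by (simp add: ennreal_mult_less_top)
    qed
    finally show "(\<integral>\<^sup>+z. ennreal (norm (case_prod G z)) \<partial>(lborel \<Otimes>\<^sub>M lborel)) < \<infinity>" .
  qed measurable
  have W: "(\<integral>y. G w y \<partial>lborel) = \<bar>x \<bullet> chart w\<bar> powr - q * direction_weight q \<sigma> K w" for w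
    by (simp add: G_def direction_weight_def)
  have "(\<integral>\<^sup>+y. indicator K y * (\<integral>\<^sup>+s. ennreal (\<bar>s\<bar> powr (q - 1)) * ennreal (2 * poisson_kernel \<sigma> (s *\<^sub>R x - y)) \<partial>lborel) \<partial>lborel)
     = (\<integral>\<^sup>+y. ennreal (indicator K y * J y) \<partial>lborel)"
  proof (rule nn_integral_cong)
    fix y
    have "(\<integral>\<^sup>+s. ennreal (\<bar>s\<bar> powr (q - 1)) * ennreal (2 * poisson_kernel \<sigma> (s *\<^sub>R x - y)) \<partial>lborel) =
      (\<integral>\<^sup>+s. ennreal (\<bar>s\<bar> powr (q - 1) * (2 * poisson_kernel \<sigma> (s *\<^sub>R x - y))) \<partial>lborel)"
      by (simp add: ennreal_mult')
    also have "\<dots> = ennreal (J y)"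
      unfolding J_def using \<sigma>
      by (intro nn_integral_eq_integral poisson_kernel_line_integral(1)[OF q \<sigma> x] AE_I2)
        (simp add: poisson_kernel_nonneg)
    finally show "indicator K y * (\<integral>\<^sup>+s. ennreal (\<bar>s\<bar> powr (q - 1)) * ennreal (2 * poisson_kernel \<sigma> (s *\<^sub>R x - y)) \<partial>lborel) = ennreal (indicator K y * J y)"
      by (simp add: indicator_def)
  qed
  also have "\<dots> = ennreal (\<integral>y. indicator K y * J y \<partial>lborel)"
    using lborel_pair.integrable_snd[OF int] J0 by (intro nn_integral_eq_integral) (simp_all add: GJ)
  also have "(\<integral>y. indicator K y * J y \<partial>lborel) = (\<integral>w. \<bar>x \<bullet> chart w\<bar> powr - q * direction_weight q \<sigma> K w \<partial>lborel)"
    using lborel_pair.Fubini_integral[OF int] by (simp only: GJ W)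
  also have "ennreal \<dots> = (\<integral>\<^sup>+w. ennreal (\<bar>x \<bullet> chart w\<bar> powr - q * direction_weight q \<sigma> K w) \<partial>lborel)"
    using lborel_pair.integrable_fst[OF int] direction_weight_nonneg[OF q \<sigma> K]
    by (intro nn_integral_eq_integral[symmetric]) (simp_all add: W)
  finally show ?thesis by (simp add: ennreal_mult')
qed

subsection \<open>Norms on three-dimensional space\<close>


text \<open>The moment, with density \<open>\<bar>s\<bar> powr (q - 1)\<close>, of the chord that
  the line through \<open>- v\<close> parallel to \<open>x\<close> cuts out of the unit ball. The
  central chord returns \<open>N x powr - q\<close> up to the factor \<open>2 / q\<close>.\<close>

definition chord_moment :: "real \<Rightarrow> ('a::euclidean_space \<Rightarrow> real) \<Rightarrow> 'a \<Rightarrow> 'a \<Rightarrow> ennreal" where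
  "chord_moment q N x v = (\<integral>\<^sup>+s. ennreal (\<bar>s\<bar> powr (q - 1)) * indicator {y. N y \<le> 1} (s *\<^sub>R x - v) \<partial>lborel)"

lemma chord_moment_zero:
  assumes N: "norm_fun N" and q: "0 < q" and x: "x \<noteq> 0"
  shows "chord_moment q N x 0 = ennreal (2 / q * N x powr - q)"
proof -
  have Nx: "0 < N x" by (rule norm_fun_pos[OF N x])
  have "N (s *\<^sub>R x) \<le> 1 \<longleftrightarrow> - (1 / N x) \<le> s \<and> s \<le> 1 / N x" for s
    unfolding norm_fun_scaleR[OF N] pos_le_divide_eq[OF Nx, symmetric] by auto
  hence "chord_moment q N x 0 = (\<integral>\<^sup>+s\<in>{- (1 / N x)..1 / N x}. ennreal (\<bar>s\<bar> powr (q - 1)) \<partial>lborel)"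
    unfolding chord_moment_def by (simp add: indicator_def)
  also have "\<dots> = ennreal (2 * ((1 / N x) powr (q - 1 + 1) / (q - 1 + 1)))"
    using Nx q by (intro nn_integral_abs_powr) auto
  also have "2 * ((1 / N x) powr (q - 1 + 1) / (q - 1 + 1)) = 2 / q * N x powr - q"
    using Nx by (simp add: powr_minus divide_inverse inverse_powr)
  finally show ?thesis .
qed

text \<open>Among parallel chords the central one is longest, and intervals centred at 0 maximise the moment.\<close>

lemma chord_moment_le:
  assumes N: "norm_fun N" and q: "0 < q" "q < 1" and x: "x \<noteq> 0"
  shows "chord_moment q N x v \<le> chord_moment q N x 0"
proof -
  have Nx: "0 < N x" by (rule norm_fun_pos[OF N x])
  define r where "r = 1 / N x"
  define S where "S = {s. N (s *\<^sub>R x - v) \<le> 1}"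
  have r: "0 < r" using Nx by (simp add: r_def)
  \<comment> \<open>Two points of the chord lie at \<open>N\<close>-distance at most 2, so in the
    parameter \<open>s\<close> the chord is no longer than the central one, of length
    \<open>2 / N x\<close>.\<close>
  have diam: "\<bar>s - t\<bar> \<le> 2 * r" if "s \<in> S" "t \<in> S" for s t
  proof -
    have "\<bar>s - t\<bar> * N x = N ((s *\<^sub>R x - v) - (t *\<^sub>R x - v))"
      by (simp add: norm_fun_scaleR[OF N, symmetric] scaleR_diff_left)
    also have "\<dots> \<le> N (s *\<^sub>R x - v) + N (t *\<^sub>R x - v)"
      using norm_fun_triangle[OF N, of "s *\<^sub>R x - v" "- (t *\<^sub>R x - v)"] norm_fun_minus[OF N, of "t *\<^sub>R x - v"] by simp
    also have "\<dots> \<le> 2" using that by (simp add: S_def)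
    finally show ?thesis using Nx by (simp add: r_def field_simps)
  qed
  have S_closed: "closed S" unfolding S_def
    by (intro closed_Collect_le continuous_on_compose2[OF norm_fun_continuous[OF N, of UNIV]] continuous_intros) auto
  hence [measurable]: "S \<in> sets borel" by simp
  have em: "emeasure lborel S \<le> ennreal (2 * r)"
  proof (cases "S = {}")
    case False
    have bdd: "bdd_below S"
    proof -
      obtain t where "t \<in> S" using False by auto
      thus ?thesis using diam by (intro bdd_belowI[of _ "t - 2 * r"]) (smt (verit))
    qed
    have Inf: "Inf S \<in> S" using S_closed False bdd by (intro closed_contains_Inf)
    have "S \<subseteq> {Inf S..Inf S + 2 * r}"
      using diam[OF _ Inf] cInf_lower[OF _ bdd] by fastforce
    hence "emeasure lborel S \<le> emeasure lborel {Inf S..Inf S + 2 * r}" by (intro emeasure_mono) auto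
    thus ?thesis using r by simp
  qed simp
  have "chord_moment q N x v = (\<integral>\<^sup>+s\<in>S. ennreal (\<bar>s\<bar> powr (q - 1)) \<partial>lborel)"
    unfolding chord_moment_def S_def by (intro nn_integral_cong) (simp add: indicator_def)
  \<comment> \<open>The point 0, where the default \<open>0 powr (q - 1) = 0\<close> undercuts the
    threshold, is removed from the interval.\<close>
  also have "\<dots> \<le> (\<integral>\<^sup>+s\<in>{-r..r} - {0}. ennreal (\<bar>s\<bar> powr (q - 1)) \<partial>lborel)"
  proof (rule nn_integral_bathtub[where \<tau> = "ennreal (r powr (q - 1))"])
    have "emeasure lborel ({-r..r} - {0}) = emeasure lborel {-r..r}"
      by (rule emeasure_Diff_null_set) auto
    thus "emeasure lborel S \<le> emeasure lborel ({-r..r} - {0})" using em r by simp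
    show "emeasure lborel S < \<infinity>" using em by (rule le_less_trans) simp
  next
    fix s assume "s \<in> S - ({-r..r} - {0})"
    hence "s = 0 \<or> r \<le> \<bar>s\<bar>" by auto
    thus "ennreal (\<bar>s\<bar> powr (q - 1)) \<le> ennreal (r powr (q - 1))"
    proof
      assume "r \<le> \<bar>s\<bar>" thus ?thesis using r q by (intro ennreal_leI powr_mono2') auto
    qed simp
  next
    fix s assume "s \<in> {-r..r} - {0} - S"
    thus "ennreal (r powr (q - 1)) \<le> ennreal (\<bar>s\<bar> powr (q - 1))"
      using r q by (intro ennreal_leI powr_mono2') auto
  qed auto
  also have "\<dots> \<le> chord_moment q N x 0"
    unfolding chord_moment_def r_def using Nx
    by (intro nn_integral_mono) (auto simp: indicator_def norm_fun_scaleR[OF N] abs_le_iff field_simps)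
  finally show ?thesis .
qed

lemma chord_moment_measurable:
  fixes N :: "'a::euclidean_space \<Rightarrow> real"
  assumes N: "norm_fun N" and [measurable]: "f \<in> borel_measurable M" "g \<in> borel_measurable M"
  shows "(\<lambda>z. chord_moment q N (f z) (g z)) \<in> borel_measurable M"
proof -
  note [measurable] = norm_fun_measurable[OF N]
  have [measurable]: "{y. N y \<le> 1} \<in> sets borel" by measurable
  show ?thesis unfolding chord_moment_def by measurable
qed

text \<open>Fatou's lemma: a parameter with \<open>N (s *\<^sub>R x) < 1\<close> stays in the chord
  under small displacements, and the two end points of the central chord are null. The matching
  upper bound holds without a limit, by maximality of the central chord.\<close>

lemma chord_moment_liminf:
  assumes N: "norm_fun N" and q: "0 < q" "q < 1" and x: "x \<noteq> 0" and \<sigma>: "\<sigma> \<longlonglongrightarrow> 0"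
  shows "chord_moment q N x 0 \<le> liminf (\<lambda>j. chord_moment q N x (\<sigma> j *\<^sub>R v))"
proof -
  note [measurable] = norm_fun_measurable[OF N]
  have [measurable]: "{y. N y \<le> 1} \<in> sets borel" by measurable
  have Nx: "0 < N x" by (rule norm_fun_pos[OF N x])
  let ?f = "\<lambda>j s. ennreal (\<bar>s\<bar> powr (q - 1)) * indicator {y. N y \<le> 1} (s *\<^sub>R x - \<sigma> j *\<^sub>R v)"
  have "chord_moment q N x 0 \<le> (\<integral>\<^sup>+s. liminf (\<lambda>j. ?f j s) \<partial>lborel)"
    unfolding chord_moment_def
  proof (rule nn_integral_mono_AE)
    show "AE s in lborel. ennreal (\<bar>s\<bar> powr (q - 1)) * indicator {y. N y \<le> 1} (s *\<^sub>R x - 0) \<le> liminf (\<lambda>j. ?f j s)"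
      using AE_lborel_singleton[of "1 / N x"] AE_lborel_singleton[of "- (1 / N x)"]
    proof eventually_elim
      case (elim s)
      show ?case
      proof (cases "N (s *\<^sub>R x) \<le> 1")
        case True
        have "N (s *\<^sub>R x) \<noteq> 1"
          using elim Nx by (auto simp: norm_fun_scaleR[OF N] abs_if field_simps split: if_splits)
        hence less: "N (s *\<^sub>R x) < 1" using True by simp
        have "(\<lambda>j. s *\<^sub>R x - \<sigma> j *\<^sub>R v) \<longlonglongrightarrow> s *\<^sub>R x - 0 *\<^sub>R v" by (intro tendsto_intros \<sigma>)
        hence "(\<lambda>j. s *\<^sub>R x - \<sigma> j *\<^sub>R v) \<longlonglongrightarrow> s *\<^sub>R x" by simp
        moreover have "isCont N (s *\<^sub>R x)"
          using norm_fun_continuous[OF N, of UNIV] continuous_on_eq_continuous_at[OF open_UNIV] by auto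
        ultimately have "(\<lambda>j. N (s *\<^sub>R x - \<sigma> j *\<^sub>R v)) \<longlonglongrightarrow> N (s *\<^sub>R x)" by (rule isCont_tendsto_compose[rotated])
        hence "\<forall>\<^sub>F j in sequentially. N (s *\<^sub>R x - \<sigma> j *\<^sub>R v) < 1" using less by (rule order_tendstoD)
        hence "\<forall>\<^sub>F j in sequentially. ennreal (\<bar>s\<bar> powr (q - 1)) \<le> ?f j s"
          by eventually_elim (simp add: indicator_def)
        hence "ennreal (\<bar>s\<bar> powr (q - 1)) \<le> liminf (\<lambda>j. ?f j s)" by (rule Liminf_bounded)
        thus ?thesis using True by simp
      qed simp
    qed
  qed
  also have "\<dots> \<le> liminf (\<lambda>j. \<integral>\<^sup>+s. ?f j s \<partial>lborel)"
    by (rule nn_integral_liminf) measurable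
  finally show ?thesis by (simp only: chord_moment_def)
qed

lemma poisson_kernel_eq_cauchy:
  "poisson_kernel \<sigma> z = pi ^ 3 * (cauchy \<sigma> (fst (fst z)) * cauchy \<sigma> (snd (fst z)) * cauchy \<sigma> (snd z))"
  by (simp add: poisson_kernel_def cauchy_def power3_eq_cube)

lemma poisson_kernel_mass: "(\<integral>\<^sup>+z. ennreal (poisson_kernel 1 z) \<partial>lborel) = ennreal (pi ^ 3)"
proof -
  have "(\<integral>\<^sup>+z. ennreal (poisson_kernel 1 z) \<partial>lborel) =
    (\<integral>\<^sup>+u. (\<integral>\<^sup>+v. (\<integral>\<^sup>+t. ennreal (pi ^ 3) * (ennreal (cauchy 1 t) * ennreal (cauchy 1 v) * ennreal (cauchy 1 u)) \<partial>lborel) \<partial>lborel) \<partial>lborel)"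
    by (subst nn_integral_lborel_triple) (simp_all add: poisson_kernel_eq_cauchy ennreal_mult cauchy_nonneg)
  also have "\<dots> = ennreal (pi ^ 3)"
    by (simp add: nn_integral_cmult nn_integral_multc nn_integral_cauchy)
  finally show ?thesis .
qed

lemma poisson_kernel_dilation:
  assumes \<sigma>: "0 < \<sigma>" and [measurable]: "f \<in> borel_measurable borel"
  shows "(\<integral>\<^sup>+v. ennreal (poisson_kernel \<sigma> v) * f v \<partial>lborel) = (\<integral>\<^sup>+v. ennreal (poisson_kernel 1 v) * f (\<sigma> *\<^sub>R v) \<partial>lborel)"
proof -
  have scale: "\<sigma> ^ 3 * poisson_kernel \<sigma> (\<sigma> *\<^sub>R v) = poisson_kernel 1 v" for v
  proof -
    have "\<sigma> * (\<sigma> / (\<sigma>\<^sup>2 + (\<sigma> * t)\<^sup>2)) = 1 / (1\<^sup>2 + t\<^sup>2)" for t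
    proof -
      have "\<sigma>\<^sup>2 + (\<sigma> * t)\<^sup>2 = \<sigma> * \<sigma> * (1 + t\<^sup>2)" by (simp add: power2_eq_square algebra_simps)
      thus ?thesis using \<sigma> by simp
    qed
    note * = this
    have "\<sigma> ^ 3 * poisson_kernel \<sigma> (\<sigma> *\<^sub>R v) = (\<sigma> * (\<sigma> / (\<sigma>\<^sup>2 + (\<sigma> * fst (fst v))\<^sup>2))) *
       (\<sigma> * (\<sigma> / (\<sigma>\<^sup>2 + (\<sigma> * snd (fst v))\<^sup>2))) * (\<sigma> * (\<sigma> / (\<sigma>\<^sup>2 + (\<sigma> * snd v)\<^sup>2)))"
      by (simp add: poisson_kernel_def power3_eq_cube mult_ac)
    also have "\<dots> = poisson_kernel 1 v" unfolding * by (simp add: poisson_kernel_def)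
    finally show ?thesis .
  qed
  have *: "ennreal (poisson_kernel 1 v) = ennreal (\<sigma> ^ 3) * ennreal (poisson_kernel \<sigma> (\<sigma> *\<^sub>R v))" for v
    unfolding scale[symmetric] using \<sigma> by (intro ennreal_mult') simp
  have "(\<integral>\<^sup>+v. ennreal (poisson_kernel \<sigma> v) * f v \<partial>lborel) =
     ennreal (\<sigma> ^ 3) * (\<integral>\<^sup>+v. ennreal (poisson_kernel \<sigma> (\<sigma> *\<^sub>R v)) * f (\<sigma> *\<^sub>R v) \<partial>lborel)"
    using \<sigma> by (subst nn_integral_lborel_scaleR[of _ \<sigma>]) (simp_all add: power3_eq_cube mult.assoc)
  also have "\<dots> = (\<integral>\<^sup>+v. ennreal (\<sigma> ^ 3) * (ennreal (poisson_kernel \<sigma> (\<sigma> *\<^sub>R v)) * f (\<sigma> *\<^sub>R v)) \<partial>lborel)"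
    by (rule nn_integral_cmult[symmetric]) measurable
  also have "\<dots> = (\<integral>\<^sup>+v. ennreal (poisson_kernel 1 v) * f (\<sigma> *\<^sub>R v) \<partial>lborel)"
    by (intro nn_integral_cong) (simp only: * mult.assoc)
  finally show ?thesis .
qed

text \<open>For each \<open>\<sigma>\<close> the smoothed chord moment \<open>H \<sigma>\<close> is
  a mixture of directional functions, so its integral over \<open>\<mu>\<close> is at most that over
  \<open>\<nu>\<close>. Fatou bounds the central chord moment over \<open>\<mu>\<close> by the lower
  limit of the former, and maximality of the central chord bounds the latter by the central chord
  moment over \<open>\<nu>\<close>. Chaining the three removes the smoothing.\<close>

lemma spatial_norm_embeds_in_Lp:
  fixes N :: "(real \<times> real) \<times> real \<Rightarrow> real"
  assumes N: "norm_fun N" and p: "-1 < p" "p < 0"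
  shows "embeds_in_Lp p N"
  unfolding embeds_in_Lp_def
proof (intro allI impI)
  fix \<mu> \<nu> :: "((real \<times> real) \<times> real) measure"
  assume \<mu>: "moment_measure p \<mu>" and \<nu>: "moment_measure p \<nu>"
    and le: "\<forall>\<xi>. directional_moment p \<mu> \<xi> \<le> directional_moment p \<nu> \<xi>"
  define q where "q = - p"
  have q: "0 < q" "q < 1" using p by (simp_all add: q_def)
  define K where "K = {x. N x \<le> 1}"
  have K: "symmetric_body K"
    unfolding symmetric_body_def K_def using norm_fun_ball[OF N] norm_fun_minus[OF N] by auto
  note [measurable] = norm_fun_measurable[OF N]
  have [measurable]: "K \<in> sets borel" unfolding K_def by measurable
  \<comment> \<open>Averaging over displaced chords is the same as smoothing the indicator of
    \<open>K\<close> and then integrating along the line through 0 and \<open>x\<close>.\<close>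
  define H where "H \<sigma> x = (\<integral>\<^sup>+v. ennreal (2 * poisson_kernel \<sigma> v) * chord_moment q N x v \<partial>lborel)" for \<sigma> x
  have [measurable]: "(\<lambda>x. chord_moment q N x (c *\<^sub>R v)) \<in> borel_measurable borel"
    "(\<lambda>x. chord_moment q N x 0) \<in> borel_measurable borel" for c v
    by (rule chord_moment_measurable[OF N]; measurable)+
  have cm2 [measurable]: "(\<lambda>z. chord_moment q N (fst z) (snd z)) \<in> borel_measurable (borel \<Otimes>\<^sub>M borel)"
    by (rule chord_moment_measurable[OF N]; measurable)
  have cm3 [measurable]: "(\<lambda>v. chord_moment q N x v) \<in> borel_measurable borel" for x
    by (rule chord_moment_measurable[OF N, where f="\<lambda>_. x" and g="\<lambda>v. v"]; measurable)
  have H_measurable [measurable]: "H \<sigma> \<in> borel_measurable borel" for \<sigma>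
  proof -
    have [measurable]: "(\<lambda>(x, v). chord_moment q N x v) \<in> borel_measurable (borel \<Otimes>\<^sub>M lborel)"
      using cm2 by (simp add: case_prod_beta')
    show ?thesis unfolding H_def[abs_def] by measurable
  qed
  have H_eq: "H \<sigma> x = (\<integral>\<^sup>+w. ennreal (\<bar>x \<bullet> chart w\<bar> powr p) * ennreal (direction_weight q \<sigma> K w) \<partial>lborel)"
    if \<sigma>: "0 < \<sigma>" and x: "snd x \<noteq> 0" for \<sigma> x
  proof -
    have "H \<sigma> x = (\<integral>\<^sup>+v. (\<integral>\<^sup>+s. ennreal (2 * poisson_kernel \<sigma> v) * (ennreal (\<bar>s\<bar> powr (q - 1)) * indicator K (s *\<^sub>R x - v)) \<partial>lborel) \<partial>lborel)"
      unfolding H_def chord_moment_def K_def[symmetric]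
      by (intro nn_integral_cong nn_integral_cmult[symmetric]) measurable
    also have "\<dots> = (\<integral>\<^sup>+s. (\<integral>\<^sup>+v. ennreal (2 * poisson_kernel \<sigma> v) * (ennreal (\<bar>s\<bar> powr (q - 1)) * indicator K (s *\<^sub>R x - v)) \<partial>lborel) \<partial>lborel)"
      by (rule lborel_pair.Fubini') measurable
    also have "\<dots> = (\<integral>\<^sup>+s. (\<integral>\<^sup>+y. ennreal (2 * poisson_kernel \<sigma> (s *\<^sub>R x - y)) * (ennreal (\<bar>s\<bar> powr (q - 1)) * indicator K y) \<partial>lborel) \<partial>lborel)"
    proof (rule nn_integral_cong)
      fix s
      show "(\<integral>\<^sup>+v. ennreal (2 * poisson_kernel \<sigma> v) * (ennreal (\<bar>s\<bar> powr (q - 1)) * indicator K (s *\<^sub>R x - v)) \<partial>lborel) =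
        (\<integral>\<^sup>+y. ennreal (2 * poisson_kernel \<sigma> (s *\<^sub>R x - y)) * (ennreal (\<bar>s\<bar> powr (q - 1)) * indicator K y) \<partial>lborel)"
        by (subst lborel_affine[of "-1" "s *\<^sub>R x"]) (simp_all add: nn_integral_density nn_integral_distr)
    qed
    also have "\<dots> = (\<integral>\<^sup>+y. (\<integral>\<^sup>+s. ennreal (2 * poisson_kernel \<sigma> (s *\<^sub>R x - y)) * (ennreal (\<bar>s\<bar> powr (q - 1)) * indicator K y) \<partial>lborel) \<partial>lborel)"
      by (rule lborel_pair.Fubini') measurable
    also have "\<dots> = (\<integral>\<^sup>+y. indicator K y * (\<integral>\<^sup>+s. ennreal (\<bar>s\<bar> powr (q - 1)) * ennreal (2 * poisson_kernel \<sigma> (s *\<^sub>R x - y)) \<partial>lborel) \<partial>lborel)"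
      by (intro nn_integral_cong, subst nn_integral_cmult[symmetric]) (simp_all add: mult_ac)
    also have "\<dots> = (\<integral>\<^sup>+w. ennreal (\<bar>x \<bullet> chart w\<bar> powr p) * ennreal (direction_weight q \<sigma> K w) \<partial>lborel)"
      using poisson_smoothing_eq[OF q \<sigma> K x] by (simp add: q_def)
    finally show ?thesis .
  qed
  have dw [measurable]: "direction_weight q \<sigma> K \<in> borel_measurable borel" for \<sigma>
    unfolding direction_weight_def[abs_def] by measurable
  have AE_snd: "AE x in \<kappa>. snd x \<noteq> 0" if "moment_measure p \<kappa>" for \<kappa> :: "((real \<times> real) \<times> real) measure"
  proof -
    have "AE x in \<kappa>. x \<bullet> ((0, 0), 1) \<noteq> 0" using that by (simp add: moment_measure_def zero_prod_def)
    thus ?thesis by (simp add: inner_prod_def)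
  qed
  have H_int: "(\<integral>\<^sup>+x. H \<sigma> x \<partial>\<kappa>) = (\<integral>\<^sup>+w. directional_moment p \<kappa> (chart w) * ennreal (direction_weight q \<sigma> K w) \<partial>lborel)"
    if \<sigma>: "0 < \<sigma>" and \<kappa>: "moment_measure p \<kappa>" for \<sigma> \<kappa>
  proof -
    have [measurable_cong]: "sets \<kappa> = sets borel" using \<kappa> by (simp add: moment_measure_def)
    interpret \<kappa>: finite_measure \<kappa> using \<kappa> by (simp add: moment_measure_def)
    interpret pair_sigma_finite lborel \<kappa> by unfold_locales
    have "(\<integral>\<^sup>+x. H \<sigma> x \<partial>\<kappa>) = (\<integral>\<^sup>+x. (\<integral>\<^sup>+w. ennreal (\<bar>x \<bullet> chart w\<bar> powr p) * ennreal (direction_weight q \<sigma> K w) \<partial>lborel) \<partial>\<kappa>)"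
      using AE_snd[OF \<kappa>] by (intro nn_integral_cong_AE) (auto simp: H_eq[OF \<sigma>])
    also have "\<dots> = (\<integral>\<^sup>+w. (\<integral>\<^sup>+x. ennreal (\<bar>x \<bullet> chart w\<bar> powr p) * ennreal (direction_weight q \<sigma> K w) \<partial>\<kappa>) \<partial>lborel)"
      by (rule Fubini') measurable
    also have "\<dots> = (\<integral>\<^sup>+w. directional_moment p \<kappa> (chart w) * ennreal (direction_weight q \<sigma> K w) \<partial>lborel)"
      by (intro nn_integral_cong nn_integral_multc) measurable
    finally show ?thesis .
  qed
  \<comment> \<open>The mass of \<open>2 * poisson_kernel \<sigma>\<close>, the same for every
    \<open>\<sigma> > 0\<close>. It is positive and finite and cancels at the end.\<close>
  define c where "c = ennreal (2 * pi ^ 3)"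
  have H1: "H \<sigma> x = (\<integral>\<^sup>+v. ennreal (2 * poisson_kernel 1 v) * chord_moment q N x (\<sigma> *\<^sub>R v) \<partial>lborel)" if "0 < \<sigma>" for \<sigma> x
    unfolding H_def using poisson_kernel_dilation[OF that cm3, of x]
    by (simp add: ennreal_mult' mult.assoc nn_integral_cmult)
  have mass: "(\<integral>\<^sup>+v. ennreal (2 * poisson_kernel 1 v) * k \<partial>lborel) = c * k" for k
    by (simp add: ennreal_mult' mult.assoc nn_integral_cmult nn_integral_multc poisson_kernel_mass c_def)
  have upper: "H \<sigma> x \<le> c * chord_moment q N x 0" if "0 < \<sigma>" "x \<noteq> 0" for \<sigma> x
    unfolding H1[OF that(1)] mass[symmetric]
    by (intro nn_integral_mono mult_left_mono chord_moment_le[OF N q that(2)]) simp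
  have lower: "c * chord_moment q N x 0 \<le> liminf (\<lambda>j. H (1 / real (Suc j)) x)" if x: "x \<noteq> 0" for x
  proof -
    have lim: "(\<lambda>j. 1 / real (Suc j)) \<longlonglongrightarrow> 0" by (rule LIMSEQ_Suc[OF lim_1_over_n])
    have "c * chord_moment q N x 0 \<le> (\<integral>\<^sup>+v. liminf (\<lambda>j. ennreal (2 * poisson_kernel 1 v) * chord_moment q N x ((1 / real (Suc j)) *\<^sub>R v)) \<partial>lborel)"
      unfolding mass[symmetric]
    proof (rule nn_integral_mono)
      fix v
      show "ennreal (2 * poisson_kernel 1 v) * chord_moment q N x 0 \<le> liminf (\<lambda>j. ennreal (2 * poisson_kernel 1 v) * chord_moment q N x ((1 / real (Suc j)) *\<^sub>R v))"
        using mult_left_mono[OF chord_moment_liminf[OF N q x lim, of v], of "ennreal (2 * poisson_kernel 1 v)"]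
        by (subst Liminf_compose_continuous_mono[where f="\<lambda>t. ennreal (2 * poisson_kernel 1 v) * t"])
          (auto intro!: monoI mult_left_mono ennreal_continuous_on_cmult continuous_on_id)
    qed
    also have "\<dots> \<le> liminf (\<lambda>j. H (1 / real (Suc j)) x)"
      unfolding H1[OF divide_pos_pos[OF zero_less_one of_nat_0_less_iff[THEN iffD2, OF zero_less_Suc]]]
      by (rule nn_integral_liminf) measurable
    finally show ?thesis .
  qed
  have AE0: "AE x in \<kappa>. x \<noteq> 0" if "moment_measure p \<kappa>" for \<kappa> :: "((real \<times> real) \<times> real) measure"
    using AE_snd[OF that] by eventually_elim auto
  have [measurable_cong]: "sets \<mu> = sets borel" "sets \<nu> = sets borel" using \<mu> \<nu> by (auto simp: moment_measure_def)
  have "c * (\<integral>\<^sup>+x. chord_moment q N x 0 \<partial>\<mu>) = (\<integral>\<^sup>+x. c * chord_moment q N x 0 \<partial>\<mu>)"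
    by (simp add: nn_integral_cmult)
  also have "\<dots> \<le> (\<integral>\<^sup>+x. liminf (\<lambda>j. H (1 / real (Suc j)) x) \<partial>\<mu>)"
    by (intro nn_integral_mono_AE eventually_mono[OF AE0[OF \<mu>]] lower)
  also have "\<dots> \<le> liminf (\<lambda>j. \<integral>\<^sup>+x. H (1 / real (Suc j)) x \<partial>\<mu>)"
    by (rule nn_integral_liminf) measurable
  also have "\<dots> \<le> liminf (\<lambda>j. c * (\<integral>\<^sup>+x. chord_moment q N x 0 \<partial>\<nu>))"
  proof (intro Liminf_mono always_eventually allI)
    fix j
    have \<sigma>: "0 < 1 / real (Suc j)" by simp
    have "(\<integral>\<^sup>+x. H (1 / real (Suc j)) x \<partial>\<mu>) \<le> (\<integral>\<^sup>+x. H (1 / real (Suc j)) x \<partial>\<nu>)"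
      unfolding H_int[OF \<sigma> \<mu>] H_int[OF \<sigma> \<nu>] by (intro nn_integral_mono mult_right_mono le[rule_format]) simp
    also have "\<dots> \<le> (\<integral>\<^sup>+x. c * chord_moment q N x 0 \<partial>\<nu>)"
      using AE0[OF \<nu>] upper[OF \<sigma>] by (intro nn_integral_mono_AE) auto
    also have "\<dots> = c * (\<integral>\<^sup>+x. chord_moment q N x 0 \<partial>\<nu>)" by (simp add: nn_integral_cmult)
    finally show "(\<integral>\<^sup>+x. H (1 / real (Suc j)) x \<partial>\<mu>) \<le> c * (\<integral>\<^sup>+x. chord_moment q N x 0 \<partial>\<nu>)" .
  qed
  also have "\<dots> = c * (\<integral>\<^sup>+x. chord_moment q N x 0 \<partial>\<nu>)" by (simp add: Liminf_const)
  finally have main: "(\<integral>\<^sup>+x. chord_moment q N x 0 \<partial>\<mu>) \<le> (\<integral>\<^sup>+x. chord_moment q N x 0 \<partial>\<nu>)"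
    by (simp add: c_def ennreal_mult_le_mult_iff ennreal_eq_0_iff not_le)
  have "(\<integral>\<^sup>+x. chord_moment q N x 0 \<partial>\<kappa>) = ennreal (2 / q) * norm_moment p \<kappa> N"
    if \<kappa>: "moment_measure p \<kappa>" for \<kappa>
  proof -
    have [measurable_cong]: "sets \<kappa> = sets borel" using \<kappa> by (simp add: moment_measure_def)
    have "(\<integral>\<^sup>+x. chord_moment q N x 0 \<partial>\<kappa>) = (\<integral>\<^sup>+x. ennreal (2 / q) * ennreal (N x powr p) \<partial>\<kappa>)"
    proof (rule nn_integral_cong_AE, rule eventually_mono[OF AE0[OF \<kappa>]])
      fix x :: "(real \<times> real) \<times> real" assume x: "x \<noteq> 0"
      have "p = - q" by (simp add: q_def)
      thus "chord_moment q N x 0 = ennreal (2 / q) * ennreal (N x powr p)"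
        using q chord_moment_zero[OF N q(1) x] by (simp only: ennreal_mult'[symmetric] divide_nonneg_nonneg less_imp_le zero_le_numeral)
    qed
    thus ?thesis by (simp add: nn_integral_cmult)
  qed
  from this[OF \<mu>] this[OF \<nu>] main q
  show "norm_moment p \<mu> N \<le> norm_moment p \<nu> N"
    by (simp add: ennreal_mult_le_mult_iff ennreal_eq_0_iff not_le)
qed

subsection \<open>Centroid bodies\<close>


text \<open>Lebesgue measure is determined by its values on boxes. Since \<open>T\<close> matches
  the two bases, the preimage of a box is a box with the same side lengths.\<close>

lemma lborel_distr_basis_iso:
  fixes T :: "'a::euclidean_space \<Rightarrow> 'b::euclidean_space"
  assumes T: "linear T" and TS: "\<And>y. T (S y) = y"
    and iso: "\<And>x y. T x \<bullet> T y = x \<bullet> y" and basis: "T ` Basis = Basis"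
  shows "distr lborel borel T = lborel"
proof (rule lborel_eqI[symmetric])
  fix l u :: 'b assume lu: "\<And>b. b \<in> Basis \<Longrightarrow> l \<bullet> b \<le> u \<bullet> b"
  have [measurable]: "T \<in> borel_measurable borel"
    using T by (simp add: linear_linear borel_measurable_continuous_onI linear_continuous_on)
  have adj: "y \<bullet> T c = S y \<bullet> c" for y c using iso[of "S y" c] by (simp add: TS)
  have "T -` box l u = box (S l) (S u)"
  proof -
    have "(\<forall>b\<in>T ` Basis. l \<bullet> b < T x \<bullet> b \<and> T x \<bullet> b < u \<bullet> b) \<longleftrightarrow> (\<forall>b\<in>Basis. S l \<bullet> b < x \<bullet> b \<and> x \<bullet> b < S u \<bullet> b)" for x
      by (simp add: adj[of l] adj[of u] iso)
    thus ?thesis unfolding basis by (auto simp: box_def)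
  qed
  hence "emeasure (distr lborel borel T) (box l u) = emeasure lborel (box (S l) (S u))"
    by (simp add: emeasure_distr)
  also have "\<dots> = (\<Prod>b\<in>Basis. (S u - S l) \<bullet> b)"
  proof (rule emeasure_lborel_box)
    fix b :: 'a assume "b \<in> Basis"
    hence "T b \<in> Basis" using basis by auto
    from lu[OF this] show "S l \<bullet> b \<le> S u \<bullet> b" by (simp add: adj)
  qed
  also have "(\<Prod>b\<in>Basis. (S u - S l) \<bullet> b) = (\<Prod>b\<in>T ` Basis. (u - l) \<bullet> b)"
  proof -
    have "inj_on T Basis"
    proof (rule inj_onI)
      fix x y assume "T x = T y"
      hence "(x - y) \<bullet> (x - y) = 0" using iso[of "x - y" "x - y"] T by (simp add: linear_diff)
      thus "x = y" by simp
    qed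
    thus ?thesis by (simp add: prod.reindex inner_diff_left adj)
  qed
  finally show "emeasure (distr lborel borel T) (box l u) = (\<Prod>b\<in>Basis. (u - l) \<bullet> b)"
    by (simp only: basis)
qed simp

abbreviation ball_moment :: "real \<Rightarrow> real \<Rightarrow> 'a::euclidean_space \<Rightarrow> ennreal" where
  "ball_moment p R \<xi> \<equiv> (\<integral>\<^sup>+x\<in>cball 0 R. ennreal (\<bar>x \<bullet> \<xi>\<bar> powr p) \<partial>lborel)"

text \<open>Finiteness guards the centroid functional: a non-integrable power would have Bochner
  integral 0 and give it a junk value.\<close>

definition moments_finite :: "real \<Rightarrow> 'a::euclidean_space itself \<Rightarrow> bool" where
  "moments_finite p _ \<longleftrightarrow> (\<forall>(\<xi>::'a) R. \<xi> \<noteq> 0 \<longrightarrow> ball_moment p R \<xi> < \<infinity>)"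

text \<open>The bound is uniform in the offset \<open>a\<close>, so it can be integrated over
  further coordinates. The term \<open>2 / (1 + p)\<close> comes from splitting at distance 1 from
  the singularity.\<close>

lemma nn_integral_affine_powr_le:
  assumes p: "-1 < p" "p < 0" and c: "c \<noteq> 0"
  shows "(\<integral>\<^sup>+t\<in>{-R..R}. ennreal (\<bar>a + t * c\<bar> powr p) \<partial>lborel) \<le> ennreal (\<bar>c\<bar> powr p * (2 * \<bar>R\<bar> + 2 / (1 + p)))"
proof -
  have fac: "\<bar>a + t * c\<bar> = \<bar>c\<bar> * \<bar>t - (- a / c)\<bar>" for t
  proof -
    have "a + t * c = c * (t - (- a / c))" using c by (simp add: field_simps)
    thus ?thesis by (simp only: abs_mult)
  qed
  have "(\<integral>\<^sup>+t\<in>{-R..R}. ennreal (\<bar>a + t * c\<bar> powr p) \<partial>lborel)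
     = ennreal (\<bar>c\<bar> powr p) * (\<integral>\<^sup>+t. ennreal (\<bar>t - (- a / c)\<bar> powr - (- p)) * indicator {-R..R} t \<partial>lborel)"
    unfolding fac by (subst nn_integral_cmult[symmetric]) (simp_all add: powr_mult ennreal_mult mult.assoc)
  also have "\<dots> \<le> ennreal (\<bar>c\<bar> powr p) * (ennreal (1 powr - (- p)) * (\<integral>\<^sup>+t. indicator {-R..R} t \<partial>lborel) +
     ennreal (2 * (1 powr (1 - (- p)) / (1 - (- p)))) * 1)"
    using p by (intro mult_left_mono nn_integral_singular_kernel_le) (auto simp: indicator_def)
  also have "\<dots> \<le> ennreal (\<bar>c\<bar> powr p) * (ennreal (2 * \<bar>R\<bar>) + ennreal (2 / (1 + p)))"
  proof -
    have "emeasure lborel {-R..R} \<le> ennreal (2 * \<bar>R\<bar>)" by (cases "0 \<le> R") auto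
    thus ?thesis by (intro mult_left_mono add_mono) auto
  qed
  also have "\<dots> = ennreal (\<bar>c\<bar> powr p * (2 * \<bar>R\<bar> + 2 / (1 + p)))"
    using p by (simp add: ennreal_mult ennreal_plus)
  finally show ?thesis .
qed

lemma moments_finite_real:
  assumes p: "-1 < p" "p < 0"
  shows "moments_finite p TYPE(real)"
  unfolding moments_finite_def
proof (intro allI impI)
  fix \<xi> R :: real assume "\<xi> \<noteq> 0"
  have "cball 0 R = {-R..R}" by (auto simp: dist_real_def)
  hence "ball_moment p R \<xi> \<le> ennreal (\<bar>\<xi>\<bar> powr p * (2 * \<bar>R\<bar> + 2 / (1 + p)))"
    using nn_integral_affine_powr_le[OF p \<open>\<xi> \<noteq> 0\<close>, where R=R and a=0] by (simp only: inner_real_def add_0)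
  thus "ball_moment p R \<xi> < \<infinity>" by (rule le_less_trans) simp
qed

text \<open>The ball is enlarged to a cylinder. If the last coordinate of \<open>\<xi>\<close> is
  nonzero, integrating along it gives a bound uniform in the others; otherwise the moment factors
  through the lower-dimensional one.\<close>

lemma moments_finite_prod:
  assumes p: "-1 < p" "p < 0" and fin: "moments_finite p TYPE('b::euclidean_space)"
  shows "moments_finite p TYPE('b \<times> real)"
  unfolding moments_finite_def
proof (intro allI impI)
  fix \<xi> :: "'b \<times> real" and R :: real assume \<xi>: "\<xi> \<noteq> 0"
  define g where "g z t = ennreal (\<bar>z \<bullet> fst \<xi> + t * snd \<xi>\<bar> powr p) * (indicator (cball 0 R) z * indicator {-R..R} t)" for z t
  have [measurable]: "cball (0::'b) R \<in> sets borel" "{-R..R} \<in> sets borel" by simp_all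
  have [measurable]: "case_prod g \<in> borel_measurable (lborel \<Otimes>\<^sub>M lborel)"
    unfolding g_def by measurable
  have "ball_moment p R \<xi> \<le> (\<integral>\<^sup>+x. g (fst x) (snd x) \<partial>lborel)"
  proof (rule nn_integral_mono)
    fix x :: "'b \<times> real"
    have "norm (fst x) \<le> norm x" "\<bar>snd x\<bar> \<le> norm x"
      using norm_fst_le[of "fst x" "snd x"] norm_snd_le[of "snd x" "fst x"] by simp_all
    thus "ennreal (\<bar>x \<bullet> \<xi>\<bar> powr p) * indicator (cball 0 R) x \<le> g (fst x) (snd x)"
      by (auto simp: g_def indicator_def inner_prod_def)
  qed
  also have "\<dots> = (\<integral>\<^sup>+z. (\<integral>\<^sup>+t. g z t \<partial>lborel) \<partial>lborel)"
  proof -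
    have "(\<lambda>x. g (fst x) (snd x)) \<in> borel_measurable borel"
      using \<open>case_prod g \<in> _\<close> by (simp add: lborel_prod case_prod_beta')
    thus ?thesis using lborel.nn_integral_fst[of "case_prod g" lborel] by (simp add: lborel_prod case_prod_beta')
  qed
  also have "\<dots> < \<infinity>"
  proof (cases "snd \<xi> = 0")
    case True
    hence \<xi>1: "fst \<xi> \<noteq> 0" using \<xi> by (simp add: prod_eq_iff)
    have "(\<integral>\<^sup>+z. (\<integral>\<^sup>+t. g z t \<partial>lborel) \<partial>lborel) = (\<integral>\<^sup>+z\<in>cball 0 R. ennreal (\<bar>z \<bullet> fst \<xi>\<bar> powr p) \<partial>lborel) * emeasure lborel {-R..R}"
      by (simp add: g_def True nn_integral_cmult nn_integral_multc flip: mult.assoc)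
    also have "\<dots> < \<infinity>"
      using fin \<xi>1 emeasure_compact_finite[of "{-R..R}"] by (simp add: moments_finite_def ennreal_mult_less_top)
    finally show ?thesis .
  next
    case False
    have "(\<integral>\<^sup>+z. (\<integral>\<^sup>+t. g z t \<partial>lborel) \<partial>lborel) \<le> (\<integral>\<^sup>+z. ennreal (\<bar>snd \<xi>\<bar> powr p * (2 * \<bar>R\<bar> + 2 / (1 + p))) * indicator (cball 0 R :: 'b set) z \<partial>lborel)"
    proof (rule nn_integral_mono)
      fix z
      have "(\<integral>\<^sup>+t. g z t \<partial>lborel) = (\<integral>\<^sup>+t\<in>{-R..R}. ennreal (\<bar>z \<bullet> fst \<xi> + t * snd \<xi>\<bar> powr p) \<partial>lborel) * indicator (cball 0 R) z"
        unfolding g_def by (subst nn_integral_multc[symmetric]) (simp_all add: mult_ac)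
      also have "\<dots> \<le> ennreal (\<bar>snd \<xi>\<bar> powr p * (2 * \<bar>R\<bar> + 2 / (1 + p))) * indicator (cball 0 R) z"
        by (intro mult_right_mono nn_integral_affine_powr_le p False) simp
      finally show "(\<integral>\<^sup>+t. g z t \<partial>lborel) \<le> ennreal (\<bar>snd \<xi>\<bar> powr p * (2 * \<bar>R\<bar> + 2 / (1 + p))) * indicator (cball 0 R) z" .
    qed
    also have "\<dots> < \<infinity>"
      using emeasure_compact_finite[of "cball 0 R :: 'b set"] by (simp add: nn_integral_cmult ennreal_mult_less_top)
    finally show ?thesis .
  qed
  finally show "ball_moment p R \<xi> < \<infinity>" .
qed

lemma moments_finite_iso:
  assumes dim: "DIM('a::euclidean_space) = DIM('b::euclidean_space)"
    and fin: "moments_finite p TYPE('b)"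
  shows "moments_finite p TYPE('a)"
  unfolding moments_finite_def
proof (intro allI impI)
  fix \<xi> :: 'a and R :: real assume \<xi>: "\<xi> \<noteq> 0"
  obtain T :: "'a \<Rightarrow> 'b" and S :: "'b \<Rightarrow> 'a" where T: "linear T" "linear S" "\<And>x. S (T x) = x" "\<And>y. T (S y) = y"
    "\<And>x y. T x \<bullet> T y = x \<bullet> y" "T ` Basis = Basis"
    using linear_iso_exists[OF dim] by metis
  have [measurable]: "T \<in> borel_measurable borel"
    using T by (simp add: linear_linear borel_measurable_continuous_onI linear_continuous_on)
  have norm: "norm (T x) = norm x" for x by (simp add: norm_eq_sqrt_inner T)
  have "T \<xi> \<noteq> 0" using \<xi> norm[of \<xi>] by auto
  hence "(\<integral>\<^sup>+y\<in>cball 0 R. ennreal (\<bar>y \<bullet> T \<xi>\<bar> powr p) \<partial>lborel) < \<infinity>"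
    using fin by (simp add: moments_finite_def)
  also have "(\<integral>\<^sup>+y\<in>cball 0 R. ennreal (\<bar>y \<bullet> T \<xi>\<bar> powr p) \<partial>lborel) =
    (\<integral>\<^sup>+y\<in>cball 0 R. ennreal (\<bar>y \<bullet> T \<xi>\<bar> powr p) \<partial>distr lborel borel T)"
    by (subst lborel_distr_basis_iso[OF T(1,4,5,6)]) simp
  also have "\<dots> = ball_moment p R \<xi>"
    by (subst nn_integral_distr) (auto simp: T norm indicator_def intro!: nn_integral_cong)
  finally show "ball_moment p R \<xi> < \<infinity>" .
qed

lemma moments_finite_nonneg:
  assumes "0 \<le> p" shows "moments_finite p TYPE('a::euclidean_space)"
  unfolding moments_finite_def
proof (intro allI impI)
  fix \<xi> :: 'a and R :: real
  have "ball_moment p R \<xi> \<le> (\<integral>\<^sup>+x. ennreal ((\<bar>R\<bar> * norm \<xi>) powr p) * indicator (cball 0 R :: 'a set) x \<partial>lborel)"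
  proof (rule nn_integral_mono)
    fix x :: 'a
    show "ennreal (\<bar>x \<bullet> \<xi>\<bar> powr p) * indicator (cball 0 R) x \<le> ennreal ((\<bar>R\<bar> * norm \<xi>) powr p) * indicator (cball 0 R) x"
    proof (cases "norm x \<le> R")
      case True
      have "\<bar>x \<bullet> \<xi>\<bar> \<le> norm x * norm \<xi>" by (rule Cauchy_Schwarz_ineq2)
      also have "\<dots> \<le> \<bar>R\<bar> * norm \<xi>" using True by (intro mult_right_mono) auto
      finally show ?thesis using assms by (intro mult_right_mono ennreal_leI powr_mono2) auto
    qed simp
  qed
  also have "\<dots> < \<infinity>"
    using emeasure_compact_finite[of "cball 0 R :: 'a set"]
    by (subst nn_integral_cmult_indicator) (simp_all add: ennreal_mult_less_top)
  finally show "ball_moment p R \<xi> < \<infinity>" .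
qed

lemma moments_finite_low_dim:
  assumes "-1 < p" and dim: "DIM('a::euclidean_space) = 2 \<or> DIM('a) = 3"
  shows "moments_finite p TYPE('a)"
proof (cases "p < 0")
  case True
  note p = \<open>-1 < p\<close> True
  have 2: "moments_finite p TYPE(real \<times> real)" by (rule moments_finite_prod[OF p moments_finite_real[OF p]])
  have 3: "moments_finite p TYPE((real \<times> real) \<times> real)" by (rule moments_finite_prod[OF p 2])
  from dim show ?thesis
  proof
    assume "DIM('a) = 2" thus ?thesis by (intro moments_finite_iso[OF _ 2]) simp
  next
    assume "DIM('a) = 3" thus ?thesis by (intro moments_finite_iso[OF _ 3]) simp
  qed
qed (auto intro: moments_finite_nonneg)

lemma norm_embeds_in_Lp_transfer:
  fixes N :: "'a::euclidean_space \<Rightarrow> real"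
  assumes dim: "DIM('a) = DIM('b::euclidean_space)" and N: "norm_fun N"
    and emb: "\<And>M :: 'b \<Rightarrow> real. norm_fun M \<Longrightarrow> embeds_in_Lp p M"
  shows "embeds_in_Lp p N"
proof -
  obtain T :: "'a \<Rightarrow> 'b" and S :: "'b \<Rightarrow> 'a" where T: "linear T" "linear S" "\<And>x. S (T x) = x" "\<And>y. T (S y) = y"
    "\<And>x y. T x \<bullet> T y = x \<bullet> y"
    using linear_iso_exists[OF dim] by metis
  have "inj S" using T(4) by (rule inj_on_inverseI)
  hence "norm_fun (\<lambda>y. N (S y))" by (rule norm_fun_linear[OF N T(2)])
  thus ?thesis by (intro embeds_in_Lp_linear_iso[OF T norm_fun_measurable[OF N]] emb)
qed

lemma norm_embeds_in_Lp:
  fixes N :: "'a::euclidean_space \<Rightarrow> real"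
  assumes N: "norm_fun N" and p: "-1 < p" "p < 1"
    and dim: "DIM('a) = 2 \<or> (p < 0 \<and> DIM('a) = 3)"
  shows "embeds_in_Lp p N"
proof -
  from dim show ?thesis
  proof
    assume "DIM('a) = 2"
    thus ?thesis
      by (intro norm_embeds_in_Lp_transfer[OF _ N planar_norm_embeds_in_Lp[OF _ p]]) simp_all
  next
    assume "p < 0 \<and> DIM('a) = 3"
    thus ?thesis
      by (intro norm_embeds_in_Lp_transfer[OF _ N spatial_norm_embeds_in_Lp[OF _ p(1)]]) simp_all
  qed
qed

section \<open>Normalised Lebesgue measure and the centroid functional\<close>

definition uniform_on :: "'a::euclidean_space set \<Rightarrow> 'a measure" where
  "uniform_on K = density lborel (\<lambda>x. ennreal (1 / measure lborel K) * indicator K x)"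

lemma nn_integral_uniform_on:
  assumes [measurable]: "K \<in> sets borel" "f \<in> borel_measurable borel"
  shows "(\<integral>\<^sup>+x. f x \<partial>uniform_on K) = ennreal (1 / measure lborel K) * (\<integral>\<^sup>+x\<in>K. f x \<partial>lborel)"
  unfolding uniform_on_def
  by (subst nn_integral_density) (simp_all add: nn_integral_cmult[symmetric] mult_ac)

lemma moment_measure_uniform_on:
  fixes K :: "'a::euclidean_space set"
  assumes K: "compact K" and fin: "moments_finite p TYPE('a)"
  shows "moment_measure p (uniform_on K)"
proof -
  have [measurable]: "K \<in> sets borel" using K by (simp add: borel_compact)
  obtain R where "\<forall>x\<in>K. norm x \<le> R" using compact_imp_bounded[OF K] by (auto simp: bounded_iff)
  hence R: "K \<subseteq> cball 0 R" by auto
  have sets: "sets (uniform_on K) = sets borel" by (simp add: uniform_on_def)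
  have "emeasure (uniform_on K) (space (uniform_on K)) < \<infinity>"
    using nn_integral_uniform_on[of K "\<lambda>_. 1"] emeasure_compact_finite[OF K]
    by (simp add: ennreal_mult_less_top)
  hence "finite_measure (uniform_on K)" by (intro finite_measureI) auto
  moreover have ae: "AE x in uniform_on K. x \<bullet> \<xi> \<noteq> 0" if "\<xi> \<noteq> 0" for \<xi>
    unfolding uniform_on_def using AE_lborel_inner_neq[OF that, of 0]
    by (subst AE_density) auto
  moreover have "(\<integral>\<^sup>+x. ennreal (norm x powr p) \<partial>uniform_on K) < \<infinity>"
  proof (cases "0 \<le> p")
    case True
    have "(\<integral>\<^sup>+x. ennreal (norm x powr p) * indicator K x \<partial>lborel) \<le> (\<integral>\<^sup>+x. ennreal (\<bar>R\<bar> powr p) * indicator K x \<partial>lborel)"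
      using R True by (intro nn_integral_mono) (auto simp: indicator_def subset_iff intro!: ennreal_leI powr_mono2)
    also have "\<dots> < \<infinity>" using emeasure_compact_finite[OF K] by (simp add: nn_integral_cmult ennreal_mult_less_top)
    finally show ?thesis by (simp add: nn_integral_uniform_on ennreal_mult_less_top)
  next
    case False
    \<comment> \<open>The norm dominates each coordinate, so for negative \<open>p\<close> its power
      is at most that of a coordinate, away from a null hyperplane. A directional moment thus
      controls the moment of the norm.\<close>
    obtain b :: 'a where b: "b \<in> Basis" using nonempty_Basis by blast
    hence b0: "b \<noteq> 0" by (rule nonzero_Basis)
    have "(\<integral>\<^sup>+x. ennreal (norm x powr p) * indicator K x \<partial>lborel) \<le> (\<integral>\<^sup>+x. ennreal (\<bar>x \<bullet> b\<bar> powr p) * indicator (cball 0 R) x \<partial>lborel)"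
    proof (rule nn_integral_mono_AE)
      show "AE x in lborel. ennreal (norm x powr p) * indicator K x \<le> ennreal (\<bar>x \<bullet> b\<bar> powr p) * indicator (cball 0 R) x"
        using AE_lborel_inner_neq[OF b0, of 0]
      proof eventually_elim
        case (elim x)
        have "norm x powr p \<le> \<bar>x \<bullet> b\<bar> powr p"
          using False elim Basis_le_norm[OF b, of x] by (intro powr_mono2') auto
        thus ?case using R by (auto simp: indicator_def subset_iff intro!: ennreal_leI)
      qed
    qed
    also have "\<dots> < \<infinity>" using fin b0 by (simp add: moments_finite_def)
    finally show ?thesis by (simp add: nn_integral_uniform_on ennreal_mult_less_top)
  qed
  ultimately show ?thesis using sets by (simp add: moment_measure_def)
qed

lemma convex_body_measure:
  assumes "convex_body K"
  shows "compact K" "K \<in> sets borel" "emeasure lborel K < \<infinity>" "0 < measure lborel K" "measure lebesgue K = measure lborel K"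
proof -
  show K: "compact K" using assms by (simp add: convex_body_def)
  thus borel: "K \<in> sets borel" by (rule borel_compact)
  show fin: "emeasure lborel K < \<infinity>" using K by (rule emeasure_compact_finite)
  show "measure lebesgue K = measure lborel K" using borel by (simp add: measure_completion)
  have "open (interior K)" "interior K \<noteq> {}" using assms by (auto simp: convex_body_def)
  hence "\<not> negligible (interior K)" by (rule open_not_negligible)
  hence "emeasure lborel (interior K) \<noteq> 0" by (simp add: negligible_iff_emeasure0)
  moreover have "emeasure lborel (interior K) \<le> emeasure lborel K" using borel by (intro emeasure_mono interior_subset) auto
  ultimately show "0 < measure lborel K"
    using fin by (auto simp: measure_def enn2real_positive_iff zero_less_iff_neq_zero)
qed

text \<open>The link between the functional, built from a Bochner integral over
  \<open>lebesgue\<close>, and the extended nonnegative moments. The value is finite by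
  \<open>moments_finite\<close>, and positive because a hyperplane is null while \<open>K\<close>
  has positive volume.\<close>

lemma polar_centroid_functional_eq:
  assumes K: "convex_body K" and fin: "moments_finite p TYPE(real ^ 'n)" and \<xi>: "(\<xi> :: real ^ 'n) \<noteq> 0"
  obtains A where "0 < A" "polar_centroid_functional p K \<xi> = A powr (1 / p)"
    "directional_moment p (uniform_on K) \<xi> = ennreal A"
proof -
  note K' = convex_body_measure[OF K]
  note [measurable] = K'(2)
  define I where "I = (\<integral>x. indicator K x * \<bar>x \<bullet> \<xi>\<bar> powr p \<partial>lborel)"
  define A where "A = 1 / measure lborel K * I"
  obtain R where "\<forall>x\<in>K. norm x \<le> R" using compact_imp_bounded[OF K'(1)] by (auto simp: bounded_iff)
  hence R: "K \<subseteq> cball 0 R" by auto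
  have "(\<integral>\<^sup>+x\<in>K. ennreal (\<bar>x \<bullet> \<xi>\<bar> powr p) \<partial>lborel) \<le> ball_moment p R \<xi>"
    using R by (intro nn_integral_mono) (auto simp: indicator_def)
  also have "\<dots> < \<infinity>" using fin \<xi> by (simp add: moments_finite_def)
  finally have fin': "(\<integral>\<^sup>+x\<in>K. ennreal (\<bar>x \<bullet> \<xi>\<bar> powr p) \<partial>lborel) < \<infinity>" .
  have eq: "(\<integral>\<^sup>+x\<in>K. ennreal (\<bar>x \<bullet> \<xi>\<bar> powr p) \<partial>lborel) = (\<integral>\<^sup>+x. ennreal (indicator K x * \<bar>x \<bullet> \<xi>\<bar> powr p) \<partial>lborel)"
    by (intro nn_integral_cong) (simp add: indicator_def)
  have int: "integrable lborel (\<lambda>x. indicator K x * \<bar>x \<bullet> \<xi>\<bar> powr p)"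
    using fin' unfolding eq by (intro integrableI_bounded) (auto simp: abs_mult)
  have nn: "(\<integral>\<^sup>+x\<in>K. ennreal (\<bar>x \<bullet> \<xi>\<bar> powr p) \<partial>lborel) = ennreal I"
    unfolding eq I_def using int by (intro nn_integral_eq_integral) auto
  have "I \<noteq> 0"
  proof
    assume "I = 0"
    hence "(\<integral>\<^sup>+x\<in>K. ennreal (\<bar>x \<bullet> \<xi>\<bar> powr p) \<partial>lborel) = 0" using nn by simp
    hence "AE x in lborel. ennreal (\<bar>x \<bullet> \<xi>\<bar> powr p) * indicator K x = 0"
      by (subst (asm) nn_integral_0_iff_AE) auto
    hence "AE x in lborel. x \<notin> K"
      using AE_lborel_inner_neq[OF \<xi>, of 0] by eventually_elim (auto simp: indicator_def split: if_splits)
    hence "emeasure lborel K = 0" by (subst (asm) AE_iff_measurable[of K]) auto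
    thus False using K'(4) by (simp add: measure_def)
  qed
  moreover have "0 \<le> I" unfolding I_def by (intro integral_nonneg_AE) simp
  ultimately have "0 < A" using K'(4) by (simp add: A_def)
  moreover have "(LINT x:K|lebesgue. \<bar>x \<bullet> \<xi>\<bar> powr p) = I"
    unfolding set_lebesgue_integral_def I_def by (subst integral_completion) simp_all
  hence "polar_centroid_functional p K \<xi> = A powr (1 / p)"
    using \<xi> by (simp add: polar_centroid_functional_def A_def K'(5))
  moreover have "directional_moment p (uniform_on K) \<xi> = ennreal A"
    using K'(4) by (simp add: nn_integral_uniform_on nn A_def flip: ennreal_mult')
  ultimately show ?thesis by (rule that)
qed

lemma polar_centroid_functional_scaleR:
  assumes "0 < c" "p \<noteq> 0"
  shows "polar_centroid_functional p K (c *\<^sub>R \<xi>) = c * polar_centroid_functional p K \<xi>"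
proof (cases "\<xi> = 0")
  case False
  have "(LINT x:K|lebesgue. \<bar>x \<bullet> (c *\<^sub>R \<xi>)\<bar> powr p) = c powr p * (LINT x:K|lebesgue. \<bar>x \<bullet> \<xi>\<bar> powr p)"
    using assms by (simp add: abs_mult powr_mult)
  moreover have "0 \<le> (LINT x:K|lebesgue. \<bar>x \<bullet> \<xi>\<bar> powr p)"
    unfolding set_lebesgue_integral_def by (intro integral_nonneg_AE) simp
  ultimately show ?thesis
    using False assms by (simp add: polar_centroid_functional_def powr_mult powr_powr powr_divide)
qed (simp add: polar_centroid_functional_def)

text \<open>Scaling \<open>\<xi>\<close> by the inverse of its positive value for \<open>K\<close>
  puts it into the body of \<open>K\<close> and so into that of \<open>L\<close>; homogeneity undoes
  the scaling.\<close>

lemma polar_centroid_functional_antimono: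
  assumes K: "convex_body K" and p: "p \<noteq> 0" and fin: "moments_finite p TYPE(real ^ 'n)"
    and sub: "polar_centroid_body p K \<subseteq> polar_centroid_body p (L :: (real ^ 'n) set)" and \<xi>: "\<xi> \<noteq> 0"
  shows "polar_centroid_functional p L \<xi> \<le> polar_centroid_functional p K \<xi>"
proof -
  define f where "f = polar_centroid_functional p K \<xi>"
  obtain A where "0 < A" "f = A powr (1 / p)"
    unfolding f_def using polar_centroid_functional_eq[OF K fin \<xi>] by metis
  hence f: "0 < f" by simp
  hence "(1 / f) *\<^sub>R \<xi> \<in> polar_centroid_body p K"
    using p by (simp add: polar_centroid_body_def polar_centroid_functional_scaleR f_def[symmetric])
  hence "polar_centroid_functional p L ((1 / f) *\<^sub>R \<xi>) \<le> 1" using sub by (auto simp: polar_centroid_body_def)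
  thus ?thesis using f p by (simp add: polar_centroid_functional_scaleR f_def[symmetric])
qed

lemma measure_le_of_polar_centroid_body_subset:
  fixes p :: real and K L :: "(real ^ 'n) set"
  assumes p: "-1 < p" "p < 1" "p \<noteq> 0"
    and dim: "CARD('n) = 2 \<or> (p < 0 \<and> CARD('n) = 3)"
    and K: "convex_body K" "origin_symmetric K" and L: "convex_body L"
    and sub: "polar_centroid_body p K \<subseteq> polar_centroid_body p L"
  shows "measure lebesgue L \<le> measure lebesgue K"
proof -
  have fin: "moments_finite p TYPE(real ^ 'n)" using p dim by (intro moments_finite_low_dim) auto
  note K' = convex_body_measure[OF K(1)] and L' = convex_body_measure[OF L]
  note [measurable] = K'(2) L'(2)
  obtain N where N: "norm_fun N" and KN: "K = {x. N x \<le> 1}"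
    using symmetric_convex_body_norm_fun[of K] K by (metis convex_body_def origin_symmetric_def)
  note [measurable] = norm_fun_measurable[OF N]
  have emb: "embeds_in_Lp p N" using N p dim by (intro norm_embeds_in_Lp) auto
  have mK: "moment_measure p (uniform_on K)" and mL: "moment_measure p (uniform_on L)"
    using K'(1) L'(1) fin by (auto intro: moment_measure_uniform_on)
  \<comment> \<open>Removing the outer power \<open>1 / p\<close> keeps the order for
    \<open>p > 0\<close> and reverses it for \<open>p < 0\<close>. At \<open>\<xi> = 0\<close> both
    moments vanish, as \<open>0 powr p = 0\<close>.\<close>
  have le: "if 0 < p then directional_moment p (uniform_on L) \<xi> \<le> directional_moment p (uniform_on K) \<xi>
    else directional_moment p (uniform_on K) \<xi> \<le> directional_moment p (uniform_on L) \<xi>" for \<xi>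
  proof (cases "\<xi> = 0")
    case False
    obtain A where A: "0 < A" "polar_centroid_functional p K \<xi> = A powr (1 / p)"
      "directional_moment p (uniform_on K) \<xi> = ennreal A"
      using polar_centroid_functional_eq[OF K(1) fin False] by metis
    obtain B where B: "0 < B" "polar_centroid_functional p L \<xi> = B powr (1 / p)"
      "directional_moment p (uniform_on L) \<xi> = ennreal B"
      using polar_centroid_functional_eq[OF L fin False] by metis
    have BA: "B powr (1 / p) \<le> A powr (1 / p)"
      using polar_centroid_functional_antimono[OF K(1) p(3) fin sub False] by (simp add: A B)
    have "B \<le> A" if "0 < p"
    proof (rule ccontr)
      assume "\<not> B \<le> A"
      hence "A powr (1 / p) < B powr (1 / p)" using that A by (intro powr_less_mono2) auto
      thus False using BA by simp
    qed
    moreover have "A \<le> B" if "\<not> 0 < p"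
    proof (rule ccontr)
      assume "\<not> A \<le> B"
      hence "A powr (1 / p) < B powr (1 / p)" using that p(3) B by (intro powr_less_mono2_neg) auto
      thus False using BA by simp
    qed
    ultimately show ?thesis by (auto simp: A B intro: ennreal_leI)
  qed simp
  \<comment> \<open>\<open>N\<close> is equivalent to the Euclidean norm. Both constants enter,
    because for \<open>p < 0\<close> it is the lower one that bounds the power from above.\<close>
  have I: "(\<integral>\<^sup>+x\<in>K. ennreal (N x powr p) \<partial>lborel) < \<infinity>"
  proof -
    obtain c C where c: "0 < c" "0 < C" "\<And>x. c * norm x \<le> N x" "\<And>x. N x \<le> C * norm x"
      using norm_fun_bounds[OF N] by metis
    have "norm_moment p (uniform_on K) N \<le> (\<integral>\<^sup>+x. ennreal (c powr p + C powr p) * ennreal (norm x powr p) \<partial>uniform_on K)"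
    proof (rule nn_integral_mono)
      fix x
      have "N x powr p \<le> (c powr p + C powr p) * norm x powr p"
      proof (cases "x = 0 \<or> 0 < p")
        case True
        hence "N x powr p \<le> (C * norm x) powr p"
          using c(4)[of x] norm_fun_nonneg[OF N] norm_fun_zero[OF N] by (auto intro: powr_mono2)
        also have "\<dots> \<le> (c powr p + C powr p) * norm x powr p"
          using c by (simp add: powr_mult mult_right_mono)
        finally show ?thesis .
      next
        case False
        hence "N x powr p \<le> (c * norm x) powr p" using c p by (intro powr_mono2') auto
        also have "\<dots> \<le> (c powr p + C powr p) * norm x powr p"
          using c by (simp add: powr_mult mult_right_mono)
        finally show ?thesis .
      qed
      hence "ennreal (N x powr p) \<le> ennreal ((c powr p + C powr p) * norm x powr p)" by (rule ennreal_leI)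
      also have "\<dots> = ennreal (c powr p + C powr p) * ennreal (norm x powr p)" by (rule ennreal_mult') simp
      finally show "ennreal (N x powr p) \<le> ennreal (c powr p + C powr p) * ennreal (norm x powr p)" .
    qed
    also have "\<dots> < \<infinity>"
    proof -
      have [measurable_cong]: "sets (uniform_on K) = sets borel" by (simp add: uniform_on_def)
      show ?thesis using mK by (simp add: nn_integral_cmult moment_measure_def ennreal_mult_less_top)
    qed
    finally have "ennreal (1 / measure lborel K) * (\<integral>\<^sup>+x\<in>K. ennreal (N x powr p) \<partial>lborel) < \<infinity>"
      by (simp add: nn_integral_uniform_on)
    thus ?thesis using K'(4) by (auto simp: ennreal_mult_less_top)
  qed
  have "measure lborel L \<le> measure lborel K"
    unfolding KN
  proof (rule volume_comparison_of_norm_moments[OF N p(3)])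
    show "L \<in> sets borel" "0 < measure lborel L" "emeasure lborel L < \<infinity>" by (fact L')+
    show "0 < measure lborel {x. N x \<le> 1}" "(\<integral>\<^sup>+x\<in>{x. N x \<le> 1}. ennreal (N x powr p) \<partial>lborel) < \<infinity>"
      using K'(4) I by (simp_all only: KN[symmetric])
    show "ennreal (1 / measure lborel {x. N x \<le> 1}) * (\<integral>\<^sup>+x\<in>{x. N x \<le> 1}. ennreal (N x powr p) \<partial>lborel)
       \<le> ennreal (1 / measure lborel L) * (\<integral>\<^sup>+x\<in>L. ennreal (N x powr p) \<partial>lborel)" if "p < 0"
      using emb[unfolded embeds_in_Lp_def, rule_format, OF mK mL] le that
      by (simp add: nn_integral_uniform_on KN[symmetric])
    show "ennreal (1 / measure lborel L) * (\<integral>\<^sup>+x\<in>L. ennreal (N x powr p) \<partial>lborel)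
       \<le> ennreal (1 / measure lborel {x. N x \<le> 1}) * (\<integral>\<^sup>+x\<in>{x. N x \<le> 1}. ennreal (N x powr p) \<partial>lborel)" if "0 < p"
      using emb[unfolded embeds_in_Lp_def, rule_format, OF mL mK] le that
      by (simp add: nn_integral_uniform_on KN[symmetric])
  qed
  thus ?thesis by (simp only: K'(5) L'(5))
qed

theorem corollary2p2:
  fixes p :: real and K L :: "(real ^ 'n) set"
  assumes "-1 < p" and "p < 1" and "p \<noteq> 0"
    and "convex_body K" and "origin_symmetric K"
    and "convex_body L" and "origin_symmetric L"
    and "polar_centroid_body p K \<subseteq> polar_centroid_body p L"
  shows "(0 < p \<and> p < 1 \<and> CARD('n) = 2
            \<longrightarrow> measure lebesgue L \<le> measure lebesgue K) \<and>
         (-1 < p \<and> p < 0 \<and> (CARD('n) = 2 \<or> CARD('n) = 3)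
            \<longrightarrow> measure lebesgue L \<le> measure lebesgue K)"
  using measure_le_of_polar_centroid_body_subset[OF assms(1-3) _ assms(4-6,8)] by blast

end
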